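(* Assume (Mon), (RegFG) and (RegH): (Mon) for all $m,m'\in P(\Sigma)$, $\sum_{x\in\Sigma}(F(x,m)-F(x,m'))(m(x)-m'(x))\ge0$, and the same holds for $G$; (RegFG) $F$ and $G$ are $C^1$ with respect to $m$, with $D^mF$ and $D^mG$ bounded and Lipschitz continuous; (RegH) for $|p|\le K$, $H$ is $C^2$ with respect to $p$; $H$, $D_pH$ and $D^2_{pp}H$ are Lipschitz in $p$; and there is a constant $C>0$ with $D^2_{pp}H(x,p)\ge C^{-1}$ (in the sense of quadratic forms). Then there exists a unique classical solution $U:[0,T]\times\Sigma\times P(\Sigma)\to\mathbb R$ to the Master Equation $$-\frac{\partial U}{\partial t}+H(x,\Delta^xU)-\int_\Sigma D^mU(t,x,m,y)\cdot\alpha^*(y,\Delta^yU(t,y,m))\,dm(y)=F(x,m),\qquad U(T,x,m)=G(x,m).$$ Moreover it is regular.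
   Context: **Basic notation.** $\Sigma=\{1,\dots,d\}$, $T>0$, $0<\kappa<M$, $A=[\kappa,M]^d$, $P(\Sigma)=\{m\in\mathbb R^d: m_j\ge0,\ m_1+\dots+m_d=1\}$ (we write $m(x)=m_x$). $L:\Sigma\times A\to\mathbb R$ is continuous in its second argument, $H(x,p):=\sup_{\alpha\in A}\{-\alpha\cdot p-L(x,\alpha)\}$ for $x\in\Sigma$, $p\in\mathbb R^d$, and the maximizer is assumed unique for every $(x,p)$ and denoted $\alpha^*(x,p)\in A$ (so $\alpha^*=-D_pH$ where $H$ is differentiable). $F,G:\Sigma\times P(\Sigma)\to\mathbb R$ are the costs. $\Delta^xU(t,x,m)=(U(t,y,m)-U(t,x,m))_{y=1,\dots,d}\in\mathbb R^d$. **Derivatives on the simplex.** $g:P(\Sigma)\to\mathbb R$ is differentiable if there is $D^mg:P(\Sigma)\times\Sigma\to\mathbb R^d$ with $[D^mg(m,y)]_z=\lim_{s\to0^+}\frac{g(m+s(\delta_z-\delta_y))-g(m)}{s}$, $z=1,\dots,d$ (at boundary points only admissible directions are considered). $g$ is $C^1$ if $D^mg$ is continuous in $m$. **Solutions.** A classical solution is a function $U$, continuous in all arguments, $C^1$ in $t$ and $C^1$ in $m$, satisfying the equation at every $(t,x,m)\in[0,T]\times\Sigma\times P(\Sigma)$ and the terminal condition (in particular $\Delta^xU(t,x,\cdot)$ is bounded and Lipschitz continuous and $D^mU(t,x,\cdot)$ is bounded). A regular solution is a classical solution for which $D^mU(t,x,\cdot)$ is moreover Lipschitz continuous in $m$,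 uniformly in $(t,x)$. **The constant $K$.** $K>0$ is a fixed constant, sufficiently large that the finite differences of the value functions at which $H$ and $\alpha^*$ are evaluated have norm at most $K$ (these finite differences are a priori bounded). *)

theory Defs
  imports "HOL-Analysis.Analysis"
begin

text \<open>
  The finite state space is a finite type 'd, and real^'d is the space of vectors
  indexed by it. Functions on the simplex are total functions of which only the values on
  the simplex matter.
\<close>

definition simplex_P :: "(real ^ 'd::finite) set" where
  "simplex_P = {m. (\<forall>j. 0 \<le> m $ j) \<and> (\<Sum>j\<in>UNIV. m $ j) = 1}"

definition ctrl_set :: "real \<Rightarrow> real \<Rightarrow> (real ^ 'd::finite) set" where
  "ctrl_set \<kappa> M = {a. \<forall>j. \<kappa> \<le> a $ j \<and> a $ j \<le> M}"

definition fdiff :: "('d::finite \<Rightarrow> real) \<Rightarrow> 'd \<Rightarrow> real ^ 'd" where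
  "fdiff v x = (\<chi> y. v y - v x)"

definition Ham :: "real \<Rightarrow> real \<Rightarrow> ('d::finite \<Rightarrow> real ^ 'd \<Rightarrow> real) \<Rightarrow> 'd \<Rightarrow> real ^ 'd \<Rightarrow> real" where
  "Ham \<kappa> M L x p = (SUP a \<in> ctrl_set \<kappa> M. - (a \<bullet> p) - L x a)"

definition is_maximizer ::
  "real \<Rightarrow> real \<Rightarrow> ('d::finite \<Rightarrow> real ^ 'd \<Rightarrow> real) \<Rightarrow> 'd \<Rightarrow> real ^ 'd \<Rightarrow> real ^ 'd \<Rightarrow> bool" where
  "is_maximizer \<kappa> M L x p a \<longleftrightarrow>
     a \<in> ctrl_set \<kappa> M \<and> (\<forall>b \<in> ctrl_set \<kappa> M. - (b \<bullet> p) - L x b \<le> - (a \<bullet> p) - L x a)"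

definition opt_ctrl ::
  "real \<Rightarrow> real \<Rightarrow> ('d::finite \<Rightarrow> real ^ 'd \<Rightarrow> real) \<Rightarrow> 'd \<Rightarrow> real ^ 'd \<Rightarrow> real ^ 'd" where
  "opt_ctrl \<kappa> M L x p = (THE a. is_maximizer \<kappa> M L x p a)"

definition direction :: "'d::finite \<Rightarrow> 'd \<Rightarrow> real ^ 'd" where
  "direction y z = axis z 1 - axis y 1"

definition admissible :: "real ^ 'd::finite \<Rightarrow> 'd \<Rightarrow> 'd \<Rightarrow> bool" where
  "admissible m y z \<longleftrightarrow> (\<exists>\<epsilon>>0. \<forall>s\<in>{0<..<\<epsilon>}. m + s *\<^sub>R direction y z \<in> simplex_P)"

definition has_simplex_derivative ::
  "(real ^ 'd::finite \<Rightarrow> real) \<Rightarrow> (real ^ 'd \<Rightarrow> 'd \<Rightarrow> real ^ 'd) \<Rightarrow> bool" where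
  "has_simplex_derivative g D \<longleftrightarrow>
     (\<forall>m\<in>simplex_P. \<forall>y z. admissible m y z \<longrightarrow>
        ((\<lambda>s. (g (m + s *\<^sub>R direction y z) - g m) / s) \<longlongrightarrow> D m y $ z) (at_right 0))"

text \<open>
  At points with positive entries every direction is admissible, and these points are dense
  in the simplex. Hence the continuity required here determines D on the whole simplex, also
  in the components that belong to inadmissible directions.
\<close>

definition C1_simplex ::
  "(real ^ 'd::finite \<Rightarrow> real) \<Rightarrow> (real ^ 'd \<Rightarrow> 'd \<Rightarrow> real ^ 'd) \<Rightarrow> bool" where
  "C1_simplex g D \<longleftrightarrow>
     has_simplex_derivative g D \<and> (\<forall>y. continuous_on simplex_P (\<lambda>m. D m y))"

definition Mon :: "('d::finite \<Rightarrow> real ^ 'd \<Rightarrow> real) \<Rightarrow> bool" where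
  "Mon F \<longleftrightarrow>
     (\<forall>m\<in>simplex_P. \<forall>m'\<in>simplex_P. (\<Sum>x\<in>UNIV. (F x m - F x m') * (m $ x - m' $ x)) \<ge> 0)"

definition RegCost :: "('d::finite \<Rightarrow> real ^ 'd \<Rightarrow> real) \<Rightarrow> bool" where
  "RegCost F \<longleftrightarrow>
     (\<exists>DF. (\<forall>x. C1_simplex (F x) (DF x)) \<and>
           (\<forall>x y. bounded ((\<lambda>m. DF x m y) ` simplex_P)) \<and>
           (\<exists>C. \<forall>x y. C-lipschitz_on simplex_P (\<lambda>m. DF x m y)))"

text \<open>
  Derivatives are taken relative to the closed ball of radius K, so that nothing is required
  of H outside it.
\<close>

definition RegH :: "real \<Rightarrow> ('d::finite \<Rightarrow> real ^ 'd \<Rightarrow> real) \<Rightarrow> bool" where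
  "RegH K H \<longleftrightarrow>
     (\<exists>(DH :: 'd \<Rightarrow> real ^ 'd \<Rightarrow> real ^ 'd) (D2H :: 'd \<Rightarrow> real ^ 'd \<Rightarrow> real ^ 'd ^ 'd).
        (\<forall>x. \<forall>p\<in>cball 0 K.
           (H x has_derivative (\<lambda>h. DH x p \<bullet> h)) (at p within cball 0 K) \<and>
           (DH x has_derivative (\<lambda>h. D2H x p *v h)) (at p within cball 0 K)) \<and>
        (\<forall>x. continuous_on (cball 0 K) (D2H x)) \<and>
        (\<exists>C. \<forall>x. C-lipschitz_on (cball 0 K) (H x) \<and>
                 C-lipschitz_on (cball 0 K) (DH x) \<and>
                 C-lipschitz_on (cball 0 K) (D2H x)) \<and>
        (\<exists>C>0. \<forall>x. \<forall>p\<in>cball 0 K. \<forall>h. h \<bullet> (D2H x p *v h) \<ge> inverse C * (norm h)\<^sup>2))"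

text \<open>
  u is the value function of a single player who faces the flow m of distributions: it solves
  the Hamilton-Jacobi-Bellman equation of that player's control problem.
\<close>

definition value_function ::
  "real \<Rightarrow> ('d::finite \<Rightarrow> real ^ 'd \<Rightarrow> real) \<Rightarrow> ('d \<Rightarrow> real ^ 'd \<Rightarrow> real) \<Rightarrow>
   ('d \<Rightarrow> real ^ 'd \<Rightarrow> real) \<Rightarrow> (real \<Rightarrow> real ^ 'd) \<Rightarrow> (real \<Rightarrow> 'd \<Rightarrow> real) \<Rightarrow> bool" where
  "value_function T H F G m u \<longleftrightarrow>
     (\<forall>x. \<forall>t\<in>{0..T}.
        ((\<lambda>s. u s x) has_real_derivative (H x (fdiff (u t) x) - F x (m t))) (at t within {0..T})) \<and>
     (\<forall>x. u T x = G x (m T))"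

definition bounds_value_differences ::
  "real \<Rightarrow> ('d::finite \<Rightarrow> real ^ 'd \<Rightarrow> real) \<Rightarrow> ('d \<Rightarrow> real ^ 'd \<Rightarrow> real) \<Rightarrow>
   ('d \<Rightarrow> real ^ 'd \<Rightarrow> real) \<Rightarrow> real \<Rightarrow> bool" where
  "bounds_value_differences T H F G K \<longleftrightarrow>
     (\<forall>m u. continuous_on {0..T} m \<longrightarrow> m ` {0..T} \<subseteq> simplex_P \<longrightarrow> value_function T H F G m u \<longrightarrow>
        (\<forall>t\<in>{0..T}. \<forall>x. norm (fdiff (u t) x) \<le> K))"

text \<open>
  U is a classical solution with time derivative Ut and simplex derivative DU. Both are
  determined by U on the domain; the integral over the state space with respect to m is the
  sum weighted by m.
\<close>

definition classical_solution_with ::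
  "real \<Rightarrow> ('d::finite \<Rightarrow> real ^ 'd \<Rightarrow> real) \<Rightarrow> ('d \<Rightarrow> real ^ 'd \<Rightarrow> real ^ 'd) \<Rightarrow>
   ('d \<Rightarrow> real ^ 'd \<Rightarrow> real) \<Rightarrow> ('d \<Rightarrow> real ^ 'd \<Rightarrow> real) \<Rightarrow>
   (real \<Rightarrow> 'd \<Rightarrow> real ^ 'd \<Rightarrow> real) \<Rightarrow> (real \<Rightarrow> 'd \<Rightarrow> real ^ 'd \<Rightarrow> real) \<Rightarrow>
   (real \<Rightarrow> 'd \<Rightarrow> real ^ 'd \<Rightarrow> 'd \<Rightarrow> real ^ 'd) \<Rightarrow> bool" where
  "classical_solution_with T H \<alpha> F G U Ut DU \<longleftrightarrow>
     (\<forall>x. continuous_on ({0..T} \<times> simplex_P) (\<lambda>(t, m). U t x m)) \<and>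
     (\<forall>x. \<forall>m\<in>simplex_P. continuous_on {0..T} (\<lambda>t. Ut t x m) \<and>
        (\<forall>t\<in>{0..T}. ((\<lambda>s. U s x m) has_real_derivative Ut t x m) (at t within {0..T}))) \<and>
     (\<forall>t\<in>{0..T}. \<forall>x. C1_simplex (U t x) (DU t x)) \<and>
     (\<forall>t\<in>{0..T}. \<forall>x. \<forall>m\<in>simplex_P.
        - Ut t x m + H x (fdiff (\<lambda>y. U t y m) x)
        - (\<Sum>y\<in>UNIV. m $ y * (DU t x m y \<bullet> \<alpha> y (fdiff (\<lambda>z. U t z m) y)))
        = F x m) \<and>
     (\<forall>x. \<forall>m\<in>simplex_P. U T x m = G x m)"

definition classical_solution ::
  "real \<Rightarrow> ('d::finite \<Rightarrow> real ^ 'd \<Rightarrow> real) \<Rightarrow> ('d \<Rightarrow> real ^ 'd \<Rightarrow> real ^ 'd) \<Rightarrow>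
   ('d \<Rightarrow> real ^ 'd \<Rightarrow> real) \<Rightarrow> ('d \<Rightarrow> real ^ 'd \<Rightarrow> real) \<Rightarrow>
   (real \<Rightarrow> 'd \<Rightarrow> real ^ 'd \<Rightarrow> real) \<Rightarrow> bool" where
  "classical_solution T H \<alpha> F G U \<longleftrightarrow> (\<exists>Ut DU. classical_solution_with T H \<alpha> F G U Ut DU)"

definition regular_solution ::
  "real \<Rightarrow> ('d::finite \<Rightarrow> real ^ 'd \<Rightarrow> real) \<Rightarrow> ('d \<Rightarrow> real ^ 'd \<Rightarrow> real ^ 'd) \<Rightarrow>
   ('d \<Rightarrow> real ^ 'd \<Rightarrow> real) \<Rightarrow> ('d \<Rightarrow> real ^ 'd \<Rightarrow> real) \<Rightarrow>
   (real \<Rightarrow> 'd \<Rightarrow> real ^ 'd \<Rightarrow> real) \<Rightarrow> bool" where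
  "regular_solution T H \<alpha> F G U \<longleftrightarrow>
     (\<exists>Ut DU. classical_solution_with T H \<alpha> F G U Ut DU \<and>
        (\<exists>C. \<forall>t\<in>{0..T}. \<forall>x y. C-lipschitz_on simplex_P (\<lambda>m. DU t x m y)))"

end

theory Submission
  imports Defs
begin

text \<open>
  Uniqueness. For two solutions \<open>V\<close> and \<open>W\<close> the function
  \<open>\<Phi>(t, m, m') = \<Sum>\<^sub>x (V(t, x, m) - W(t, x, m')) (m\<^sub>x - m'\<^sub>x)\<close> cannot decrease below \<open>0\<close> backwards in time:
  at a spatial minimum the transport terms have a sign, the Hamiltonian terms have one by convexity
  and the costs by monotonicity. So \<open>\<Phi> \<ge> 0\<close>; letting \<open>m \<rightarrow> m'\<close> shows that \<open>V - W\<close> does not depend on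
  \<open>x\<close>. Then \<open>V\<close> and \<open>W\<close> have the same controls, and \<open>V - W\<close> solves a linear transport equation with
  zero terminal value. Only separate derivatives in \<open>t\<close> and \<open>m\<close> are used.

  Existence. \<open>U(t, x, m)\<close> is the value at time \<open>t\<close> along the solution of the forward-backward system
  of the game started from \<open>m\<close> at time \<open>t\<close>. Monotonicity and uniform convexity make the pairing of
  two differences of solutions dissipative, which bounds the distance of two solutions by the
  distance of their initial distributions, with a constant that does not depend on the initial time.
  This bound fixes a step size with which a contraction argument continues solutions backwards to any
  initial time. The same estimate, with error terms, applies to the difference of two difference
  quotients of solutions, so the quotients depend on base point and step size in a Lipschitz way.
  Hence \<open>U\<close> has a Lipschitz derivative in \<open>m\<close>, without any solution theory for the linearized system.
  The time derivative follows from the constancy of the solution map along trajectories.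
\<close>

section \<open>One-dimensional estimates and fixed points\<close>

text \<open>All hypotheses on derivatives of \<open>H\<close> live in the ball of radius
  \<open>K\<close>, and two arguments leave that ball: Picard iterates are not value functions, and
  the finite differences of an arbitrary classical solution are not known to be bounded by
  \<open>K\<close>. The iterates are handled by a control \<open>\<beta>\<close> that is continued
  outside the ball by projection, together with the global Lipschitz bound that \<open>H\<close> has
  as a supremum of affine functions. Solutions of the game have differences of size at most
  \<open>K\<close> and therefore see the original control. Uniqueness rests on the supporting-plane
  inequality of \<open>H\<close>, which holds for all momenta. The other obstacle is the boundary of
  the simplex. Derivatives are one-sided limits along transfers of mass, and convexity yields
  dissipation only with the weight \<open>m $ y\<close>, which may vanish. The forward forcing
  carries the same weight, so a weighted size of the value difference closes the estimate.
  Identities between derivatives are first obtained at points shifted into the interior.\<close>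

lemma nonincreasing_within:
  fixes f :: "real \<Rightarrow> real"
  assumes "a \<le> b"
    and "\<And>t. t \<in> {a..b} \<Longrightarrow> (f has_real_derivative f' t) (at t within {a..b})"
    and "\<And>t. t \<in> {a..b} \<Longrightarrow> f' t \<le> 0"
  shows "f b \<le> f a"
proof (rule DERIV_nonpos_imp_decreasing_open[OF assms(1)])
  show "continuous_on {a..b} f"
    using assms(2) by (meson DERIV_continuous_on)
  fix x assume "a < x" "x < b"
  then show "\<exists>y. (f has_real_derivative y) (at x) \<and> y \<le> 0"
    using assms(2)[of x] assms(3)[of x] by (auto simp: at_within_Icc_at)
qed

text \<open>An explicit antiderivative \<open>g\<close> of the bound stands in for an integral, so
  no integrability of the bound has to be checked. Later estimates let \<open>g\<close> contain a
  multiple of an energy pairing.\<close>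

lemma norm_increment_le:
  fixes f :: "real \<Rightarrow> 'a::real_normed_vector"
  assumes "a \<le> b"
    and f: "\<And>t. t \<in> {a..b} \<Longrightarrow> (f has_vector_derivative f' t) (at t within {a..b})"
    and g: "\<And>t. t \<in> {a..b} \<Longrightarrow> (g has_real_derivative g' t) (at t within {a..b})"
    and le: "\<And>t. t \<in> {a..b} \<Longrightarrow> norm (f' t) \<le> g' t"
  shows "norm (f b - f a) \<le> g b - g a"
proof (cases "a = b")
  case False
  then have ab: "a < b" using assms(1) by simp
  show ?thesis
  proof (rule differentiable_bound_general[OF ab])
    show "continuous_on {a..b} f"
      by (rule continuous_on_vector_derivative) (use f in auto)
    show "continuous_on {a..b} g"
      using g by (meson DERIV_continuous_on)
    fix x assume x: "a < x" "x < b"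
    show "(f has_vector_derivative f' x) (at x)"
      using f[of x] x by (auto simp: at_within_Icc_at)
    show "(g has_vector_derivative g' x) (at x)"
      using g[of x] x by (auto simp: at_within_Icc_at has_real_derivative_iff_has_vector_derivative)
    show "norm (f' x) \<le> g' x" using le[of x] x by auto
  qed
qed simp

section \<open>Gronwall inequalities forwards and backwards in time\<close>

lemma has_vector_derivative_reflect:
  fixes f :: "real \<Rightarrow> 'a::real_normed_vector"
  assumes "\<And>t. t \<in> {a..b} \<Longrightarrow> (f has_vector_derivative f' t) (at t within {a..b})"
    and t: "t \<in> {a..b}"
  shows "((\<lambda>t. f (a + b - t)) has_vector_derivative - f' (a + b - t)) (at t within {a..b})"
proof -
  have im: "(\<lambda>t. a + b - t) ` {a..b} = {a..b}" by auto
  have 1: "((\<lambda>t. a + b - t) has_vector_derivative -1) (at t within {a..b})"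
    by (auto intro!: derivative_eq_intros)
  have 2: "(f has_vector_derivative f' (a + b - t)) (at (a + b - t) within (\<lambda>t. a + b - t) ` {a..b})"
    unfolding im using assms(1)[of "a+b-t"] t by auto
  show ?thesis using vector_diff_chain_within[OF 1 2] by (simp add: o_def)
qed

lemma gronwall:
  fixes f :: "real \<Rightarrow> real"
  assumes "continuous_on {a..b} f" "0 \<le> C"
    and le: "\<And>t. t \<in> {a..b} \<Longrightarrow> f t \<le> A + C * integral {a..t} f"
    and t: "t \<in> {a..b}"
  shows "f t \<le> A * exp (C * (t - a))"
proof -
  define J where "J t = integral {a..t} f" for t
  \<comment> \<open>With this integrating factor the right hand side of the assumed inequality
    becomes nonincreasing.\<close>
  define y where "y t = (A + C * J t) * exp (- C * (t - a))" for t
  have J: "(J has_real_derivative f s) (at s within {a..t})" if "s \<in> {a..t}" for s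
    unfolding J_def has_real_derivative_iff_has_vector_derivative
    by (rule integral_has_vector_derivative)
       (use that t in \<open>auto intro: continuous_on_subset[OF assms(1)]\<close>)
  have "y t \<le> y a"
  proof (rule nonincreasing_within[where f = y])
    fix s assume s: "s \<in> {a..t}"
    show "(y has_real_derivative (C * f s - C * (A + C * J s)) * exp (- C * (s - a))) (at s within {a..t})"
      unfolding y_def using J[OF s]
      by (auto intro!: derivative_eq_intros simp: algebra_simps)
    have "f s \<le> A + C * J s" using le[of s] s t by (auto simp: J_def)
    then have "C * f s - C * (A + C * J s) \<le> 0"
      using \<open>0 \<le> C\<close> mult_left_mono[of "f s" "A + C * J s" C] by simp
    then show "(C * f s - C * (A + C * J s)) * exp (- C * (s - a)) \<le> 0"
      by (simp add: mult_nonpos_nonneg)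
  qed (use t in auto)
  then have "(A + C * J t) * exp (- C * (t - a)) \<le> A" by (simp add: y_def J_def)
  then have "A + C * J t \<le> A * exp (C * (t - a))"
    by (simp add: exp_minus exp_diff field_simps)
  then show ?thesis using le[OF t] by (simp add: J_def)
qed

text \<open>Only the increments \<open>g t - g a\<close> of the primitive need a bound, while the
  inhomogeneity \<open>g'\<close> may be large. This fits a forcing whose square is dominated by the
  derivative of a bounded quantity.\<close>

lemma gronwall_norm:
  fixes f :: "real \<Rightarrow> 'a::real_normed_vector"
  assumes "0 \<le> C"
    and f: "\<And>t. t \<in> {a..b} \<Longrightarrow> (f has_vector_derivative f' t) (at t within {a..b})"
    and g: "\<And>t. t \<in> {a..b} \<Longrightarrow> (g has_real_derivative g' t) (at t within {a..b})"
    and le: "\<And>t. t \<in> {a..b} \<Longrightarrow> norm (f' t) \<le> C * norm (f t) + g' t"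
    and D: "\<And>t. t \<in> {a..b} \<Longrightarrow> g t - g a \<le> D"
    and t: "t \<in> {a..b}"
  shows "norm (f t) \<le> (norm (f a) + D) * exp (C * (t - a))"
proof (rule gronwall[where f = "\<lambda>t. norm (f t)" and b = b])
  have cf: "continuous_on {a..b} f"
    by (rule continuous_on_vector_derivative) (use f in auto)
  then show cn: "continuous_on {a..b} (\<lambda>t. norm (f t))" by (rule continuous_on_norm)
  fix s assume s: "s \<in> {a..b}"
  define J where "J t = integral {a..t} (\<lambda>t. norm (f t))" for t
  have J: "(J has_real_derivative norm (f r)) (at r within {a..s})" if "r \<in> {a..s}" for r
    unfolding J_def has_real_derivative_iff_has_vector_derivative
    by (rule integral_has_vector_derivative)
       (use that s in \<open>auto intro: continuous_on_subset[OF cn]\<close>)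
  have "norm (f s - f a) \<le> (C * J s + g s) - (C * J a + g a)"
  proof (rule norm_increment_le)
    fix r assume r: "r \<in> {a..s}"
    then have r': "r \<in> {a..b}" using s by auto
    show "(f has_vector_derivative f' r) (at r within {a..s})"
      by (rule has_vector_derivative_within_subset[OF f[OF r']]) (use s in auto)
    have "(g has_real_derivative g' r) (at r within {a..s})"
      by (rule DERIV_subset[OF g[OF r']]) (use s in auto)
    then show "((\<lambda>s. C * J s + g s) has_real_derivative C * norm (f r) + g' r) (at r within {a..s})"
      using J[OF r] by (auto intro!: derivative_eq_intros)
    show "norm (f' r) \<le> C * norm (f r) + g' r" by (rule le[OF r'])
  qed (use s in auto)
  moreover have "J a = 0" by (simp add: J_def)
  moreover have "norm (f s) \<le> norm (f a) + norm (f s - f a)" by (metis add.commute norm_triangle_sub)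
  ultimately show "norm (f s) \<le> (norm (f a) + D) + C * integral {a..s} (\<lambda>t. norm (f t))"
    using D[OF s] by (simp add: J_def)
qed (use assms in auto)

lemma gronwall_norm_backward:
  fixes f :: "real \<Rightarrow> 'a::real_normed_vector"
  assumes "0 \<le> C" "0 \<le> D"
    and f: "\<And>t. t \<in> {a..b} \<Longrightarrow> (f has_vector_derivative f' t) (at t within {a..b})"
    and le: "\<And>t. t \<in> {a..b} \<Longrightarrow> norm (f' t) \<le> C * norm (f t) + D"
    and t: "t \<in> {a..b}"
  shows "norm (f t) \<le> (norm (f b) + D * (b - a)) * exp (C * (b - a))"
proof -
  define g where "g t = f (a + b - t)" for t
  have "norm (g (a + b - t)) \<le> (norm (g a) + D * (b - a)) * exp (C * (a + b - t - a))"
  proof (rule gronwall_norm[where b = b and f' = "\<lambda>t. - f' (a + b - t)" and g = "\<lambda>t. D * t" and g' = "\<lambda>_. D"])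
    fix s assume s: "s \<in> {a..b}"
    show "(g has_vector_derivative - f' (a + b - s)) (at s within {a..b})"
      unfolding g_def by (rule has_vector_derivative_reflect[OF f s])
    show "((*) D has_real_derivative D) (at s within {a..b})"
      by (auto intro!: derivative_eq_intros)
    show "norm (- f' (a + b - s)) \<le> C * norm (g s) + D"
      using le[of "a+b-s"] s by (auto simp: g_def)
    show "D * s - D * a \<le> D * (b - a)"
      using mult_left_mono[of s b D] s \<open>0 \<le> D\<close> by (auto simp: algebra_simps)
  qed (use assms in auto)
  also have "\<dots> \<le> (norm (g a) + D * (b - a)) * exp (C * (b - a))"
    using t \<open>0 \<le> C\<close> \<open>0 \<le> D\<close> by (intro mult_left_mono) (auto intro!: mult_left_mono)
  finally show ?thesis by (simp add: g_def)
qed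

lemma first_order_expansion:
  fixes f :: "real \<Rightarrow> 'a::real_normed_vector"
  assumes "a \<le> b"
    and f: "\<And>t. t \<in> {a..b} \<Longrightarrow> (f has_vector_derivative f' t) (at t within {a..b})"
    and le: "\<And>t. t \<in> {a..b} \<Longrightarrow> norm (f' t - d) \<le> C"
  shows "norm (f b - f a - (b - a) *\<^sub>R d) \<le> C * (b - a)"
proof -
  have "norm ((f b - b *\<^sub>R d) - (f a - a *\<^sub>R d)) \<le> C * b - C * a"
  proof (rule norm_increment_le[OF assms(1)])
    fix t assume t: "t \<in> {a..b}"
    show "((\<lambda>t. f t - t *\<^sub>R d) has_vector_derivative (f' t - d)) (at t within {a..b})"
      using f[OF t] by (auto intro!: derivative_eq_intros)
    show "((*) C has_real_derivative C) (at t within {a..b})"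
      by (auto intro!: derivative_eq_intros)
  qed (use le in auto)
  then show ?thesis by (simp add: algebra_simps)
qed

text \<open>Banach's fixed point theorem on a path space, in a form that avoids introducing
  that space as a type.\<close>

lemma path_fixpoint:
  fixes \<Phi> :: "(real \<Rightarrow> 'a::banach) \<Rightarrow> real \<Rightarrow> 'a"
  assumes "closed S" "z0 \<in> S"
    and maps: "\<And>z. continuous_on {a..b} z \<Longrightarrow> z ` {a..b} \<subseteq> S \<Longrightarrow>
                 continuous_on {a..b} (\<Phi> z) \<and> \<Phi> z ` {a..b} \<subseteq> S"
    and contr: "\<And>z z' \<delta>. continuous_on {a..b} z \<Longrightarrow> z ` {a..b} \<subseteq> S \<Longrightarrow>
                 continuous_on {a..b} z' \<Longrightarrow> z' ` {a..b} \<subseteq> S \<Longrightarrow>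
                 (\<And>t. t \<in> {a..b} \<Longrightarrow> norm (z t - z' t) \<le> \<delta>) \<Longrightarrow>
                 (\<And>t. t \<in> {a..b} \<Longrightarrow> norm (\<Phi> z t - \<Phi> z' t) \<le> \<delta> / 2)"
  shows "\<exists>z. continuous_on {a..b} z \<and> z ` {a..b} \<subseteq> S \<and> (\<forall>t\<in>{a..b}. \<Phi> z t = z t)"
proof (cases "a \<le> b")
  case True
  define Z where "Z n = (\<Phi> ^^ n) (\<lambda>_. z0)" for n
  have Z0: "Z 0 = (\<lambda>_. z0)" and ZS: "\<And>n. Z (Suc n) = \<Phi> (Z n)" by (simp_all add: Z_def)
  have Zc: "continuous_on {a..b} (Z n) \<and> Z n ` {a..b} \<subseteq> S" for n
  proof (induction n)
    case 0
    then show ?case using assms(2) by (auto simp: Z0)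
  next
    case (Suc n)
    then show ?case using maps[of "Z n"] by (auto simp: ZS)
  qed
  \<comment> \<open>A continuous path on a compact interval is bounded, which gives the size
    \<open>B\<close> of the first increment; each further iteration halves it.\<close>
  have "compact ((\<lambda>t. Z 1 t - Z 0 t) ` {a..b})"
    using Zc by (intro compact_continuous_image continuous_on_diff) auto
  then obtain B where B: "\<And>t. t \<in> {a..b} \<Longrightarrow> norm (Z 1 t - Z 0 t) \<le> B"
    using compact_imp_bounded bounded_iff by (metis (no_types, lifting) imageI)
  have step: "norm (Z (Suc n) t - Z n t) \<le> B * (1/2)^n" if "t \<in> {a..b}" for n t
    using that
  proof (induction n arbitrary: t)
    case 0
    then show ?case using B[of t] by simp
  next
    case (Suc n)
    have "norm (\<Phi> (Z (Suc n)) t - \<Phi> (Z n) t) \<le> (B * (1/2)^n) / 2"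
      by (rule contr) (use Suc Zc in auto)
    then show ?case by (simp add: ZS)
  qed
  have "uniformly_convergent_on {a..b} (\<lambda>n t. \<Sum>k<n. (Z (Suc k) t - Z k t))"
  proof (rule Weierstrass_m_test')
    show "norm (Z (Suc n) x - Z n x) \<le> B * (1/2)^n" if "x \<in> {a..b}" for n x
      using step[OF that] .
    show "summable (\<lambda>n. B * (1/2::real)^n)" by (intro summable_mult summable_geometric) simp
  qed
  then obtain l where l: "uniform_limit {a..b} (\<lambda>n t. \<Sum>k<n. (Z (Suc k) t - Z k t)) l sequentially"
    by (auto simp: uniformly_convergent_on_def)
  have tel: "(\<Sum>k<n. (Z (Suc k) t - Z k t)) = Z n t - z0" for n t
    using sum_lessThan_telescope[of "\<lambda>k. Z k t" n] by (simp add: Z0)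
  define z where "z t = l t + z0" for t
  have ul: "uniform_limit {a..b} Z z sequentially"
  proof -
    have "uniform_limit {a..b} (\<lambda>n t. (\<Sum>k<n. (Z (Suc k) t - Z k t)) + z0) (\<lambda>t. l t + z0) sequentially"
      by (intro uniform_limit_intros l)
    then show ?thesis by (simp add: tel z_def[abs_def])
  qed
  have zc: "continuous_on {a..b} z"
    by (rule uniform_limit_theorem[OF _ ul]) (use Zc in auto)
  have zS: "z ` {a..b} \<subseteq> S"
  proof
    fix y assume "y \<in> z ` {a..b}"
    then obtain t where t: "t \<in> {a..b}" "y = z t" by auto
    have "(\<lambda>n. Z n t) \<longlonglongrightarrow> z t" using tendsto_uniform_limitI[OF ul t(1)] .
    moreover have "Z n t \<in> S" for n using Zc[of n] t(1) by auto
    ultimately show "y \<in> S" using closed_sequentially[OF assms(1), of "\<lambda>n. Z n t"] t(2) by auto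
  qed
  have "\<Phi> z t = z t" if t: "t \<in> {a..b}" for t
  proof -
    \<comment> \<open>\<open>\<Phi> z\<close> is compared with
      \<open>Z (Suc n) = \<Phi> (Z n)\<close> for one late \<open>n\<close>: the contraction makes
      the first distance at most \<open>e/4\<close>, uniform convergence the second less than
      \<open>e/2\<close>.\<close>
    have "norm (\<Phi> z t - z t) \<le> e" if "e > 0" for e
    proof -
      have "\<forall>\<^sub>F n in sequentially. \<forall>x\<in>{a..b}. dist (Z n x) (z x) < e/2"
        using uniform_limitD[OF ul, of "e/2"] that by simp
      then obtain n where n: "\<And>k x. k \<ge> n \<Longrightarrow> x\<in>{a..b} \<Longrightarrow> dist (Z k x) (z x) < e/2"
        unfolding eventually_sequentially by blast
      have "norm (\<Phi> z t - \<Phi> (Z n) t) \<le> (e/2) / 2"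
        using zc zS Zc[of n] n[of n] t
        by (intro contr) (auto simp: dist_norm norm_minus_commute intro: less_imp_le)
      moreover have "norm (Z (Suc n) t - z t) < e/2" using n[of "Suc n" t] t by (simp add: dist_norm)
      moreover have "norm (\<Phi> z t - z t) \<le> norm (\<Phi> z t - \<Phi> (Z n) t) + norm (Z (Suc n) t - z t)"
        using norm_triangle_ineq[of "\<Phi> z t - \<Phi> (Z n) t" "Z (Suc n) t - z t"] by (simp add: ZS)
      ultimately show ?thesis using that by linarith
    qed
    then have "norm (\<Phi> z t - z t) \<le> 0" by (meson dense_ge)
    then show ?thesis by simp
  qed
  then show ?thesis using zc zS by blast
qed (use assms in auto)

text \<open>A minimum principle that uses the time derivative only at spatial minima. No joint
  differentiability is needed.\<close>

lemma nonneg_if_decreasing_at_minima: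
  fixes f :: "real \<Rightarrow> 'a::metric_space \<Rightarrow> real"
  assumes "compact S"
    and cont: "continuous_on ({0..T} \<times> S) (\<lambda>(t, s). f t s)"
    and fin: "\<And>s. s \<in> S \<Longrightarrow> 0 \<le> f T s"
    and dec: "\<And>t s. 0 \<le> t \<Longrightarrow> t < T \<Longrightarrow> s \<in> S \<Longrightarrow> (\<And>s'. s' \<in> S \<Longrightarrow> f t s \<le> f t s') \<Longrightarrow>
       \<exists>D\<le>0. ((\<lambda>t. f t s) has_real_derivative D) (at t within {0..T})"
    and t: "t \<in> {0..T}" and s: "s \<in> S"
  shows "0 \<le> f t s"
proof -
  \<comment> \<open>The tilt by \<open>\<eta> * t\<close> makes a weak sign strict. A space-time
    minimum before \<open>T\<close> is also a spatial minimum of \<open>f t0\<close>, there the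
    tilted time derivative is at most \<open>- \<eta>\<close>, and a small step forwards in time
    would go lower. So the minimum sits at time \<open>T\<close>.\<close>
  have key: "- \<eta> * T \<le> f t s - \<eta> * t" if "\<eta> > 0" for \<eta>
  proof -
    define g where "g p = (case p of (t, s) \<Rightarrow> f t s - \<eta> * t)" for p
    have "compact ({0..T} \<times> S)" using assms(1) by (intro compact_Times) auto
    moreover have "continuous_on ({0..T} \<times> S) g"
      using cont unfolding g_def case_prod_unfold by (intro continuous_intros) auto
    moreover have "{0..T} \<times> S \<noteq> {}" using t s by auto
    ultimately obtain p where p: "p \<in> {0..T} \<times> S" "\<And>q. q \<in> {0..T} \<times> S \<Longrightarrow> g p \<le> g q"
      using continuous_attains_inf by meson
    obtain t0 s0 where ts: "p = (t0, s0)" by force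
    have t0: "t0 \<in> {0..T}" and s0: "s0 \<in> S" using p ts by auto
    have min: "f t0 s0 - \<eta> * t0 \<le> f r x - \<eta> * r" if "r \<in> {0..T}" "x \<in> S" for r x
      using p(2)[of "(r, x)"] that by (simp add: g_def ts)
    have "t0 = T"
    proof (rule ccontr)
      assume "t0 \<noteq> T"
      then have lt: "0 \<le> t0" "t0 < T" using t0 by auto
      obtain D where D: "D \<le> 0" "((\<lambda>t. f t s0) has_real_derivative D) (at t0 within {0..T})"
        using dec[OF lt s0] min[OF t0] by fastforce
      have "((\<lambda>t. f t s0 - \<eta> * t) has_real_derivative (D - \<eta>)) (at t0 within {0..T})"
        using D(2) by (auto intro!: derivative_eq_intros)
      moreover have "D - \<eta> < 0" using D(1) that by simp
      ultimately obtain d where d: "d > 0"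
        "\<And>h. h > 0 \<Longrightarrow> t0 + h \<in> {0..T} \<Longrightarrow> h < d \<Longrightarrow> f (t0+h) s0 - \<eta> * (t0+h) < f t0 s0 - \<eta> * t0"
        using has_real_derivative_neg_dec_right by blast
      define h where "h = min (d/2) (T - t0)"
      have "h > 0" "h < d" "t0 + h \<in> {0..T}" using d(1) lt by (auto simp: h_def min_def)
      then show False using d(2)[of h] min[of "t0 + h" s0] s0 by linarith
    qed
    then have "- \<eta> * T \<le> f t0 s0 - \<eta> * t0" using fin[OF s0] by simp
    also have "\<dots> \<le> f t s - \<eta> * t" using min[OF t s] .
    finally show ?thesis .
  qed
  have "- \<eta> * T \<le> f t s" if "\<eta> > 0" for \<eta>
  proof -
    have "0 \<le> \<eta> * t" using t that by simp
    then show ?thesis using key[OF that] by linarith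
  qed
  note le = this
  show ?thesis
  proof (rule field_le_epsilon)
    fix e :: real assume "e > 0"
    then have "- (e / (\<bar>T\<bar> + 1)) * T \<le> f t s" by (intro le) simp
    moreover have "e / (\<bar>T\<bar> + 1) * T \<le> e"
    proof -
      have "e * T \<le> e * (\<bar>T\<bar> + 1)" using \<open>e > 0\<close> by (intro mult_left_mono) auto
      then show ?thesis by (simp add: pos_divide_le_eq)
    qed
    ultimately show "0 \<le> f t s + e" by simp
  qed
qed

section \<open>Monotone forward-backward systems\<close>

text \<open>The energy estimate behind monotone forward-backward systems. The dissipation \<open>r\<^sup>2\<close> of the
  pairing \<open>v \<bullet> \<rho>\<close> controls the forcing \<open>r\<close> of \<open>\<rho>\<close>: with \<open>X\<close> the size of the solution, Young's
  inequality \<open>r \<le> \<theta> + r\<^sup>2 / (4 * \<theta>)\<close> for \<open>\<theta>\<close> a small multiple of \<open>X\<close> makes the estimate close.\<close>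

lemma forward_backward_stability:
  fixes C c T :: real
  assumes "0 \<le> C" "0 < c" "0 \<le> T"
  shows "\<exists>C'\<ge>0. \<forall>a b (\<rho> :: real \<Rightarrow> 'a::real_inner) \<rho>' v v' r \<epsilon>.
    a \<le> b \<longrightarrow> b - a \<le> T \<longrightarrow> 0 \<le> \<epsilon> \<longrightarrow>
    (\<forall>t\<in>{a..b}. (\<rho> has_vector_derivative \<rho>' t) (at t within {a..b}) \<and>
       (v has_vector_derivative v' t) (at t within {a..b}) \<and>
       norm (\<rho>' t) \<le> C * (norm (\<rho> t) + r t + \<epsilon>) \<and>
       norm (v' t) \<le> C * (norm (v t) + norm (\<rho> t) + \<epsilon>) \<and>
       v' t \<bullet> \<rho> t + v t \<bullet> \<rho>' t \<le> - c * (r t)\<^sup>2 + C * \<epsilon> * (norm (v t) + norm (\<rho> t))) \<longrightarrow>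
    norm (v b) \<le> C * (norm (\<rho> b) + \<epsilon>) \<longrightarrow> - (C * \<epsilon> * norm (\<rho> b)) \<le> v b \<bullet> \<rho> b \<longrightarrow>
    (\<forall>t\<in>{a..b}. norm (\<rho> t) \<le> C' * (norm (\<rho> a) + \<epsilon>) \<and> norm (v t) \<le> C' * (norm (\<rho> a) + \<epsilon>))"
proof -
  \<comment> \<open>\<open>E\<close> bounds all Gronwall factors on an interval of length at most
    \<open>T\<close>; \<open>K2\<close> collects the bound of \<open>v\<close> by that of
    \<open>\<rho>\<close>; \<open>K1\<close> collects the contributions of the data to the growth of
    \<open>\<rho>\<close>. The value of \<open>\<eta>\<close> is dictated by the last step, where
    the coefficient \<open>K2 * E * C * T * \<eta>\<close> of \<open>X\<close> has to be at most
    1/2.\<close>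
  define E where "E = exp (C * T)"
  define K2 where "K2 = 1 + C * (1 + T) * E"
  define \<eta> where "\<eta> = 1 / (2 * (K2 * E * C * T + 1))"
  define k' where "k' = C / (4 * \<eta> * c)"
  define K1 where "K1 = C * T + k' * (1 + C + 2 * C * T)"
  define C' where "C' = 2 * K2 * (E * (1 + K1) + 1)"
  have E1: "E \<ge> 1" using assms by (simp add: E_def)
  have K2: "K2 \<ge> 1" using assms E1 by (simp add: K2_def)
  have \<eta>0: "\<eta> > 0" using K2 E1 assms by (simp add: \<eta>_def add_nonneg_pos)
  have \<eta>half: "K2 * E * C * T * \<eta> \<le> 1/2"
  proof -
    have "0 \<le> K2 * E * C * T" using K2 E1 assms by simp
    then show ?thesis by (simp add: \<eta>_def field_simps)
  qed
  have k'0: "k' \<ge> 0" using assms \<eta>0 by (simp add: k'_def)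
  have K10: "K1 \<ge> 0" using assms k'0 by (simp add: K1_def)
  have C'0: "C' \<ge> 0" using K2 E1 K10 by (simp add: C'_def)
  have main: "norm (\<rho> t) + norm (v t) \<le> C' * (norm (\<rho> a) + \<epsilon>)"
    if ab: "a \<le> b" "b - a \<le> T" and \<epsilon>: "0 \<le> \<epsilon>"
      and D\<rho>: "\<And>t. t \<in> {a..b} \<Longrightarrow> (\<rho> has_vector_derivative \<rho>' t) (at t within {a..b})"
      and Dv: "\<And>t. t \<in> {a..b} \<Longrightarrow> (v has_vector_derivative v' t) (at t within {a..b})"
      and \<rho>': "\<And>t. t \<in> {a..b} \<Longrightarrow> norm (\<rho>' t) \<le> C * (norm (\<rho> t) + r t + \<epsilon>)"
      and v': "\<And>t. t \<in> {a..b} \<Longrightarrow> norm (v' t) \<le> C * (norm (v t) + norm (\<rho> t) + \<epsilon>)"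
      and diss: "\<And>t. t \<in> {a..b} \<Longrightarrow>
        v' t \<bullet> \<rho> t + v t \<bullet> \<rho>' t \<le> - c * (r t)\<^sup>2 + C * \<epsilon> * (norm (v t) + norm (\<rho> t))"
      and vb: "norm (v b) \<le> C * (norm (\<rho> b) + \<epsilon>)"
      and pb: "- (C * \<epsilon> * norm (\<rho> b)) \<le> v b \<bullet> \<rho> b"
      and t: "t \<in> {a..b}"
    for a b \<epsilon> t :: real and \<rho> \<rho>' v v' :: "real \<Rightarrow> 'a" and r
  proof -
    have c\<rho>: "continuous_on {a..b} \<rho>"
      by (rule continuous_on_vector_derivative) (use D\<rho> in auto)
    have cv: "continuous_on {a..b} v"
      by (rule continuous_on_vector_derivative) (use Dv in auto)
    \<comment> \<open>The largest combined size \<open>X\<close> is finite by compactness, so that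
      half of it can be absorbed at the end.\<close>
    have "\<exists>s\<in>{a..b}. \<forall>t\<in>{a..b}. norm (\<rho> t) + norm (v t) \<le> norm (\<rho> s) + norm (v s)"
      by (rule continuous_attains_sup) (use ab c\<rho> cv in \<open>auto intro!: continuous_intros\<close>)
    then obtain s0 where s0: "s0 \<in> {a..b}"
      "\<And>t. t \<in> {a..b} \<Longrightarrow> norm (\<rho> t) + norm (v t) \<le> norm (\<rho> s0) + norm (v s0)" by auto
    define X where "X = norm (\<rho> s0) + norm (v s0)"
    have X: "norm (\<rho> t) + norm (v t) \<le> X" if "t \<in> {a..b}" for t using s0(2)[OF that] by (simp add: X_def)
    have X\<rho>: "norm (\<rho> t) \<le> X" if "t \<in> {a..b}" for t using X[OF that] norm_ge_zero[of "v t"] by linarith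
    have Xv: "norm (v t) \<le> X" if "t \<in> {a..b}" for t using X[OF that] norm_ge_zero[of "\<rho> t"] by linarith
    define \<delta> where "\<delta> = norm (\<rho> a) + \<epsilon>"
    have \<delta>0: "0 \<le> \<delta>" using \<epsilon> by (simp add: \<delta>_def)
    have "X \<le> C' * \<delta>"
    proof (cases "X = 0")
      case True
      then show ?thesis using C'0 \<delta>0 by simp
    next
      case False
      then have X0: "X > 0" by (simp add: X_def) (metis add_nonneg_nonneg less_eq_real_def norm_ge_zero)
      define S where "S t = v t \<bullet> \<rho> t" for t
      define S' where "S' t = v' t \<bullet> \<rho> t + v t \<bullet> \<rho>' t" for t
      have DS: "(S has_real_derivative S' t) (at t within {a..b})" if "t \<in> {a..b}" for t
        unfolding S_def S'_def has_real_derivative_iff_has_vector_derivative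
        using bounded_bilinear.has_vector_derivative[OF bounded_bilinear_inner Dv[OF that] D\<rho>[OF that]]
        by (simp add: add.commute)
      have S'le: "S' t \<le> - c * (r t)\<^sup>2 + C * \<epsilon> * X" if "t \<in> {a..b}" for t
      proof -
        have "C * \<epsilon> * (norm (v t) + norm (\<rho> t)) \<le> C * \<epsilon> * X"
          using X[OF that] assms(1) \<epsilon> by (intro mult_left_mono) auto
        then show ?thesis using diss[OF that] by (simp add: S'_def)
      qed
      \<comment> \<open>The pairing can increase only by the error \<open>C * \<epsilon> * X\<close>
        per unit of time, and its terminal value is almost nonnegative; reading this backwards
        bounds it from below.\<close>
      have Slow: "- (C * (1 + T) * \<epsilon> * X) \<le> S t" if t: "t \<in> {a..b}" for t
      proof -
        have "(\<lambda>t. S t - C * \<epsilon> * X * t) b \<le> (\<lambda>t. S t - C * \<epsilon> * X * t) t"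
        proof (rule nonincreasing_within[where f = "\<lambda>t. S t - C * \<epsilon> * X * t" and f' = "\<lambda>t. S' t - C * \<epsilon> * X"])
          fix s assume s: "s \<in> {t..b}"
          then have s': "s \<in> {a..b}" using t by auto
          show "((\<lambda>t. S t - C * \<epsilon> * X * t) has_real_derivative S' s - C * \<epsilon> * X) (at s within {t..b})"
            using DERIV_subset[OF DS[OF s'], of "{t..b}"] t by (auto intro!: derivative_eq_intros)
          have "0 \<le> c * (r s)\<^sup>2" using assms by simp
          then show "S' s - C * \<epsilon> * X \<le> 0" using S'le[OF s'] by simp
        qed (use t in auto)
        then have "S b - C * \<epsilon> * X * (b - t) \<le> S t" by (simp add: algebra_simps)
        moreover have "C * \<epsilon> * X * (b - t) \<le> C * \<epsilon> * X * T"
          using t ab X0 assms \<epsilon> by (intro mult_left_mono) auto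
        moreover have "- (C * \<epsilon> * X) \<le> S b"
        proof -
          have "C * \<epsilon> * norm (\<rho> b) \<le> C * \<epsilon> * X" using X\<rho>[of b] ab assms \<epsilon> by (intro mult_left_mono) auto
          then show ?thesis using pb by (simp add: S_def)
        qed
        ultimately show ?thesis by (simp add: algebra_simps)
      qed
      have Sa: "S a \<le> norm (\<rho> a) * X"
      proof -
        have "S a \<le> norm (v a) * norm (\<rho> a)" unfolding S_def by (rule norm_cauchy_schwarz)
        also have "\<dots> \<le> X * norm (\<rho> a)" using Xv[of a] ab by (intro mult_right_mono) auto
        finally show ?thesis by (simp add: mult.commute)
      qed
      define \<theta> where "\<theta> = \<eta> * X"
      have \<theta>0: "\<theta> > 0" using \<eta>0 X0 by (simp add: \<theta>_def)
      define k where "k = C / (4 * \<theta> * c)"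
      \<comment> \<open>\<open>k\<close> is of order \<open>1 / X\<close>, while the total drop of
        the pairing is at most \<open>X\<close> times the data. Their product therefore no longer
        involves \<open>X\<close>.\<close>
      have kX: "k * X = k'" using X0 by (simp add: k_def k'_def \<theta>_def)
      have k0: "k \<ge> 0" using assms \<theta>0 by (simp add: k_def)
      define D where "D = C * T * \<eta> * X + K1 * \<delta>"
      have \<rho>bd: "norm (\<rho> t) \<le> (norm (\<rho> a) + D) * exp (C * (t - a))" if t: "t \<in> {a..b}" for t
      proof (rule gronwall_norm[OF assms(1) D\<rho> _ _ _ t])
        fix s assume s: "s \<in> {a..b}"
        \<comment> \<open>Through the summand \<open>- k * S t\<close> the dissipation pays for the
          forcing: Young's inequality bounds \<open>C * r s\<close> by \<open>C * \<theta>\<close>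
          plus \<open>k * (c * (r s)\<^sup>2)\<close>, and \<open>c * (r s)\<^sup>2\<close> is at
          most \<open>C * \<epsilon> * X - S' s\<close>.\<close>
        let ?g = "\<lambda>t. (C * (\<theta> + \<epsilon>) + k * (C * \<epsilon> * X)) * t - k * S t"
        show "(?g has_real_derivative (C * (\<theta> + \<epsilon>) + k * (C * \<epsilon> * X)) - k * S' s) (at s within {a..b})"
          using DS[OF s] by (auto intro!: derivative_eq_intros)
        have "0 \<le> (r s - 2 * \<theta>)\<^sup>2" by simp
        then have "4 * \<theta> * r s \<le> 4 * \<theta> * \<theta> + (r s)\<^sup>2" by (simp add: power2_eq_square algebra_simps)
        then have "r s \<le> \<theta> + (r s)\<^sup>2 / (4 * \<theta>)" using \<theta>0 by (simp add: field_simps)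
        then have "C * r s \<le> C * \<theta> + C * ((r s)\<^sup>2 / (4 * \<theta>))"
          using assms(1) by (metis distrib_left mult_left_mono)
        also have "C * ((r s)\<^sup>2 / (4 * \<theta>)) = k * (c * (r s)\<^sup>2)" using assms(2) \<theta>0 by (simp add: k_def)
        also have "\<dots> \<le> k * (C * \<epsilon> * X - S' s)" using S'le[OF s] k0 by (intro mult_left_mono) auto
        finally show "norm (\<rho>' s) \<le> C * norm (\<rho> s) + ((C * (\<theta> + \<epsilon>) + k * (C * \<epsilon> * X)) - k * S' s)"
          using \<rho>'[OF s] by (simp add: algebra_simps)
        have p0: "0 \<le> C * (\<theta> + \<epsilon>) + k * (C * \<epsilon> * X)" using assms k0 \<theta>0 \<epsilon> X0 by simp
        have "?g s - ?g a = (C * (\<theta> + \<epsilon>) + k * (C * \<epsilon> * X)) * (s - a) + k * (S a - S s)" by (simp add: algebra_simps)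
        also have "\<dots> \<le> (C * (\<theta> + \<epsilon>) + k * (C * \<epsilon> * X)) * T
            + k * (norm (\<rho> a) * X + C * (1 + T) * \<epsilon> * X)"
          using Sa Slow[OF s] s ab k0 p0 by (intro add_mono mult_left_mono) auto
        also have "\<dots> = C * T * \<eta> * X + C * T * \<epsilon> + (k * X) * (norm (\<rho> a) + (C + 2 * C * T) * \<epsilon>)"
          by (simp add: algebra_simps \<theta>_def)
        also have "\<dots> \<le> C * T * \<eta> * X + C * T * \<delta> + k' * ((1 + C + 2 * C * T) * \<delta>)"
        proof -
          have "C * T * \<epsilon> \<le> C * T * \<delta>" using assms by (intro mult_left_mono) (auto simp: \<delta>_def)
          moreover have "norm (\<rho> a) + (C + 2 * C * T) * \<epsilon> \<le> \<delta> + (C + 2 * C * T) * \<delta>"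
            using assms \<epsilon> by (intro add_mono mult_left_mono) (auto simp: \<delta>_def)
          ultimately show ?thesis unfolding kX
            using mult_left_mono[OF _ k'0, of "norm (\<rho> a) + (C + 2 * C * T) * \<epsilon>" "\<delta> + (C + 2 * C * T) * \<delta>"]
            by (simp add: algebra_simps)
        qed
        also have "\<dots> = D" by (simp add: D_def K1_def algebra_simps)
        finally show "?g s - ?g a \<le> D" .
      qed
      define R where "R = E * (C * T * \<eta> * X) + E * (1 + K1) * \<delta>"
      have D0: "0 \<le> D" using assms \<eta>0 X0 K10 \<delta>0 by (simp add: D_def)
      have \<rho>R: "norm (\<rho> t) \<le> R" if t: "t \<in> {a..b}" for t
      proof -
        have "norm (\<rho> t) \<le> (norm (\<rho> a) + D) * E"
          using \<rho>bd[OF t] t ab assms(1) D0 unfolding E_def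
          by (elim order_trans) (auto intro!: mult_left_mono)
        also have "\<dots> \<le> (\<delta> + D) * E" using E1 \<epsilon> by (intro mult_right_mono) (auto simp: \<delta>_def)
        also have "\<dots> = R" by (simp add: R_def D_def algebra_simps)
        finally show ?thesis .
      qed
      have R0: "0 \<le> R" using order_trans[OF norm_ge_zero \<rho>R[of a]] ab by simp
      have vR: "norm (v t) \<le> C * (1 + T) * E * (R + \<epsilon>)" if t: "t \<in> {a..b}" for t
      proof -
        have "norm (v t) \<le> (norm (v b) + C * (R + \<epsilon>) * (b - a)) * exp (C * (b - a))"
        proof (rule gronwall_norm_backward[OF assms(1) _ Dv _ t])
          show "0 \<le> C * (R + \<epsilon>)" using assms R0 \<epsilon> by simp
          fix s assume s: "s \<in> {a..b}"
          have "C * (norm (v s) + norm (\<rho> s) + \<epsilon>) \<le> C * (norm (v s) + R + \<epsilon>)"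
            using \<rho>R[OF s] assms by (intro mult_left_mono) auto
          then show "norm (v' s) \<le> C * norm (v s) + C * (R + \<epsilon>)"
            using v'[OF s] by (simp add: algebra_simps)
        qed
        also have "\<dots> \<le> (C * (R + \<epsilon>) + C * (R + \<epsilon>) * T) * E"
        proof (intro mult_mono add_mono)
          have "C * (norm (\<rho> b) + \<epsilon>) \<le> C * (R + \<epsilon>)" using \<rho>R[of b] ab assms by (intro mult_left_mono) auto
          then show "norm (v b) \<le> C * (R + \<epsilon>)" using vb by simp
          show "exp (C * (b - a)) \<le> E" using ab assms by (auto simp: E_def intro: mult_left_mono)
        qed (use assms R0 \<epsilon> ab in auto)
        finally show ?thesis by (simp add: algebra_simps)
      qed
      have "X \<le> R + C * (1 + T) * E * (R + \<epsilon>)" unfolding X_def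
        using \<rho>R[OF s0(1)] vR[OF s0(1)] by simp
      also have "\<dots> = K2 * R + C * (1 + T) * E * \<epsilon>" by (simp add: K2_def algebra_simps)
      also have "\<dots> \<le> K2 * R + K2 * \<delta>"
        using assms E1 \<epsilon> by (intro add_left_mono mult_mono) (auto simp: K2_def \<delta>_def)
      also have "\<dots> = (K2 * E * C * T * \<eta>) * X + K2 * (E * (1 + K1) + 1) * \<delta>"
        by (simp add: R_def algebra_simps)
      also have "\<dots> \<le> 1/2 * X + K2 * (E * (1 + K1) + 1) * \<delta>"
        using \<eta>half X0 by (intro add_right_mono mult_right_mono) auto
      finally show ?thesis by (simp add: C'_def)
    qed
    then show ?thesis using X[OF t] by (simp add: \<delta>_def)
  qed
  show ?thesis
  proof (intro exI[of _ C'] conjI C'0 allI impI)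
    fix a b and \<rho> \<rho>' v v' :: "real \<Rightarrow> 'a" and r \<epsilon>
    assume *: "a \<le> b" "b - a \<le> T" "0 \<le> \<epsilon>"
      "\<forall>t\<in>{a..b}. (\<rho> has_vector_derivative \<rho>' t) (at t within {a..b}) \<and>
         (v has_vector_derivative v' t) (at t within {a..b}) \<and>
         norm (\<rho>' t) \<le> C * (norm (\<rho> t) + r t + \<epsilon>) \<and>
         norm (v' t) \<le> C * (norm (v t) + norm (\<rho> t) + \<epsilon>) \<and>
         v' t \<bullet> \<rho> t + v t \<bullet> \<rho>' t \<le> - c * (r t)\<^sup>2 + C * \<epsilon> * (norm (v t) + norm (\<rho> t))"
      "norm (v b) \<le> C * (norm (\<rho> b) + \<epsilon>)" "- (C * \<epsilon> * norm (\<rho> b)) \<le> v b \<bullet> \<rho> b"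
    show "\<forall>t\<in>{a..b}. norm (\<rho> t) \<le> C' * (norm (\<rho> a) + \<epsilon>) \<and> norm (v t) \<le> C' * (norm (\<rho> a) + \<epsilon>)"
    proof
      fix t assume t: "t \<in> {a..b}"
      have "norm (\<rho> t) + norm (v t) \<le> C' * (norm (\<rho> a) + \<epsilon>)"
        by (rule main[where a = a and b = b and \<rho> = \<rho> and \<rho>' = \<rho>' and v = v and v' = v' and r = r])
           (use * t in auto)
      then show "norm (\<rho> t) \<le> C' * (norm (\<rho> a) + \<epsilon>) \<and> norm (v t) \<le> C' * (norm (\<rho> a) + \<epsilon>)"
        using norm_ge_zero[of "\<rho> t"] norm_ge_zero[of "v t"] by linarith
    qed
  qed
qed

section \<open>Differentiation on the simplex\<close>

lemma simplex_P_nonneg: "m \<in> simplex_P \<Longrightarrow> 0 \<le> m $ j"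
  and simplex_P_sum: "m \<in> simplex_P \<Longrightarrow> (\<Sum>j\<in>UNIV. m $ j) = 1"
  by (auto simp: simplex_P_def)

lemma sum_direction: "(\<Sum>j\<in>UNIV. direction y z $ j) = 0"
  by (simp add: direction_def sum_subtractf axis_def)

lemma direction_nth: "direction y z $ j = (if j = z then 1 else 0) - (if j = y then 1 else 0)"
  by (auto simp: direction_def axis_def)

lemma inner_direction: "A \<bullet> direction y z = A $ z - A $ y"
  by (simp add: direction_def inner_diff_right inner_axis)

lemma norm_direction_le: "norm (direction y z) \<le> 2"
  unfolding direction_def by (rule order_trans[OF norm_triangle_ineq4]) simp

lemma convex_simplex_P: "convex simplex_P"
  unfolding simplex_P_def convex_def
  by (auto simp: sum.distrib sum_distrib_left[symmetric])

lemma norm_simplex_P_le: "m \<in> simplex_P \<Longrightarrow> norm m \<le> 1"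
  using norm_le_l1_cart[of m] by (auto simp: simplex_P_def)

lemma compact_simplex_P: "compact (simplex_P :: (real ^ 'd::finite) set)"
proof -
  have "closed {m :: real^'d. (\<forall>j. 0 \<le> m $ j) \<and> (\<Sum>j\<in>UNIV. m $ j) = 1}"
    by (intro closed_Collect_conj closed_Collect_all closed_Collect_le closed_Collect_eq continuous_intros)
  moreover have "bounded (simplex_P :: (real^'d) set)"
    using norm_simplex_P_le by (auto simp: bounded_iff)
  ultimately show ?thesis by (simp add: compact_eq_bounded_closed simplex_P_def)
qed

lemma axis_in_simplex_P: "axis x 1 \<in> simplex_P"
  by (auto simp: simplex_P_def axis_def)

text \<open>A convex combination of \<open>m\<close> with the barycentre, the latter with weight
  \<open>CARD('d) * s\<close>. Afterwards every state holds mass at least \<open>s\<close>, so every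
  transfer of mass \<open>s\<close> is possible, and the point has moved by a distance of order
  \<open>s\<close> only.\<close>

definition interior_shift :: "real \<Rightarrow> real ^ 'd::finite \<Rightarrow> real ^ 'd" where
  "interior_shift s m = (1 - real CARD('d) * s) *\<^sub>R m + s *\<^sub>R (\<chi> j. 1)"

lemma interior_shift:
  fixes m :: "real ^ 'd::finite"
  assumes m: "m \<in> simplex_P" and s: "0 \<le> s" "real CARD('d) * s \<le> 1"
  shows "interior_shift s m \<in> simplex_P" "s \<le> interior_shift s m $ j"
    "norm (interior_shift s m - m) \<le> 2 * real CARD('d) * s"
proof -
  have *: "0 \<le> (1 - real CARD('d) * s) * m $ j" for j
    using s simplex_P_nonneg[OF m] by simp
  then show "s \<le> interior_shift s m $ j" by (simp add: interior_shift_def)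
  have "(\<Sum>j\<in>UNIV. interior_shift s m $ j) = (1 - real CARD('d) * s) * (\<Sum>j\<in>UNIV. m $ j) + real CARD('d) * s"
    by (simp add: interior_shift_def sum.distrib sum_distrib_left)
  then show "interior_shift s m \<in> simplex_P"
    using * s simplex_P_sum[OF m] by (auto simp: simplex_P_def interior_shift_def)
  have "interior_shift s m - m = s *\<^sub>R ((\<chi> j. 1) - real CARD('d) *\<^sub>R m)"
    by (simp add: interior_shift_def algebra_simps)
  moreover have "norm ((\<chi> j. 1) - real CARD('d) *\<^sub>R m) \<le> 2 * real CARD('d)"
  proof -
    have "norm ((\<chi> j. 1) :: real^'d) \<le> real CARD('d)"
      using norm_le_l1_cart[of "(\<chi> j. 1) :: real^'d"] by simp
    moreover have "norm (real CARD('d) *\<^sub>R m) \<le> real CARD('d)"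
      using norm_simplex_P_le[OF m] by simp
    ultimately show ?thesis using norm_triangle_ineq4[of "(\<chi> j. 1)" "real CARD('d) *\<^sub>R m"] by linarith
  qed
  ultimately show "norm (interior_shift s m - m) \<le> 2 * real CARD('d) * s"
    using mult_left_mono[of _ _ s] s(1) by (simp add: mult.commute) (metis mult.assoc mult.commute)
qed

lemma shift_in_simplex_P:
  fixes a :: "real ^ 'd::finite"
  assumes "a \<in> simplex_P" "(\<Sum>j\<in>UNIV. e $ j) = 0" "\<And>j. 0 \<le> a $ j + c * e $ j"
  shows "a + c *\<^sub>R e \<in> simplex_P"
  using assms by (simp add: simplex_P_def sum.distrib sum_distrib_left[symmetric])

lemma shift_direction_in_simplex_P:
  assumes "a \<in> simplex_P" "0 \<le> c" "c \<le> a $ y"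
  shows "a + c *\<^sub>R direction y z \<in> simplex_P"
  by (rule shift_in_simplex_P[OF assms(1) sum_direction])
     (use assms simplex_P_nonneg[OF assms(1)] in \<open>auto simp: direction_nth\<close>)

lemma admissible_if_pos:
  assumes "m \<in> simplex_P" "0 < m $ y"
  shows "admissible m y z"
  unfolding admissible_def
  using assms by (intro exI[of _ "m $ y"]) (auto intro!: shift_direction_in_simplex_P)

section \<open>Functions with one-sided derivatives\<close>

lemma le_zero_if_le_small:
  fixes x :: real
  assumes "0 < s0" "\<And>s. 0 < s \<Longrightarrow> s \<le> s0 \<Longrightarrow> x \<le> B * s"
  shows "x \<le> 0"
proof (rule ccontr)
  assume "\<not> x \<le> 0"
  then have x: "x > 0" by simp
  define s where "s = min s0 (x / (2 * (\<bar>B\<bar> + 1)))"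
  have s: "0 < s" "s \<le> s0" "s \<le> x / (2 * (\<bar>B\<bar> + 1))" using x assms(1) by (auto simp: s_def)
  have "x \<le> B * s" by (rule assms(2)[OF s(1,2)])
  also have "\<dots> \<le> (\<bar>B\<bar> + 1) * s" using s(1) by (intro mult_right_mono) auto
  also have "\<dots> \<le> x / 2" using s(3) by (simp add: field_simps)
  finally show False using x by simp
qed

text \<open>A continuous function with right derivatives below \<open>B + \<epsilon>\<close> cannot
  have a minimum of \<open>\<psi> s - (B + \<epsilon>) * s\<close> before \<open>b\<close>, since a
  small step to the right would go lower. One-sided derivatives are all that the simplex derivative
  provides along a segment.\<close>

lemma right_derivative_le:
  fixes \<psi> :: "real \<Rightarrow> real"
  assumes "a \<le> b" and cont: "continuous_on {a..b} \<psi>"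
    and der: "\<And>s. a \<le> s \<Longrightarrow> s < b \<Longrightarrow> ((\<lambda>h. (\<psi> (s + h) - \<psi> s) / h) \<longlongrightarrow> l s) (at_right 0)"
    and le: "\<And>s. a \<le> s \<Longrightarrow> s < b \<Longrightarrow> l s \<le> B"
  shows "\<psi> b - \<psi> a \<le> B * (b - a)"
proof -
  have key: "\<psi> b - \<psi> a \<le> (B + \<epsilon>) * (b - a)" if "\<epsilon> > 0" for \<epsilon>
  proof -
    let ?g = "\<lambda>s. \<psi> s - (B + \<epsilon>) * s"
    have "\<exists>s\<in>{a..b}. \<forall>r\<in>{a..b}. ?g s \<le> ?g r"
      by (rule continuous_attains_inf) (use assms(1) cont in \<open>auto intro!: continuous_intros\<close>)
    then obtain s where s: "s \<in> {a..b}" "\<And>r. r \<in> {a..b} \<Longrightarrow> ?g s \<le> ?g r" by blast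
    have "s = b"
    proof (rule ccontr)
      assume "s \<noteq> b"
      then have sb: "a \<le> s" "s < b" using s by auto
      have "l s < B + \<epsilon>" using le[OF sb] that by simp
      then have "\<forall>\<^sub>F h in at_right 0. (\<psi> (s + h) - \<psi> s) / h < B + \<epsilon>"
        by (rule order_tendstoD(2)[OF der[OF sb]])
      moreover have "\<forall>\<^sub>F h in at_right 0. h < b - s \<and> (0::real) < h"
        by (rule eventually_at_rightI[of 0 "b - s"]) (use sb in auto)
      ultimately have "\<forall>\<^sub>F h in at_right 0. (\<psi> (s + h) - \<psi> s) / h < B + \<epsilon> \<and> h < b - s \<and> 0 < h"
        by eventually_elim simp
      then obtain h where h: "(\<psi> (s + h) - \<psi> s) / h < B + \<epsilon>" "h < b - s" "0 < h"
        using eventually_happens'[OF trivial_limit_at_right_real] by blast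
      then have "?g (s + h) < ?g s" by (simp add: field_simps)
      then show False using s(2)[of "s + h"] h sb by auto
    qed
    then have "?g b \<le> ?g a" using s(2)[of a] assms(1) by auto
    then show ?thesis by (simp add: algebra_simps)
  qed
  have "\<psi> b - \<psi> a - B * (b - a) \<le> 0"
  proof (rule le_zero_if_le_small[of 1 _ "b - a"])
    fix s :: real assume "0 < s"
    then show "\<psi> b - \<psi> a - B * (b - a) \<le> (b - a) * s"
      using key[of s] by (simp add: algebra_simps)
  qed simp
  then show ?thesis by simp
qed

lemma right_derivative_bound:
  fixes \<psi> :: "real \<Rightarrow> real"
  assumes "a \<le> b" and cont: "continuous_on {a..b} \<psi>"
    and der: "\<And>s. a \<le> s \<Longrightarrow> s < b \<Longrightarrow> ((\<lambda>h. (\<psi> (s + h) - \<psi> s) / h) \<longlongrightarrow> l s) (at_right 0)"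
    and le: "\<And>s. a \<le> s \<Longrightarrow> s < b \<Longrightarrow> \<bar>l s - d\<bar> \<le> B"
  shows "\<bar>\<psi> b - \<psi> a - (b - a) * d\<bar> \<le> B * (b - a)"
proof -
  have "\<psi> b - \<psi> a \<le> (d + B) * (b - a)"
    by (rule right_derivative_le[OF assms(1) cont der]) (use le in \<open>force simp: abs_le_iff\<close>)+
  moreover have "(- \<psi> b) - (- \<psi> a) \<le> (B - d) * (b - a)"
  proof (rule right_derivative_le[OF assms(1), where l = "\<lambda>s. - l s"])
    show "((\<lambda>h. (- \<psi> (s + h) - - \<psi> s) / h) \<longlongrightarrow> - l s) (at_right 0)" if "a \<le> s" "s < b" for s
      using tendsto_minus[OF der[OF that]] by (simp add: minus_divide_left)
  qed (use le cont in \<open>force simp: abs_le_iff intro!: continuous_intros\<close>)+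
  ultimately show ?thesis by (simp add: abs_le_iff algebra_simps)
qed

section \<open>Gradients and transfer expansions\<close>

text \<open>A C^{1,1} condition in ambient form: one vector per base point serves all displacements
  inside the simplex. These have zero total, so adding a constant to all entries of
  \<open>A m\<close> does not change the expansion.\<close>

definition simplex_gradient ::
  "real \<Rightarrow> (real ^ 'd::finite \<Rightarrow> real) \<Rightarrow> (real ^ 'd \<Rightarrow> real ^ 'd) \<Rightarrow> bool" where
  "simplex_gradient C g A \<longleftrightarrow> 0 \<le> C \<and>
     (\<forall>m\<in>simplex_P. \<forall>m'\<in>simplex_P. norm (A m - A m') \<le> C * norm (m - m') \<and>
        \<bar>g m' - g m - A m \<bullet> (m' - m)\<bar> \<le> C * (norm (m' - m))\<^sup>2)"

text \<open>Expansions along the transfers of mass \<open>c\<close> from one state to another, which are the only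
  directions that the definition of the derivative sees.\<close>

definition transfer_expansion ::
  "real \<Rightarrow> (real ^ 'd::finite \<Rightarrow> real) \<Rightarrow> (real ^ 'd \<Rightarrow> 'd \<Rightarrow> real ^ 'd) \<Rightarrow> bool" where
  "transfer_expansion L g D \<longleftrightarrow> 0 \<le> L \<and>
     (\<forall>y z. \<forall>a\<in>simplex_P.
        (\<forall>c\<ge>0. a + c *\<^sub>R direction y z \<in> simplex_P \<longrightarrow>
           \<bar>g (a + c *\<^sub>R direction y z) - g a - c * D a y $ z\<bar> \<le> L * c\<^sup>2) \<and>
        (\<forall>b\<in>simplex_P. \<bar>D a y $ z - D b y $ z\<bar> \<le> L * norm (a - b)))"

text \<open>Moving mass \<open>s\<close> from \<open>y\<close> to \<open>z\<close> and then from
  \<open>z\<close> to \<open>w\<close> has the same result as moving it from \<open>y\<close> to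
  \<open>w\<close>. At a point shifted inwards all three transfers are possible, and comparing their
  expansions gives the identity up to an error of order \<open>s\<close>.\<close>

lemma transfer_expansion_cocycle:
  fixes g :: "real ^ 'd::finite \<Rightarrow> real"
  assumes ex: "transfer_expansion L g D" and m: "m \<in> simplex_P"
  shows "D m y $ z + D m z $ w = D m y $ w"
proof -
  let ?N = "real CARD('d)"
  have N: "?N > 0" by simp
  have E: "\<And>a y z c. a \<in> simplex_P \<Longrightarrow> 0 \<le> c \<Longrightarrow> a + c *\<^sub>R direction y z \<in> simplex_P \<Longrightarrow>
      \<bar>g (a + c *\<^sub>R direction y z) - g a - c * D a y $ z\<bar> \<le> L * c\<^sup>2"
    and Lip: "\<And>a b y z. a \<in> simplex_P \<Longrightarrow> b \<in> simplex_P \<Longrightarrow> \<bar>D a y $ z - D b y $ z\<bar> \<le> L * norm (a - b)"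
    and L0: "0 \<le> L"
    using ex by (auto simp: transfer_expansion_def)
  have "\<bar>D m y $ z + D m z $ w - D m y $ w\<bar> \<le> 0"
  \<comment> \<open>Of the error \<open>5 + 6 * ?N\<close>, the three expansions contribute 3, the
    change of base point from \<open>a\<close> to \<open>b\<close> contributes 2, and replacing
    \<open>a\<close> by \<open>m\<close> in three derivatives contributes \<open>2 * ?N\<close>
    each.\<close>
  proof (rule le_zero_if_le_small[of "1 / ?N" _ "L * (5 + 6 * ?N)"])
    fix s :: real assume s: "0 < s" "s \<le> 1 / ?N"
    have s': "0 \<le> s" "?N * s \<le> 1" using s N by (auto simp: field_simps)
    define a where "a = interior_shift s m"
    have a: "a \<in> simplex_P" "\<And>j. s \<le> a $ j" "norm (a - m) \<le> 2 * ?N * s"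
      unfolding a_def using interior_shift[OF m s'] by auto
    define b where "b = a + s *\<^sub>R direction y z"
    have b: "b \<in> simplex_P" unfolding b_def by (rule shift_direction_in_simplex_P) (use a s in auto)
    have bw: "b + s *\<^sub>R direction z w = a + s *\<^sub>R direction y w"
      by (simp add: b_def direction_def algebra_simps)
    have aw: "a + s *\<^sub>R direction y w \<in> simplex_P"
      by (rule shift_direction_in_simplex_P) (use a s in auto)
    have 1: "\<bar>g b - g a - s * D a y $ z\<bar> \<le> L * s\<^sup>2"
      unfolding b_def by (rule E) (use a s b in \<open>auto simp: b_def\<close>)
    have 2: "\<bar>g (a + s *\<^sub>R direction y w) - g b - s * D b z $ w\<bar> \<le> L * s\<^sup>2"
      unfolding bw[symmetric] by (rule E) (use b bw aw s in auto)
    have 3: "\<bar>g (a + s *\<^sub>R direction y w) - g a - s * D a y $ w\<bar> \<le> L * s\<^sup>2"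
      by (rule E) (use a aw s in auto)
    have "norm (b - a) \<le> 2 * s"
      using s norm_direction_le[of y z] by (simp add: b_def)
    then have 4: "\<bar>D b z $ w - D a z $ w\<bar> \<le> 2 * L * s"
      using Lip[OF b a(1), of z w] mult_left_mono[of "norm (b - a)" "2 * s" L] L0 by simp
    have "\<bar>s * (D a y $ z + D b z $ w - D a y $ w)\<bar> \<le> 3 * (L * s\<^sup>2)"
      using 1 2 3 by (simp add: algebra_simps)
    then have "s * \<bar>D a y $ z + D b z $ w - D a y $ w\<bar> \<le> s * (3 * L * s)"
    proof -
      have "s * \<bar>D a y $ z + D b z $ w - D a y $ w\<bar> = \<bar>s * (D a y $ z + D b z $ w - D a y $ w)\<bar>"
        using s by (simp only: abs_mult abs_of_pos)
      also note \<open>\<dots> \<le> 3 * (L * s\<^sup>2)\<close>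
      finally show ?thesis by (simp add: power2_eq_square mult_ac)
    qed
    then have 5: "\<bar>D a y $ z + D b z $ w - D a y $ w\<bar> \<le> 3 * L * s"
      by (rule mult_left_le_imp_le[OF _ s(1)])
    have 6: "\<bar>D a y' $ z' - D m y' $ z'\<bar> \<le> L * (2 * ?N * s)" for y' z'
      using Lip[OF a(1) m, of y' z'] mult_left_mono[OF a(3) L0] by simp
    show "\<bar>D m y $ z + D m z $ w - D m y $ w\<bar> \<le> L * (5 + 6 * ?N) * s"
      using 4 5 6[of y z] 6[of z w] 6[of y w] by (simp add: algebra_simps)
  qed (use N in auto)
  then show ?thesis by simp
qed

text \<open>Two points of the simplex are joined by at most \<open>CARD('d)\<close> transfers, each
  of which settles one coordinate for good. No coordinate moves away from its target on the way, so
  every derivative is taken at a distance from \<open>m\<close> that is comparable to that of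
  \<open>m\<close> and \<open>m'\<close>. By the cocycle identity the contributions add up to the
  inner product of one row \<open>D m w\<close> with the displacement, for any fixed
  \<open>w\<close>.\<close>

lemma transfer_expansion_simplex_gradient:
  fixes g :: "real ^ 'd::finite \<Rightarrow> real"
  assumes ex: "transfer_expansion L g D"
  shows "simplex_gradient (4 * L * real CARD('d) ^ 3) g (\<lambda>m. D m w)"
proof -
  let ?N = "real CARD('d)"
  have N1: "?N \<ge> 1" by (simp add: Suc_leI)
  have E: "\<And>a y z c. a \<in> simplex_P \<Longrightarrow> 0 \<le> c \<Longrightarrow> a + c *\<^sub>R direction y z \<in> simplex_P \<Longrightarrow>
      \<bar>g (a + c *\<^sub>R direction y z) - g a - c * D a y $ z\<bar> \<le> L * c\<^sup>2"
    and Lip: "\<And>a b y z. a \<in> simplex_P \<Longrightarrow> b \<in> simplex_P \<Longrightarrow> \<bar>D a y $ z - D b y $ z\<bar> \<le> L * norm (a - b)"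
    and L0: "0 \<le> L"
    using ex by (auto simp: transfer_expansion_def)
  have main: "\<bar>g m' - g a - D m w \<bullet> (m' - a)\<bar> \<le> real n * (4 * L * R\<^sup>2)"
    if "m \<in> simplex_P" "m' \<in> simplex_P" "a \<in> simplex_P" "card {j. a $ j \<noteq> m' $ j} \<le> n"
      "(\<Sum>j\<in>UNIV. \<bar>a $ j - m' $ j\<bar>) \<le> R" "(\<Sum>j\<in>UNIV. \<bar>m $ j - m' $ j\<bar>) \<le> R"
    for m m' a n and R :: real
    using that
  proof (induction n arbitrary: a)
    case 0
    then have "a = m'" by (simp add: vec_eq_iff)
    then show ?case by simp
  next
    case (Suc n)
    show ?case
    proof (cases "a = m'")
      case True
      then show ?thesis using L0 by simp
    next
      case False
      have sum_eq: "(\<Sum>j\<in>UNIV. a $ j) = (\<Sum>j\<in>UNIV. m' $ j)"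
        using Suc.prems(2,3) by (simp add: simplex_P_def)
      obtain y where y: "m' $ y < a $ y"
      proof (rule ccontr)
        assume "\<not> thesis"
        then have "\<And>j. a $ j \<le> m' $ j" using that by (meson not_le)
        then have "a $ j = m' $ j" for j
          by (intro sum_mono_inv[of "\<lambda>j. a $ j" UNIV "\<lambda>j. m' $ j"]) (auto simp: sum_eq)
        then show False using False by (simp add: vec_eq_iff)
      qed
      obtain z where z: "a $ z < m' $ z"
      proof (rule ccontr)
        assume "\<not> thesis"
        then have "\<And>j. m' $ j \<le> a $ j" using that by (meson not_le)
        then have "m' $ j = a $ j" for j
          by (intro sum_mono_inv[of "\<lambda>j. m' $ j" UNIV "\<lambda>j. a $ j"]) (auto simp: sum_eq)
        then show False using False by (simp add: vec_eq_iff)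
      qed
      have yz: "y \<noteq> z" using y z by auto
      \<comment> \<open>The smaller of the surplus of \<open>y\<close> and the deficit of
        \<open>z\<close>: after the transfer one of the two states holds its final mass, so the
        number of wrong coordinates drops.\<close>
      define c where "c = min (a $ y - m' $ y) (m' $ z - a $ z)"
      have c: "0 < c" "c \<le> a $ y - m' $ y" "c \<le> m' $ z - a $ z" using y z by (auto simp: c_def)
      define b where "b = a + c *\<^sub>R direction y z"
      have bj: "b $ j = (if j = z then a $ z + c else if j = y then a $ y - c else a $ j)" for j
        using yz by (auto simp: b_def direction_nth)
      have b: "b \<in> simplex_P" unfolding b_def
        by (rule shift_direction_in_simplex_P)
           (use Suc.prems c simplex_P_nonneg[OF Suc.prems(2), of y] in auto)
      have "{j. b $ j \<noteq> m' $ j} \<subset> {j. a $ j \<noteq> m' $ j}"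
      proof -
        have "{j. b $ j \<noteq> m' $ j} \<subseteq> {j. a $ j \<noteq> m' $ j}" using y z by (auto simp: bj split: if_splits)
        moreover have "b $ y = m' $ y \<or> b $ z = m' $ z" using yz by (auto simp: bj c_def min_def)
        ultimately show ?thesis using y z by auto
      qed
      then have "card {j. b $ j \<noteq> m' $ j} < card {j. a $ j \<noteq> m' $ j}" by (intro psubset_card_mono) auto
      then have card: "card {j. b $ j \<noteq> m' $ j} \<le> n" using Suc.prems(4) by simp
      have dec: "\<bar>b $ j - m' $ j\<bar> \<le> \<bar>a $ j - m' $ j\<bar>" for j using c y z by (auto simp: bj)
      have l1: "(\<Sum>j\<in>UNIV. \<bar>b $ j - m' $ j\<bar>) \<le> R"
        using sum_mono[of UNIV "\<lambda>j. \<bar>b $ j - m' $ j\<bar>" "\<lambda>j. \<bar>a $ j - m' $ j\<bar>"] dec Suc.prems(5) by auto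
      have cR: "c \<le> R"
      proof -
        have "c \<le> \<bar>a $ y - m' $ y\<bar>" using c by simp
        also have "\<dots> \<le> (\<Sum>j\<in>UNIV. \<bar>a $ j - m' $ j\<bar>)" by (rule member_le_sum) auto
        finally show ?thesis using Suc.prems(5) by simp
      qed
      have IH: "\<bar>g m' - g b - D m w \<bullet> (m' - b)\<bar> \<le> real n * (4 * L * R\<^sup>2)"
        by (rule Suc.IH[OF Suc.prems(1,2) b card l1 Suc.prems(6)])
      have "norm (a - m) \<le> (\<Sum>j\<in>UNIV. \<bar>(a - m) $ j\<bar>)" by (rule norm_le_l1_cart)
      also have "\<dots> \<le> (\<Sum>j\<in>UNIV. \<bar>a $ j - m' $ j\<bar> + \<bar>m $ j - m' $ j\<bar>)" by (intro sum_mono) auto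
      also have "\<dots> \<le> 2 * R" using Suc.prems(5,6) by (simp add: sum.distrib)
      finally have am: "norm (a - m) \<le> 2 * R" .
      have "\<bar>D a y $ z - D m y $ z\<bar> \<le> L * (2 * R)"
        using Lip[OF Suc.prems(3,1), of y z] mult_left_mono[OF am L0] by simp
      then have "c * \<bar>D a y $ z - D m y $ z\<bar> \<le> R * (L * (2 * R))"
        using c cR L0 by (intro mult_mono) auto
      then have 1: "\<bar>c * D a y $ z - c * D m y $ z\<bar> \<le> 2 * (L * R\<^sup>2)"
      proof -
        have "\<bar>c * D a y $ z - c * D m y $ z\<bar> = c * \<bar>D a y $ z - D m y $ z\<bar>"
          using c by (simp add: abs_mult flip: right_diff_distrib)
        also note \<open>\<dots> \<le> R * (L * (2 * R))\<close>
        finally show ?thesis by (simp add: power2_eq_square mult_ac)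
      qed
      have 2: "\<bar>g b - g a - c * D a y $ z\<bar> \<le> L * c\<^sup>2"
        unfolding b_def by (rule E) (use Suc.prems c b in \<open>auto simp: b_def\<close>)
      have 3: "L * c\<^sup>2 \<le> L * R\<^sup>2" using c cR L0 by (intro mult_left_mono power_mono) auto
      \<comment> \<open>The cocycle identity in the form
        \<open>D m w $ z - D m w $ y = D m y $ z\<close> turns the derivative along a transfer into
        a difference of two components of one vector.\<close>
      have 4: "D m w \<bullet> (b - a) = c * D m y $ z"
        using transfer_expansion_cocycle[OF ex Suc.prems(1), of w y z]
        by (simp add: b_def inner_direction algebra_simps) (metis distrib_left)
      have 5: "D m w \<bullet> (m' - a) = D m w \<bullet> (m' - b) + D m w \<bullet> (b - a)" by (simp add: inner_diff_right)
      have 6: "0 \<le> L * R\<^sup>2" using L0 by simp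
      have "\<bar>g m' - g a - D m w \<bullet> (m' - a)\<bar> \<le> real n * (4 * L * R\<^sup>2) + 4 * (L * R\<^sup>2)"
        using IH 1 2 3 6 unfolding 5 4 by linarith
      then show ?thesis by (simp add: algebra_simps)
    qed
  qed
  have "\<bar>g m' - g m - D m w \<bullet> (m' - m)\<bar> \<le> 4 * L * ?N ^ 3 * (norm (m' - m))\<^sup>2"
    if m: "m \<in> simplex_P" "m' \<in> simplex_P" for m m'
  proof -
    let ?R = "\<Sum>j\<in>UNIV. \<bar>m $ j - m' $ j\<bar>"
    have "?R \<le> (\<Sum>j\<in>(UNIV::'d set). norm (m' - m))"
      by (intro sum_mono) (use component_le_norm_cart[of "m' - m"] in \<open>simp add: abs_minus_commute\<close>)
    then have R: "?R \<le> ?N * norm (m' - m)" by simp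
    have "\<bar>g m' - g m - D m w \<bullet> (m' - m)\<bar> \<le> ?N * (4 * L * ?R\<^sup>2)"
      by (rule main[OF m m(1)]) (auto intro: card_mono)
    also have "\<dots> \<le> ?N * (4 * L * (?N * norm (m' - m))\<^sup>2)"
      using R L0 by (intro mult_left_mono power_mono) (auto intro: sum_nonneg)
    finally show ?thesis by (simp add: power2_eq_square power3_eq_cube algebra_simps)
  qed
  moreover have "norm (D m w - D m' w) \<le> 4 * L * ?N ^ 3 * norm (m - m')"
    if m: "m \<in> simplex_P" "m' \<in> simplex_P" for m m'
  proof -
    have "norm (D m w - D m' w) \<le> (\<Sum>j\<in>UNIV. \<bar>(D m w - D m' w) $ j\<bar>)" by (rule norm_le_l1_cart)
    also have "\<dots> \<le> (\<Sum>j\<in>(UNIV::'d set). L * norm (m - m'))"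
      by (intro sum_mono) (use Lip[OF m] in simp)
    also have "\<dots> = ?N * (L * norm (m - m'))" by simp
    also have "\<dots> \<le> (4 * ?N ^ 3) * (L * norm (m - m'))"
    proof (rule mult_right_mono)
      have "?N \<le> ?N ^ 3" by (rule self_le_power[OF N1]) simp
      then show "?N \<le> 4 * ?N ^ 3" using N1 by linarith
    qed (use L0 in simp)
    finally show ?thesis by (simp add: algebra_simps)
  qed
  ultimately show ?thesis using L0 by (auto simp: simplex_gradient_def)
qed

text \<open>On the segment of a transfer the direction from \<open>y\<close> to \<open>z\<close>
  yields right limits and the reverse direction yields left limits, so the restriction of
  \<open>g\<close> is continuous. Its right derivatives then differ from \<open>D a y $ z\<close> by
  at most \<open>2 * L * c\<close>, the 2 being the bound for the norm of a transfer
  direction.\<close>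

lemma C1_simplex_transfer_expansion:
  fixes g :: "real ^ 'd::finite \<Rightarrow> real"
  assumes g: "C1_simplex g D" and Lip: "\<And>y. L-lipschitz_on simplex_P (\<lambda>m. D m y)"
  shows "transfer_expansion (2 * L) g D"
proof -
  have L0: "0 \<le> L" using Lip lipschitz_on_nonneg by blast
  have Lip': "\<bar>D a y $ z - D b y $ z\<bar> \<le> L * norm (a - b)" if "a \<in> simplex_P" "b \<in> simplex_P" for a b y z
  proof -
    have "\<bar>(D a y - D b y) $ z\<bar> \<le> norm (D a y - D b y)" by (rule component_le_norm_cart)
    also have "\<dots> \<le> L * norm (a - b)" using lipschitz_onD[OF Lip that, of y] by (simp add: dist_norm)
    finally show ?thesis by simp
  qed
  have der: "((\<lambda>s. (g (m + s *\<^sub>R direction y z) - g m) / s) \<longlongrightarrow> D m y $ z) (at_right 0)"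
    if "m \<in> simplex_P" "admissible m y z" for m y z
    using g that by (auto simp: C1_simplex_def has_simplex_derivative_def)
  have "\<bar>g (a + c *\<^sub>R direction y z) - g a - c * D a y $ z\<bar> \<le> 2 * L * c\<^sup>2"
    if a: "a \<in> simplex_P" and c: "0 \<le> c" and ac: "a + c *\<^sub>R direction y z \<in> simplex_P" for a c y z
  proof -
    let ?e = "direction y z"
    define \<psi> where "\<psi> s = g (a + s *\<^sub>R ?e)" for s
    have seg: "a + s *\<^sub>R ?e \<in> simplex_P" if "0 \<le> s" "s \<le> c" for s
    proof (cases "c = 0")
      case False
      then have c0: "c > 0" using c by simp
      have "(1 - s/c) *\<^sub>R a + (s/c) *\<^sub>R (a + c *\<^sub>R ?e) \<in> simplex_P"
        by (rule convexD[OF convex_simplex_P a ac]) (use that c0 in auto)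
      moreover have "(1 - s/c) *\<^sub>R a + (s/c) *\<^sub>R (a + c *\<^sub>R ?e) = a + s *\<^sub>R ?e"
        using c0 by (simp add: algebra_simps)
      ultimately show ?thesis by simp
    qed (use that a in auto)
    have right: "((\<lambda>h. (\<psi> (s + h) - \<psi> s) / h) \<longlongrightarrow> D (a + s *\<^sub>R ?e) y $ z) (at_right 0)"
      if s: "0 \<le> s" "s < c" for s
    proof -
      have "admissible (a + s *\<^sub>R ?e) y z" unfolding admissible_def
      proof (intro exI[of _ "c - s"] conjI ballI)
        fix r assume "r \<in> {0<..<c - s}"
        then show "a + s *\<^sub>R ?e + r *\<^sub>R ?e \<in> simplex_P"
          using seg[of "s + r"] s by (auto simp: algebra_simps)
      qed (use s in auto)
      from der[OF seg this] s show ?thesis by (simp add: \<psi>_def algebra_simps)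
    qed
    \<comment> \<open>The reverse transfer is admissible at every point of the segment other than
      the starting point, because it retraces the path. This supplies continuity from the left,
      including at the endpoint \<open>c\<close>.\<close>
    have left: "((\<lambda>h. (\<psi> (s - h) - \<psi> s) / h) \<longlongrightarrow> D (a + s *\<^sub>R ?e) z $ y) (at_right 0)"
      if s: "0 < s" "s \<le> c" for s
    proof -
      have zy: "direction z y = - ?e" by (simp add: direction_def)
      have "admissible (a + s *\<^sub>R ?e) z y" unfolding admissible_def
      proof (intro exI[of _ s] conjI ballI)
        fix r assume "r \<in> {0<..<s}"
        then show "a + s *\<^sub>R ?e + r *\<^sub>R direction z y \<in> simplex_P"
          using seg[of "s - r"] s by (auto simp: zy algebra_simps)
      qed (use s in auto)
      from der[OF seg this] s show ?thesis by (simp add: \<psi>_def zy algebra_simps)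
    qed
    have lim: "((\<lambda>h. f h) \<longlongrightarrow> l) (at_right 0)"
      if "((\<lambda>h. (f h - l) / h) \<longlongrightarrow> d) (at_right 0)" for f and l d :: real
    proof -
      have "((\<lambda>h. h * ((f h - l) / h) + l) \<longlongrightarrow> 0 * d + l) (at_right 0)"
        by (intro tendsto_intros that)
      moreover have "\<forall>\<^sub>F h in at_right 0. h * ((f h - l) / h) + l = f h"
        using eventually_at_right_less[of 0] by eventually_elim simp
      ultimately show ?thesis by (simp add: tendsto_cong)
    qed
    have "continuous_on {0..c} \<psi>"
    proof (cases "c = 0")
      case False
      then have c0: "c > 0" using c by simp
      have R: "(\<psi> \<longlongrightarrow> \<psi> s) (at_right s)" if "0 \<le> s" "s < c" for s
        using lim[OF right[OF that]] filterlim_at_right_to_0[of \<psi> "nhds (\<psi> s)" s] by (simp add: add.commute)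
      have Lf: "(\<psi> \<longlongrightarrow> \<psi> s) (at_left s)" if "0 < s" "s \<le> c" for s
      proof -
        have "((\<lambda>h. \<psi> (s - h)) \<longlongrightarrow> \<psi> s) (at_right 0)" by (rule lim[OF left[OF that]])
        then show ?thesis
          unfolding at_left_minus[of s] filterlim_filtermap filterlim_at_right_to_0[of _ _ "- s"]
          by simp
      qed
      show ?thesis
        by (rule continuous_on_IccI) (use R Lf c0 in \<open>auto simp: filterlim_at_split\<close>)
    qed simp
    then have "\<bar>\<psi> c - \<psi> 0 - (c - 0) * D a y $ z\<bar> \<le> (L * (c * 2)) * (c - 0)"
    proof (rule right_derivative_bound[OF c _ right])
      fix s assume s: "0 \<le> s" "s < c"
      have "norm (a + s *\<^sub>R ?e - a) \<le> c * 2"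
        using s norm_direction_le[of y z] by (auto intro!: mult_mono)
      then show "\<bar>D (a + s *\<^sub>R ?e) y $ z - D a y $ z\<bar> \<le> L * (c * 2)"
        using Lip'[OF seg a, of s y z] s mult_left_mono[OF _ L0] by fastforce
    qed
    then show ?thesis by (simp add: \<psi>_def power2_eq_square algebra_simps)
  qed
  moreover have "L * norm (a - b) \<le> 2 * L * norm (a - b)" for a b :: "real^'d" using L0 by (intro mult_right_mono) auto
  ultimately show ?thesis using Lip' L0 unfolding transfer_expansion_def by (meson order_trans mult_nonneg_nonneg zero_le_numeral)
qed


text \<open>The entry \<open>A m $ z - A m $ y\<close> is the inner product of \<open>A m\<close>
  with the transfer direction, in which the undetermined constant of the gradient cancels.\<close>

lemma simplex_gradient_C1:
  fixes g :: "real ^ 'd::finite \<Rightarrow> real"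
  assumes g: "simplex_gradient C g A"
  defines "D \<equiv> \<lambda>m y. \<chi> z. A m $ z - A m $ y"
  shows "C1_simplex g D" "(2 * real CARD('d) * C)-lipschitz_on simplex_P (\<lambda>m. D m y)"
proof -
  have C0: "0 \<le> C"
    and Lip: "\<And>m m'. m \<in> simplex_P \<Longrightarrow> m' \<in> simplex_P \<Longrightarrow> norm (A m - A m') \<le> C * norm (m - m')"
    and ex: "\<And>m m'. m \<in> simplex_P \<Longrightarrow> m' \<in> simplex_P \<Longrightarrow>
        \<bar>g m' - g m - A m \<bullet> (m' - m)\<bar> \<le> C * (norm (m' - m))\<^sup>2"
    using g by (auto simp: simplex_gradient_def)
  show lip: "(2 * real CARD('d) * C)-lipschitz_on simplex_P (\<lambda>m. D m y)" for y
  proof (rule lipschitz_onI)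
    fix m m' :: "real^'d" assume m: "m \<in> simplex_P" "m' \<in> simplex_P"
    have "norm (D m y - D m' y) \<le> (\<Sum>z\<in>UNIV. \<bar>(D m y - D m' y) $ z\<bar>)" by (rule norm_le_l1_cart)
    also have "\<dots> \<le> (\<Sum>z\<in>(UNIV::'d set). 2 * (C * norm (m - m')))"
    proof (rule sum_mono)
      fix z :: 'd
      have "\<bar>(D m y - D m' y) $ z\<bar> \<le> \<bar>(A m - A m') $ z\<bar> + \<bar>(A m - A m') $ y\<bar>" by (simp add: D_def)
      also have "\<dots> \<le> 2 * norm (A m - A m')"
        using component_le_norm_cart[of "A m - A m'" z] component_le_norm_cart[of "A m - A m'" y] by linarith
      also have "\<dots> \<le> 2 * (C * norm (m - m'))" using Lip[OF m] by simp
      finally show "\<bar>(D m y - D m' y) $ z\<bar> \<le> 2 * (C * norm (m - m'))" .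
    qed
    finally show "dist (D m y) (D m' y) \<le> 2 * real CARD('d) * C * dist m m'"
      by (simp add: dist_norm mult_ac)
  qed (use C0 in simp)
  have "has_simplex_derivative g D"
    unfolding has_simplex_derivative_def
  proof (intro ballI allI impI)
    fix m :: "real^'d" and y z assume m: "m \<in> simplex_P" and "admissible m y z"
    then obtain \<epsilon> where \<epsilon>: "\<epsilon> > 0" "\<And>s. s \<in> {0<..<\<epsilon>} \<Longrightarrow> m + s *\<^sub>R direction y z \<in> simplex_P"
      by (auto simp: admissible_def)
    have D: "D m y $ z = A m \<bullet> direction y z" by (simp add: D_def inner_direction)
    have "((\<lambda>s. (g (m + s *\<^sub>R direction y z) - g m) / s - D m y $ z) \<longlongrightarrow> 0) (at_right 0)"
    proof (rule tendsto_0_le)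
      show "((\<lambda>s. s) \<longlongrightarrow> 0) (at_right (0::real))" by (simp add: tendsto_ident_at)
      have "\<forall>\<^sub>F s in at_right 0. s \<in> {0<..<\<epsilon>}" by (rule eventually_at_rightI[of 0 \<epsilon>]) (use \<epsilon> in auto)
      then show "\<forall>\<^sub>F s in at_right 0. norm ((g (m + s *\<^sub>R direction y z) - g m) / s - D m y $ z) \<le> norm s * (4 * C)"
      proof eventually_elim
        case (elim s)
        then have s: "s > 0" by simp
        have "\<bar>g (m + s *\<^sub>R direction y z) - g m - s * D m y $ z\<bar> \<le> C * (norm (s *\<^sub>R direction y z))\<^sup>2"
          using ex[OF m \<epsilon>(2)[OF elim]] by (simp add: D)
        also have "\<dots> \<le> C * (s * 2)\<^sup>2"
          using s norm_direction_le[of y z] C0 by (intro mult_left_mono power_mono) auto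
        finally have "\<bar>g (m + s *\<^sub>R direction y z) - g m - s * D m y $ z\<bar> \<le> s * (s * (4 * C))"
          by (simp add: power2_eq_square mult_ac)
        moreover have "g (m + s *\<^sub>R direction y z) - g m - s * D m y $ z
            = s * ((g (m + s *\<^sub>R direction y z) - g m) / s - D m y $ z)" using s by (simp add: field_simps)
        ultimately have "s * \<bar>(g (m + s *\<^sub>R direction y z) - g m) / s - D m y $ z\<bar> \<le> s * (s * (4 * C))"
          using s by (simp only: abs_mult abs_of_pos)
        then show ?case using s by simp
      qed
    qed
    then show "((\<lambda>s. (g (m + s *\<^sub>R direction y z) - g m) / s) \<longlongrightarrow> D m y $ z) (at_right 0)"
      by (simp add: LIM_zero_iff)
  qed
  then show "C1_simplex g D"
    using lipschitz_on_continuous_on[OF lip] by (auto simp: C1_simplex_def)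
qed

text \<open>Monotonicity for two points that differ by \<open>s *\<^sub>R e\<close>, a small
  multiple of \<open>\<rho>\<close>, divided by the square of \<open>s\<close>. Since
  \<open>m\<close> may lie on the boundary, where such a displacement can leave the simplex, the
  base point is shifted inwards by \<open>s\<close>, at the cost of an error that vanishes with
  \<open>s\<close>.\<close>

lemma Mon_gradient_nonneg:
  fixes F :: "'d::finite \<Rightarrow> real ^ 'd \<Rightarrow> real"
  assumes mon: "Mon F" and grad: "\<And>x. simplex_gradient C (F x) (A x)"
    and m: "m \<in> simplex_P" and \<rho>: "(\<Sum>j\<in>UNIV. \<rho> $ j) = 0"
  shows "0 \<le> (\<Sum>x\<in>UNIV. (A x m \<bullet> \<rho>) * \<rho> $ x)"
proof -
  let ?N = "real CARD('d)"
  have N: "?N > 0" by simp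
  have C0: "0 \<le> C"
    and Lip: "\<And>x m m'. m \<in> simplex_P \<Longrightarrow> m' \<in> simplex_P \<Longrightarrow> norm (A x m - A x m') \<le> C * norm (m - m')"
    and ex: "\<And>x m m'. m \<in> simplex_P \<Longrightarrow> m' \<in> simplex_P \<Longrightarrow>
        \<bar>F x m' - F x m - A x m \<bullet> (m' - m)\<bar> \<le> C * (norm (m' - m))\<^sup>2"
    using grad by (auto simp: simplex_gradient_def)
  \<comment> \<open>Normalizes \<open>\<rho>\<close> so that all entries of \<open>e\<close> are at
    most 1 in size; a base point with entries at least \<open>s\<close> then leaves room for the
    displacement \<open>s *\<^sub>R e\<close>.\<close>
  define r where "r = 1 / (1 + norm \<rho>)"
  have r: "r > 0" by (simp add: r_def add_pos_nonneg)
  define e where "e = r *\<^sub>R \<rho>"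
  have e1: "norm e \<le> 1" by (simp add: e_def r_def field_simps add_pos_nonneg)
  then have ej: "\<bar>e $ j\<bar> \<le> 1" for j using component_le_norm_cart[of e j] by linarith
  have e0: "(\<Sum>j\<in>UNIV. e $ j) = 0" using \<rho> by (simp add: e_def sum_distrib_left[symmetric])
  have "- (\<Sum>x\<in>UNIV. (A x m \<bullet> e) * e $ x) \<le> 0"
  proof (rule le_zero_if_le_small[of "1 / ?N" _ "?N * (C + C * (2 * ?N))"])
    fix s :: real assume s: "0 < s" "s \<le> 1 / ?N"
    have s': "0 \<le> s" "?N * s \<le> 1" using s N by (auto simp: field_simps)
    define a where "a = interior_shift s m"
    have a: "a \<in> simplex_P" "\<And>j. s \<le> a $ j" "norm (a - m) \<le> 2 * ?N * s"
      unfolding a_def using interior_shift[OF m s'] by auto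
    have b: "a + s *\<^sub>R e \<in> simplex_P"
    proof (rule shift_in_simplex_P[OF a(1) e0])
      fix j
      have "s * (- (e $ j)) \<le> s * 1" using ej[of j] s by (intro mult_left_mono) auto
      then show "0 \<le> a $ j + s * e $ j" using a(2)[of j] by simp
    qed
    have "0 \<le> (\<Sum>x\<in>UNIV. (F x (a + s *\<^sub>R e) - F x a) * (s * e $ x))"
      using mon a(1) b unfolding Mon_def by (force simp: algebra_simps)
    also have "\<dots> \<le> (\<Sum>x\<in>UNIV. s\<^sup>2 * ((A x m \<bullet> e) * e $ x + (C + C * (2 * ?N)) * s))"
    proof (rule sum_mono)
      fix x
      have 1: "\<bar>F x (a + s *\<^sub>R e) - F x a - s * (A x a \<bullet> e)\<bar> \<le> C * s\<^sup>2"
      proof -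
        have "\<bar>F x (a + s *\<^sub>R e) - F x a - s * (A x a \<bullet> e)\<bar> \<le> C * (norm (s *\<^sub>R e))\<^sup>2"
          using ex[OF a(1) b, of x] by simp
        also have "\<dots> \<le> C * s\<^sup>2" using e1 s C0 by (intro mult_left_mono power_mono) auto
        finally show ?thesis .
      qed
      have "\<bar>(A x a - A x m) \<bullet> e\<bar> \<le> norm (A x a - A x m) * norm e" by (rule Cauchy_Schwarz_ineq2)
      also have "\<dots> \<le> norm (A x a - A x m) * 1" using e1 by (intro mult_left_mono) auto
      also have "\<dots> \<le> C * (2 * ?N * s)"
        using Lip[OF a(1) m, of x] mult_left_mono[OF a(3) C0] by simp
      finally have "s * \<bar>(A x a - A x m) \<bullet> e\<bar> \<le> s * (C * (2 * ?N * s))" using s by (intro mult_left_mono) auto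
      then have 2: "\<bar>s * (A x a \<bullet> e) - s * (A x m \<bullet> e)\<bar> \<le> C * (2 * ?N) * s\<^sup>2"
        using s by (simp add: inner_diff_left abs_mult power2_eq_square mult_ac flip: right_diff_distrib)
      have "\<bar>F x (a + s *\<^sub>R e) - F x a - s * (A x m \<bullet> e)\<bar> \<le> (C + C * (2 * ?N)) * s\<^sup>2"
        using 1 2 by (simp add: algebra_simps)
      moreover have "\<bar>e $ x\<bar> \<le> 1" by (rule ej)
      ultimately have "\<bar>(F x (a + s *\<^sub>R e) - F x a - s * (A x m \<bullet> e)) * e $ x\<bar> \<le> ((C + C * (2 * ?N)) * s\<^sup>2) * 1"
        unfolding abs_mult by (intro mult_mono) auto
      then have "(F x (a + s *\<^sub>R e) - F x a - s * (A x m \<bullet> e)) * e $ x \<le> (C + C * (2 * ?N)) * s\<^sup>2" by linarith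
      then have "s * ((F x (a + s *\<^sub>R e) - F x a - s * (A x m \<bullet> e)) * e $ x) \<le> s * ((C + C * (2 * ?N)) * s\<^sup>2)"
        using s by (intro mult_left_mono) auto
      then show "(F x (a + s *\<^sub>R e) - F x a) * (s * e $ x) \<le> s\<^sup>2 * ((A x m \<bullet> e) * e $ x + (C + C * (2 * ?N)) * s)"
        by (simp add: power2_eq_square algebra_simps)
    qed
    also have "\<dots> = s\<^sup>2 * ((\<Sum>x\<in>UNIV. (A x m \<bullet> e) * e $ x) + ?N * ((C + C * (2 * ?N)) * s))"
      by (simp add: sum_distrib_left[symmetric] sum.distrib)
    finally have "0 \<le> (\<Sum>x\<in>UNIV. (A x m \<bullet> e) * e $ x) + ?N * ((C + C * (2 * ?N)) * s)"
      using s by (simp add: zero_le_mult_iff)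
    then show "- (\<Sum>x\<in>UNIV. (A x m \<bullet> e) * e $ x) \<le> ?N * (C + C * (2 * ?N)) * s" by (simp add: mult_ac)
  qed (use N in auto)
  then have "0 \<le> r * r * (\<Sum>x\<in>UNIV. (A x m \<bullet> \<rho>) * \<rho> $ x)"
    by (simp add: e_def sum_distrib_left mult_ac)
  then show ?thesis using r by (metis mult_pos_pos zero_le_mult_iff not_le)
qed

text \<open>A Cauchy criterion for derivatives. Quotients at shifted points with shrinking steps
  converge, which defines \<open>D\<close> at all points of the simplex and for all transfers, also
  inadmissible ones. Passing to the limit in one of the two quotients gives the expansion; passing
  to the limit in both gives the Lipschitz bound.\<close>

lemma difference_quotients_expansion:
  fixes g :: "real ^ 'd::finite \<Rightarrow> real"
  assumes "0 \<le> C"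
    and quot: "\<And>y z a a' s s'. a \<in> simplex_P \<Longrightarrow> a' \<in> simplex_P \<Longrightarrow> 0 < s \<Longrightarrow> 0 < s' \<Longrightarrow>
      a + s *\<^sub>R direction y z \<in> simplex_P \<Longrightarrow> a' + s' *\<^sub>R direction y z \<in> simplex_P \<Longrightarrow>
      \<bar>(g (a + s *\<^sub>R direction y z) - g a) / s - (g (a' + s' *\<^sub>R direction y z) - g a') / s'\<bar>
        \<le> C * (norm (a - a') + s + s')"
  shows "\<exists>D. transfer_expansion C g D"
proof -
  let ?N = "real CARD('d)"
  have N: "?N \<ge> 1" by (simp add: Suc_leI)
  \<comment> \<open>The step has to satisfy \<open>?N * s n \<le> 1\<close> for
    \<open>interior_shift\<close>; the shift by \<open>s n\<close> then leaves room for a transfer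
    of exactly \<open>s n\<close>.\<close>
  define s where "s n = 1 / (?N * (real n + 1))" for n :: nat
  have s0: "0 < s n" "?N * s n \<le> 1" for n
    by (simp_all add: s_def add_pos_nonneg add_nonneg_pos divide_le_eq)
  have slim: "s \<longlonglongrightarrow> 0"
  proof -
    have "(\<lambda>n. (1 / ?N) * (1 / real (Suc n))) \<longlonglongrightarrow> (1 / ?N) * 0"
      by (intro tendsto_intros LIMSEQ_Suc[OF lim_1_over_n])
    then show ?thesis by (simp add: s_def[abs_def] add.commute)
  qed
  define a where "a n m = interior_shift (s n) m" for n and m :: "real^'d"
  have a: "a n m \<in> simplex_P" "norm (a n m - m) \<le> 2 * ?N * s n"
       "a n m + s n *\<^sub>R direction y z \<in> simplex_P" if "m \<in> simplex_P" for n m y z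
    using interior_shift[OF that less_imp_le[OF s0(1)] s0(2)] less_imp_le[OF s0(1)]
    by (auto simp: a_def intro!: shift_direction_in_simplex_P)
  define q where "q n m y z = (g (a n m + s n *\<^sub>R direction y z) - g (a n m)) / s n" for n m y z
  have alim: "(\<lambda>n. a n m) \<longlonglongrightarrow> m" if "m \<in> simplex_P" for m
  proof -
    have "(\<lambda>n. a n m - m) \<longlonglongrightarrow> 0"
      by (rule tendsto_0_le[OF slim, where K = "2 * ?N"])
         (use a(2)[OF that] s0 in \<open>auto simp: mult_ac abs_of_pos\<close>)
    then show ?thesis by (simp add: LIM_zero_iff)
  qed
  have qCauchy: "Cauchy (\<lambda>n. q n m y z)" if m: "m \<in> simplex_P" for m y z
  proof (rule metric_CauchyI)
    fix e :: real assume e: "0 < e"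
    define K where "K = C * (2 * ?N + 1) + 1"
    have K: "K > 0" using assms(1) by (simp add: K_def add_nonneg_pos)
    have "\<forall>\<^sub>F n in sequentially. s n < e / (2 * K)"
      by (rule order_tendstoD(2)[OF slim]) (use e K in simp)
    then obtain M where M: "\<And>n. n \<ge> M \<Longrightarrow> s n < e / (2 * K)" by (auto simp: eventually_sequentially)
    have "dist (q n m y z) (q k m y z) < e" if "n \<ge> M" "k \<ge> M" for n k
    proof -
      have "norm (a n m - a k m) \<le> norm (a n m - m) + norm (a k m - m)"
        by (metis norm_triangle_ineq4 diff_diff_eq2 diff_add_cancel add_diff_cancel_right')
      then have 1: "norm (a n m - a k m) \<le> 2 * ?N * (s n + s k)"
        using a(2)[OF m, of n] a(2)[OF m, of k] by (simp add: algebra_simps)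
      have "\<bar>q n m y z - q k m y z\<bar> \<le> C * (norm (a n m - a k m) + s n + s k)"
        unfolding q_def by (rule quot) (use a[OF m] s0 in auto)
      also have "\<dots> \<le> C * (2 * ?N * (s n + s k) + s n + s k)"
        using 1 assms(1) by (intro mult_left_mono) auto
      also have "\<dots> = (K - 1) * (s n + s k)" by (simp add: K_def algebra_simps)
      also have "\<dots> \<le> K * (s n + s k)" using s0(1)[of n] s0(1)[of k] by (simp add: algebra_simps)
      also have "\<dots> < K * (e / (2 * K) + e / (2 * K))"
        using M[OF that(1)] M[OF that(2)] K by (intro mult_strict_left_mono) auto
      also have "\<dots> = e" using K by (simp add: field_simps)
      finally show ?thesis by (simp add: dist_real_def)
    qed
    then show "\<exists>M. \<forall>m'\<ge>M. \<forall>n\<ge>M. dist (q m' m y z) (q n m y z) < e" by blast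
  qed
  define D where "D m y = (\<chi> z. lim (\<lambda>n. q n m y z))" for m y
  have qlim: "(\<lambda>n. q n m y z) \<longlonglongrightarrow> D m y $ z" if "m \<in> simplex_P" for m y z
    using Cauchy_convergent[OF qCauchy[OF that]] by (simp add: D_def convergent_LIMSEQ_iff)
  have "transfer_expansion C g D"
    unfolding transfer_expansion_def
  proof (intro conjI allI ballI impI assms(1))
    fix y z :: 'd and b :: "real^'d" and c :: real
    assume b: "b \<in> simplex_P" and c: "0 \<le> c" and bc: "b + c *\<^sub>R direction y z \<in> simplex_P"
    show "\<bar>g (b + c *\<^sub>R direction y z) - g b - c * D b y $ z\<bar> \<le> C * c\<^sup>2"
    proof (cases "c = 0")
      case False
      then have c0: "c > 0" using c by simp
      have "\<bar>(g (b + c *\<^sub>R direction y z) - g b) / c - D b y $ z\<bar> \<le> C * (norm (b - b) + c + 0)"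
      proof (rule tendsto_le[OF sequentially_bot])
        show "(\<lambda>n. C * (norm (b - a n b) + c + s n)) \<longlonglongrightarrow> C * (norm (b - b) + c + 0)"
          by (intro tendsto_intros alim b slim)
        show "(\<lambda>n. \<bar>(g (b + c *\<^sub>R direction y z) - g b) / c - q n b y z\<bar>) \<longlonglongrightarrow>
            \<bar>(g (b + c *\<^sub>R direction y z) - g b) / c - D b y $ z\<bar>"
          by (intro tendsto_intros qlim b)
        show "\<forall>\<^sub>F n in sequentially. \<bar>(g (b + c *\<^sub>R direction y z) - g b) / c - q n b y z\<bar>
            \<le> C * (norm (b - a n b) + c + s n)"
          unfolding q_def by (intro always_eventually allI quot) (use a[OF b] b bc c0 s0 in auto)
      qed
      then have "c * \<bar>(g (b + c *\<^sub>R direction y z) - g b) / c - D b y $ z\<bar> \<le> c * (C * c)"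
        using c0 by (intro mult_left_mono) auto
      moreover have "g (b + c *\<^sub>R direction y z) - g b - c * D b y $ z
          = c * ((g (b + c *\<^sub>R direction y z) - g b) / c - D b y $ z)" using c0 by (simp add: field_simps)
      ultimately show ?thesis using c0 by (simp add: abs_mult power2_eq_square mult_ac)
    qed simp
  next
    fix y z :: 'd and b b' :: "real^'d"
    assume b: "b \<in> simplex_P" "b' \<in> simplex_P"
    have "\<bar>D b y $ z - D b' y $ z\<bar> \<le> C * (norm (b - b') + 0 + 0)"
    proof (rule tendsto_le[OF sequentially_bot])
      show "(\<lambda>n. C * (norm (a n b - a n b') + s n + s n)) \<longlonglongrightarrow> C * (norm (b - b') + 0 + 0)"
        by (intro tendsto_intros alim b slim)
      show "(\<lambda>n. \<bar>q n b y z - q n b' y z\<bar>) \<longlonglongrightarrow> \<bar>D b y $ z - D b' y $ z\<bar>"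
        by (intro tendsto_intros qlim b)
      show "\<forall>\<^sub>F n in sequentially. \<bar>q n b y z - q n b' y z\<bar> \<le> C * (norm (a n b - a n b') + s n + s n)"
        unfolding q_def by (intro always_eventually allI quot) (use a b s0 in auto)
    qed
    then show "\<bar>D b y $ z - D b' y $ z\<bar> \<le> C * norm (b - b')" by simp
  qed
  then show ?thesis by blast
qed

section \<open>Uniqueness\<close>

lemma inner_vec_sum: "(x :: real ^ 'd::finite) \<bullet> y = (\<Sum>j\<in>UNIV. x $ j * y $ j)"
  by (simp add: inner_vec_def)

lemma fdiff_diff: "fdiff (\<lambda>x. a x - b x) y = fdiff a y - fdiff b y"
  by (simp add: fdiff_def vec_eq_iff)

section \<open>Minima on the simplex\<close>

lemma directional_min_nonneg:
  assumes g: "has_simplex_derivative g D" and m: "m \<in> simplex_P" "0 < m $ y"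
    and min: "\<And>n. n \<in> simplex_P \<Longrightarrow> g m \<le> g n"
  shows "0 \<le> D m y $ z"
proof (rule tendsto_lowerbound)
  have adm: "admissible m y z" by (rule admissible_if_pos[OF m])
  show "((\<lambda>s. (g (m + s *\<^sub>R direction y z) - g m) / s) \<longlongrightarrow> D m y $ z) (at_right 0)"
    using g m adm by (auto simp: has_simplex_derivative_def)
  obtain \<epsilon> where \<epsilon>: "\<epsilon> > 0" "\<And>s. s \<in> {0<..<\<epsilon>} \<Longrightarrow> m + s *\<^sub>R direction y z \<in> simplex_P"
    using adm by (auto simp: admissible_def)
  show "\<forall>\<^sub>F s in at_right 0. 0 \<le> (g (m + s *\<^sub>R direction y z) - g m) / s"
    by (rule eventually_at_rightI[of 0 \<epsilon>]) (use \<epsilon> min in auto)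
qed simp

text \<open>The product rule with \<open>w\<close> and \<open>m'\<close> frozen. Differentiating the
  weights leaves the inner product of the gaps with a transfer direction, which is a component of a
  finite difference.\<close>

lemma has_simplex_derivative_pairing:
  fixes g :: "'d::finite \<Rightarrow> real ^ 'd \<Rightarrow> real"
  assumes g: "\<And>x. has_simplex_derivative (g x) (D x)"
  shows "has_simplex_derivative (\<lambda>m. \<Sum>x\<in>UNIV. (g x m - w x) * (m $ x - m' $ x))
    (\<lambda>m y. (\<Sum>x\<in>UNIV. (m $ x - m' $ x) *\<^sub>R D x m y) + fdiff (\<lambda>x. g x m - w x) y)"
  unfolding has_simplex_derivative_def
proof (intro ballI allI impI)
  fix m :: "real^'d" and y z assume m: "m \<in> simplex_P" "admissible m y z"
  let ?e = "direction y z"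
  let ?f = "\<lambda>m. \<Sum>x\<in>UNIV. (g x m - w x) * (m $ x - m' $ x)"
  have der: "((\<lambda>s. (g x (m + s *\<^sub>R ?e) - g x m) / s) \<longlongrightarrow> D x m y $ z) (at_right 0)" for x
    using g m by (auto simp: has_simplex_derivative_def)
  have 1: "((\<lambda>s. \<Sum>x\<in>UNIV. (g x (m + s *\<^sub>R ?e) - g x m) / s * (m $ x - m' $ x + s * ?e $ x)
      + (g x m - w x) * ?e $ x) \<longlongrightarrow>
      (\<Sum>x\<in>UNIV. D x m y $ z * (m $ x - m' $ x + 0 * ?e $ x) + (g x m - w x) * ?e $ x)) (at_right 0)"
    by (intro tendsto_intros der)
  have "\<forall>\<^sub>F s in at_right 0. (\<Sum>x\<in>UNIV. (g x (m + s *\<^sub>R ?e) - g x m) / s * (m $ x - m' $ x + s * ?e $ x)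
      + (g x m - w x) * ?e $ x) = (?f (m + s *\<^sub>R ?e) - ?f m) / s"
    using eventually_at_right_less[of 0]
  proof eventually_elim
    case (elim s)
    then show ?case
      by (simp add: sum_subtractf[symmetric] sum_divide_distrib) (intro sum.cong refl, simp add: field_simps)
  qed
  then have 2: "((\<lambda>s. (?f (m + s *\<^sub>R ?e) - ?f m) / s) \<longlongrightarrow>
      (\<Sum>x\<in>UNIV. D x m y $ z * (m $ x - m' $ x + 0 * ?e $ x) + (g x m - w x) * ?e $ x)) (at_right 0)"
    using 1 by (rule Lim_transform_eventually[rotated])
  have "(\<Sum>x\<in>UNIV. (g x m - w x) * ?e $ x) = fdiff (\<lambda>x. g x m - w x) y $ z"
  proof -
    have "(\<Sum>x\<in>UNIV. (g x m - w x) * ?e $ x) = (\<chi> x. g x m - w x) \<bullet> ?e" by (simp add: inner_vec_sum)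
    then show ?thesis by (simp add: inner_direction fdiff_def)
  qed
  with 2 show "((\<lambda>s. (?f (m + s *\<^sub>R ?e) - ?f m) / s) \<longlongrightarrow>
      ((\<Sum>x\<in>UNIV. (m $ x - m' $ x) *\<^sub>R D x m y) + fdiff (\<lambda>x. g x m - w x) y) $ z) (at_right 0)"
    by (simp add: sum.distrib mult.commute)
qed

text \<open>At a minimum no transfer out of an occupied state decreases \<open>g\<close>, and empty
  states carry weight zero. The transport term thus has a sign at boundary points too, without any
  boundary condition.\<close>

lemma weighted_min_nonneg:
  fixes g :: "real ^ 'd::finite \<Rightarrow> real"
  assumes g: "has_simplex_derivative g D" and m: "m \<in> simplex_P"
    and min: "\<And>n. n \<in> simplex_P \<Longrightarrow> g m \<le> g n"
    and \<alpha>: "\<And>y j. 0 \<le> \<alpha> y $ j"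
  shows "0 \<le> (\<Sum>y\<in>UNIV. m $ y * (D m y \<bullet> \<alpha> y))"
proof (rule sum_nonneg)
  fix y
  show "0 \<le> m $ y * (D m y \<bullet> \<alpha> y)"
  proof (cases "m $ y = 0")
    case False
    then have "0 < m $ y" using simplex_P_nonneg[OF m, of y] by simp
    then show ?thesis
      using directional_min_nonneg[OF g m _ min, of y] \<alpha>
      by (simp add: inner_vec_sum sum_nonneg)
  qed simp
qed

text \<open>The inequality at a minimum, sorted into the transport term of the equation and a
  remainder of the form control times finite difference, which the supporting-plane inequality of
  the Hamiltonian can absorb.\<close>

lemma pairing_min_nonneg:
  fixes g :: "'d::finite \<Rightarrow> real ^ 'd \<Rightarrow> real"
  assumes g: "\<And>x. has_simplex_derivative (g x) (D x)" and m: "m \<in> simplex_P"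
    and min: "\<And>n. n \<in> simplex_P \<Longrightarrow> (\<Sum>x\<in>UNIV. (g x m - w x) * (m $ x - m' $ x))
        \<le> (\<Sum>x\<in>UNIV. (g x n - w x) * (n $ x - m' $ x))"
    and \<alpha>: "\<And>y j. 0 \<le> \<alpha> y $ j"
  shows "0 \<le> (\<Sum>x\<in>UNIV. (\<Sum>y\<in>UNIV. m $ y * (D x m y \<bullet> \<alpha> y)) * (m $ x - m' $ x))
      + (\<Sum>y\<in>UNIV. m $ y * (\<alpha> y \<bullet> fdiff (\<lambda>x. g x m - w x) y))"
proof -
  have "0 \<le> (\<Sum>y\<in>UNIV. m $ y * (((\<Sum>x\<in>UNIV. (m $ x - m' $ x) *\<^sub>R D x m y) + fdiff (\<lambda>x. g x m - w x) y) \<bullet> \<alpha> y))"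
    by (rule weighted_min_nonneg[OF has_simplex_derivative_pairing[OF g] m min \<alpha>])
  also have "\<dots> = (\<Sum>y\<in>UNIV. \<Sum>x\<in>UNIV. m $ y * (D x m y \<bullet> \<alpha> y) * (m $ x - m' $ x))
      + (\<Sum>y\<in>UNIV. m $ y * (fdiff (\<lambda>x. g x m - w x) y \<bullet> \<alpha> y))"
    by (simp add: inner_add_left inner_sum_left sum.distrib distrib_left sum_distrib_left mult_ac)
  also have "(\<Sum>y\<in>UNIV. \<Sum>x\<in>UNIV. m $ y * (D x m y \<bullet> \<alpha> y) * (m $ x - m' $ x))
      = (\<Sum>x\<in>UNIV. (\<Sum>y\<in>UNIV. m $ y * (D x m y \<bullet> \<alpha> y)) * (m $ x - m' $ x))"
    by (subst sum.swap) (simp add: sum_distrib_right)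
  finally show ?thesis by (simp only: inner_commute[of "fdiff (\<lambda>x. g x m - w x) y" for y])
qed

text \<open>Convexity enters only as the inequality \<open>conv\<close> at arbitrary momenta, so
  solutions whose finite differences are not known to be bounded by a given constant are
  covered.\<close>

lemma classical_solutions_agree:
  fixes H :: "'d::finite \<Rightarrow> real ^ 'd \<Rightarrow> real" and \<alpha> :: "'d \<Rightarrow> real ^ 'd \<Rightarrow> real ^ 'd"
  assumes conv: "\<And>x p q. H x p - \<alpha> x p \<bullet> (q - p) \<le> H x q"
    and \<alpha>: "\<And>x p j. 0 \<le> \<alpha> x p $ j"
    and MonF: "Mon F" and MonG: "Mon G"
    and V: "classical_solution T H \<alpha> F G V" and W: "classical_solution T H \<alpha> F G W"
    and t: "t \<in> {0..T}" and m: "m \<in> simplex_P"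
  shows "V t x m = W t x m"
proof -
  obtain Vt DV where V: "classical_solution_with T H \<alpha> F G V Vt DV"
    using V by (auto simp: classical_solution_def)
  obtain Wt DW where W: "classical_solution_with T H \<alpha> F G W Wt DW"
    using W by (auto simp: classical_solution_def)
  let ?P = "simplex_P :: (real^'d) set"
  have cV: "\<And>x. continuous_on ({0..T} \<times> ?P) (\<lambda>(t, m). V t x m)"
    and cW: "\<And>x. continuous_on ({0..T} \<times> ?P) (\<lambda>(t, m). W t x m)"
    using V W by (auto simp: classical_solution_with_def)
  have dV: "((\<lambda>s. V s x m) has_real_derivative Vt t x m) (at t within {0..T})"
   and dW: "((\<lambda>s. W s x m) has_real_derivative Wt t x m) (at t within {0..T})"
    if "m \<in> ?P" "t \<in> {0..T}" for x t m
    using V W that by (auto simp: classical_solution_with_def)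
  have gV: "has_simplex_derivative (V t x) (DV t x)" and gW: "has_simplex_derivative (W t x) (DW t x)"
    if "t \<in> {0..T}" for x t
    using V W that by (auto simp: classical_solution_with_def C1_simplex_def)
  define dlV where "dlV t m x = fdiff (\<lambda>y. V t y m) x" for t m x
  define dlW where "dlW t m x = fdiff (\<lambda>y. W t y m) x" for t m x
  have eV: "Vt t x m = H x (dlV t m x) - (\<Sum>y\<in>UNIV. m $ y * (DV t x m y \<bullet> \<alpha> y (dlV t m y))) - F x m"
    if "m \<in> ?P" "t \<in> {0..T}" for x t m
  proof -
    have "- Vt t x m + H x (dlV t m x) - (\<Sum>y\<in>UNIV. m $ y * (DV t x m y \<bullet> \<alpha> y (dlV t m y))) = F x m"
      using V that by (simp add: classical_solution_with_def dlV_def)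
    then show ?thesis by linarith
  qed
  have eW: "Wt t x m = H x (dlW t m x) - (\<Sum>y\<in>UNIV. m $ y * (DW t x m y \<bullet> \<alpha> y (dlW t m y))) - F x m"
    if "m \<in> ?P" "t \<in> {0..T}" for x t m
  proof -
    have "- Wt t x m + H x (dlW t m x) - (\<Sum>y\<in>UNIV. m $ y * (DW t x m y \<bullet> \<alpha> y (dlW t m y))) = F x m"
      using W that by (simp add: classical_solution_with_def dlW_def)
    then show ?thesis by linarith
  qed
  have tV: "V T x m = G x m" and tW: "W T x m = G x m" if "m \<in> ?P" for x m
    using V W that by (auto simp: classical_solution_with_def)
  have cVm: "continuous_on ?P (V t x)" if "t \<in> {0..T}" for t x
    by (rule continuous_on_compose2[OF cV[of x], of _ "\<lambda>m. (t, m)", simplified]) (use that in \<open>auto intro!: continuous_intros\<close>)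
  have cWm: "continuous_on ?P (W t x)" if "t \<in> {0..T}" for t x
    by (rule continuous_on_compose2[OF cW[of x], of _ "\<lambda>m. (t, m)", simplified]) (use that in \<open>auto intro!: continuous_intros\<close>)
  have T: "0 \<le> T" "T \<in> {0..T}" using t by auto
  have monotone: "0 \<le> (\<Sum>x\<in>UNIV. (V t x m - W t x m') * (m $ x - m' $ x))"
    if t: "t \<in> {0..T}" and mm: "m \<in> ?P" "m' \<in> ?P" for t m m'
  proof -
    \<comment> \<open>The two distributions are independent variables while the time is shared. At a
      spatial minimum each can be varied with the other fixed, which yields one transport inequality
      for \<open>V\<close> and one for \<open>W\<close>.\<close>
    define f where "f t p = (\<Sum>x\<in>UNIV. (V t x (fst p) - W t x (snd p)) * (fst p $ x - snd p $ x))" for t p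
    have "0 \<le> f t (m, m')"
    proof (rule nonneg_if_decreasing_at_minima[where S = "?P \<times> ?P" and T = T and f = f])
      show "compact (?P \<times> ?P)" by (intro compact_Times compact_simplex_P)
      have 1: "continuous_on ({0..T} \<times> ?P \<times> ?P) (\<lambda>q. V (fst q) x (fst (snd q)))" for x
        by (rule continuous_on_compose2[OF cV[of x], of _ "\<lambda>q. (fst q, fst (snd q))", simplified])
           (auto intro!: continuous_intros)
      have 2: "continuous_on ({0..T} \<times> ?P \<times> ?P) (\<lambda>q. W (fst q) x (snd (snd q)))" for x
        by (rule continuous_on_compose2[OF cW[of x], of _ "\<lambda>q. (fst q, snd (snd q))", simplified])
           (auto intro!: continuous_intros)
      show "continuous_on ({0..T} \<times> ?P \<times> ?P) (\<lambda>(t, s). f t s)"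
        unfolding f_def case_prod_unfold by (intro continuous_intros 1 2)
      show "0 \<le> f T p" if "p \<in> ?P \<times> ?P" for p
        using MonG that by (auto simp: f_def tV tW Mon_def)
      fix t p assume t: "0 \<le> t" "t < T" and p: "p \<in> ?P \<times> ?P"
        and min: "\<And>p'. p' \<in> ?P \<times> ?P \<Longrightarrow> f t p \<le> f t p'"
      obtain m m' where pm: "p = (m, m')" by force
      have tT: "t \<in> {0..T}" and mP: "m \<in> ?P" "m' \<in> ?P" using t p pm by auto
      let ?D = "\<Sum>x\<in>UNIV. (Vt t x m - Wt t x m') * (m $ x - m' $ x)"
      let ?dl = "\<lambda>y. dlV t m y - dlW t m' y"
      let ?aV = "\<lambda>y. \<alpha> y (dlV t m y)" and ?aW = "\<lambda>y. \<alpha> y (dlW t m' y)"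
      let ?SV = "\<lambda>x. \<Sum>y\<in>UNIV. m $ y * (DV t x m y \<bullet> ?aV y)"
      let ?SW = "\<lambda>x. \<Sum>y\<in>UNIV. m' $ y * (DW t x m' y \<bullet> ?aW y)"
      have fd: "fdiff (\<lambda>x. V t x m - W t x m') y = ?dl y" "fdiff (\<lambda>x. W t x m' - V t x m) y = - ?dl y" for y
        by (simp_all add: fdiff_diff dlV_def dlW_def)
      have I1: "0 \<le> (\<Sum>x\<in>UNIV. ?SV x * (m $ x - m' $ x)) + (\<Sum>y\<in>UNIV. m $ y * (?aV y \<bullet> ?dl y))"
        unfolding fd[symmetric]
        by (rule pairing_min_nonneg[OF gV[OF tT] mP(1) _ \<alpha>]) (use min pm mP in \<open>force simp: f_def\<close>)
      have I2': "0 \<le> (\<Sum>x\<in>UNIV. ?SW x * (m' $ x - m $ x)) + (\<Sum>y\<in>UNIV. m' $ y * (?aW y \<bullet> fdiff (\<lambda>x. W t x m' - V t x m) y))"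
      proof (rule pairing_min_nonneg[OF gW[OF tT] mP(2) _ \<alpha>])
        fix n assume n: "n \<in> ?P"
        have "f t (m, m') \<le> f t (m, n)" using min[of "(m, n)"] pm mP n by simp
        then show "(\<Sum>x\<in>UNIV. (W t x m' - V t x m) * (m' $ x - m $ x)) \<le> (\<Sum>x\<in>UNIV. (W t x n - V t x m) * (n $ x - m $ x))"
          by (simp add: f_def algebra_simps)
      qed
      have I2: "0 \<le> - (\<Sum>x\<in>UNIV. ?SW x * (m $ x - m' $ x)) - (\<Sum>y\<in>UNIV. m' $ y * (?aW y \<bullet> ?dl y))"
      proof -
        have "(\<Sum>x\<in>UNIV. ?SW x * (m' $ x - m $ x)) = - (\<Sum>x\<in>UNIV. ?SW x * (m $ x - m' $ x))"
          unfolding sum_negf[symmetric] by (intro sum.cong refl) (simp only: algebra_simps)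
        moreover have "(\<Sum>y\<in>UNIV. m' $ y * (?aW y \<bullet> - ?dl y)) = - (\<Sum>y\<in>UNIV. m' $ y * (?aW y \<bullet> ?dl y))"
          unfolding sum_negf[symmetric] by (intro sum.cong refl) (simp only: inner_minus_right mult_minus_right)
        ultimately show ?thesis using I2' unfolding fd by linarith
      qed
      have F: "0 \<le> (\<Sum>x\<in>UNIV. (F x m - F x m') * (m $ x - m' $ x))"
        using MonF mP by (auto simp: Mon_def)
      have c1: "(\<Sum>x\<in>UNIV. m $ x * (H x (dlV t m x) - H x (dlW t m' x) + ?aV x \<bullet> ?dl x)) \<le> 0"
      proof (rule sum_nonpos)
        fix x
        have "H x (dlV t m x) - H x (dlW t m' x) + ?aV x \<bullet> ?dl x \<le> 0"
          using conv[of x "dlV t m x" "dlW t m' x"] by (simp add: inner_diff_right)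
        then show "m $ x * (H x (dlV t m x) - H x (dlW t m' x) + ?aV x \<bullet> ?dl x) \<le> 0"
          using simplex_P_nonneg[OF mP(1), of x] by (simp add: mult_nonneg_nonpos)
      qed
      have c2: "0 \<le> (\<Sum>x\<in>UNIV. m' $ x * (H x (dlV t m x) - H x (dlW t m' x) + ?aW x \<bullet> ?dl x))"
      proof (rule sum_nonneg)
        fix x
        have "0 \<le> H x (dlV t m x) - H x (dlW t m' x) + ?aW x \<bullet> ?dl x"
          using conv[of x "dlW t m' x" "dlV t m x"] by (simp add: inner_diff_right)
        then show "0 \<le> m' $ x * (H x (dlV t m x) - H x (dlW t m' x) + ?aW x \<bullet> ?dl x)"
          using simplex_P_nonneg[OF mP(2), of x] by simp
      qed
      \<comment> \<open>With both equations inserted the time derivative splits into five groups: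
        two convexity gaps, the monotone cost, and the two inequalities at the minimum. Each has the
        sign that makes the total nonpositive.\<close>
      have "?D = (\<Sum>x\<in>UNIV. m $ x * (H x (dlV t m x) - H x (dlW t m' x) + ?aV x \<bullet> ?dl x))
          - (\<Sum>x\<in>UNIV. m' $ x * (H x (dlV t m x) - H x (dlW t m' x) + ?aW x \<bullet> ?dl x))
          - (\<Sum>x\<in>UNIV. (F x m - F x m') * (m $ x - m' $ x))
          - ((\<Sum>x\<in>UNIV. ?SV x * (m $ x - m' $ x)) + (\<Sum>y\<in>UNIV. m $ y * (?aV y \<bullet> ?dl y)))
          - (- (\<Sum>x\<in>UNIV. ?SW x * (m $ x - m' $ x)) - (\<Sum>y\<in>UNIV. m' $ y * (?aW y \<bullet> ?dl y)))"
        unfolding eV[OF mP(1) tT] eW[OF mP(2) tT] sum_subtractf[symmetric] sum.distrib[symmetric] sum_negf[symmetric]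
        by (intro sum.cong refl) (simp only: algebra_simps)
      then have D0: "?D \<le> 0" using I1 I2 F c1 c2 by linarith
      have "((\<lambda>t. f t p) has_real_derivative ?D) (at t within {0..T})"
        unfolding f_def pm fst_conv snd_conv
        by (auto intro!: derivative_eq_intros dV[OF mP(1) tT] dW[OF mP(2) tT])
      then show "\<exists>D\<le>0. ((\<lambda>t. f t p) has_real_derivative D) (at t within {0..T})" using D0 by blast
    qed (use t mm in auto)
    then show ?thesis by (simp add: f_def)
  qed
  let ?N = "real CARD('d)"
  have N: "?N > 0" by simp
  \<comment> \<open>Monotonicity for \<open>m + s *\<^sub>R ?e\<close> and \<open>m\<close>, divided
    by \<open>s\<close>: in the limit the gap between the solutions at \<open>z\<close> is at least
    its mean under \<open>m\<close>.\<close>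
  have min_axis: "(\<Sum>x\<in>UNIV. (V t x m - W t x m) * m $ x) \<le> V t z m - W t z m"
    if t: "t \<in> {0..T}" and m: "m \<in> ?P" for t m z
  proof -
    let ?e = "axis z 1 - m"
    have sP: "m + s *\<^sub>R ?e \<in> ?P" if "s \<in> {0..1}" for s
      using convexD[OF convex_simplex_P m axis_in_simplex_P[of z], of "1 - s" s] that by (auto simp: algebra_simps)
    have "((\<lambda>s. \<Sum>x\<in>UNIV. (V t x (m + s *\<^sub>R ?e) - W t x m) * ?e $ x) \<longlongrightarrow>
        (\<Sum>x\<in>UNIV. (V t x (m + 0 *\<^sub>R ?e) - W t x m) * ?e $ x)) (at 0 within {0..1})"
    proof (intro tendsto_intros)
      fix x
      have "continuous_on {0..1} (\<lambda>s. V t x (m + s *\<^sub>R ?e))"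
        by (rule continuous_on_compose2[OF cVm[OF t, of x]]) (use sP in \<open>auto intro!: continuous_intros\<close>)
      then show "((\<lambda>s. V t x (m + s *\<^sub>R ?e)) \<longlongrightarrow> V t x (m + 0 *\<^sub>R ?e)) (at 0 within {0..1})"
        unfolding continuous_on_def by (rule bspec) simp
    qed
    then have lim: "((\<lambda>s. \<Sum>x\<in>UNIV. (V t x (m + s *\<^sub>R ?e) - W t x m) * ?e $ x) \<longlongrightarrow>
        (\<Sum>x\<in>UNIV. (V t x m - W t x m) * ?e $ x)) (at_right 0)"
      by (simp add: at_within_Icc_at_right)
    have "0 \<le> (\<Sum>x\<in>UNIV. (V t x m - W t x m) * ?e $ x)"
    proof (rule tendsto_lowerbound[OF lim])
      show "\<forall>\<^sub>F s in at_right 0. 0 \<le> (\<Sum>x\<in>UNIV. (V t x (m + s *\<^sub>R ?e) - W t x m) * ?e $ x)"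
      proof (rule eventually_at_rightI[of 0 1])
        fix s :: real assume s: "s \<in> {0<..<1}"
        have "0 \<le> (\<Sum>x\<in>UNIV. (V t x (m + s *\<^sub>R ?e) - W t x m) * ((m + s *\<^sub>R ?e) $ x - m $ x))"
          by (rule monotone[OF t _ m]) (use sP s in auto)
        also have "\<dots> = s * (\<Sum>x\<in>UNIV. (V t x (m + s *\<^sub>R ?e) - W t x m) * ?e $ x)"
          unfolding sum_distrib_left by (intro sum.cong refl) simp
        finally show "0 \<le> (\<Sum>x\<in>UNIV. (V t x (m + s *\<^sub>R ?e) - W t x m) * ?e $ x)"
          using s by (simp add: zero_le_mult_iff)
      qed simp
    qed simp
    also have "\<dots> = (V t z m - W t z m) - (\<Sum>x\<in>UNIV. (V t x m - W t x m) * m $ x)"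
    proof -
      have "(\<Sum>x\<in>UNIV. (V t x m - W t x m) * axis z 1 $ x) = (\<chi> x. V t x m - W t x m) \<bullet> axis z 1"
        by (simp add: inner_vec_sum)
      then show ?thesis by (simp add: right_diff_distrib sum_subtractf inner_axis)
    qed
    finally show ?thesis by simp
  qed
  have const: "V t y m - W t y m = V t z m - W t z m" if t: "t \<in> {0..T}" and m: "m \<in> ?P" for t m y z
  proof -
    \<comment> \<open>No gap lies below the mean, and at interior points all weights are positive,
      so every gap equals the mean. Boundary points follow by continuity.\<close>
    have pos: "V t y m - W t y m = V t z m - W t z m" if m: "m \<in> ?P" and pos: "\<And>j. 0 < m $ j" for m y z
    proof -
      let ?c = "\<lambda>x. V t x m - W t x m" and ?a = "\<Sum>x\<in>UNIV. (V t x m - W t x m) * m $ x"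
      have "(\<Sum>x\<in>UNIV. ?a * m $ x) = ?a * (\<Sum>x\<in>UNIV. m $ x)" by (rule sum_distrib_left[symmetric])
      then have eq: "(\<Sum>x\<in>UNIV. ?a * m $ x) = (\<Sum>x\<in>UNIV. ?c x * m $ x)"
        using simplex_P_sum[OF m] by simp
      have eqx: "?a * m $ x = ?c x * m $ x" for x
        by (rule sum_mono_inv[OF eq]) (use min_axis[OF t m] pos in \<open>auto intro!: mult_right_mono less_imp_le\<close>)
      have eqc: "?c x = ?a" for x
      proof -
        have "m $ x \<noteq> 0" using pos[of x] by simp
        then show ?thesis using eqx[of x] by simp
      qed
      show ?thesis by (rule trans[OF eqc[of y] eqc[of z, symmetric]])
    qed
    define s where "s n = 1 / (?N * (real n + 1))" for n :: nat
    have s0: "0 < s n" "?N * s n \<le> 1" for n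
      by (simp_all add: s_def add_pos_nonneg add_nonneg_pos divide_le_eq)
    have slim: "s \<longlonglongrightarrow> 0"
    proof -
      have "(\<lambda>n. (1 / ?N) * (1 / real (Suc n))) \<longlonglongrightarrow> (1 / ?N) * 0"
        by (intro tendsto_intros LIMSEQ_Suc[OF lim_1_over_n])
      then show ?thesis by (simp add: s_def[abs_def] add.commute)
    qed
    define a where "a n = interior_shift (s n) m" for n
    have a: "a n \<in> ?P" "0 < a n $ j" for n j
      using interior_shift[OF m less_imp_le[OF s0(1)] s0(2), of n] s0(1)[of n] less_le_trans
      unfolding a_def by blast+
    have alim: "a \<longlonglongrightarrow> m"
    proof -
      have "(\<lambda>n. (1 - ?N * s n) *\<^sub>R m + s n *\<^sub>R (\<chi> j. 1)) \<longlonglongrightarrow> (1 - ?N * 0) *\<^sub>R m + 0 *\<^sub>R (\<chi> j. 1)"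
        by (intro tendsto_intros slim)
      then show ?thesis by (simp add: a_def[abs_def] interior_shift_def)
    qed
    have l: "(\<lambda>n. V t x (a n) - W t x (a n)) \<longlonglongrightarrow> V t x m - W t x m" for x
      using continuous_on_tendsto_compose[OF cVm[OF t] alim m] continuous_on_tendsto_compose[OF cWm[OF t] alim m] a(1)
      by (intro tendsto_diff) auto
    have "V t y (a n) - W t y (a n) = V t z (a n) - W t z (a n)" for n by (rule pos) (rule a)+
    then show ?thesis using LIMSEQ_unique[OF l[of y]] l[of z] by simp
  qed
  have dl: "dlV t m y = dlW t m y" if "t \<in> {0..T}" "m \<in> ?P" for t m y
  proof -
    have "V t z m - V t y m = W t z m - W t y m" for z
      using const[OF that, of z y] by linarith
    then show ?thesis by (simp add: dlV_def dlW_def fdiff_def)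
  qed
  have diff_t: "Vt t x m - Wt t x m = - (\<Sum>y\<in>UNIV. m $ y * ((DV t x m y - DW t x m y) \<bullet> \<alpha> y (dlW t m y)))"
    if "t \<in> {0..T}" "m \<in> ?P" for t m x
    using eV[OF that(2,1), of x] eW[OF that(2,1), of x] dl[OF that]
    by (simp add: inner_diff_left right_diff_distrib sum_subtractf)
  \<comment> \<open>The minimum principle for \<open>V - W\<close> and for its negative: with equal
    controls the Hamiltonians and costs cancel, and what remains is linear with a transport term
    that has a sign at minima.\<close>
  have le: "0 \<le> \<sigma> * (V t x m - W t x m)" if \<sigma>: "\<sigma> = 1 \<or> \<sigma> = -1" for \<sigma> :: real
  proof (rule nonneg_if_decreasing_at_minima[where f = "\<lambda>t m. \<sigma> * (V t x m - W t x m)",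
        OF compact_simplex_P _ _ _ t m])
    show "continuous_on ({0..T} \<times> ?P) (\<lambda>(t, m). \<sigma> * (V t x m - W t x m))"
      using cV[of x] cW[of x] unfolding case_prod_unfold by (intro continuous_intros)
    show "0 \<le> \<sigma> * (V T x m - W T x m)" if "m \<in> ?P" for m using that by (simp add: tV tW)
    fix t m assume t: "0 \<le> t" "t < T" and m: "m \<in> ?P"
      and min: "\<And>n. n \<in> ?P \<Longrightarrow> \<sigma> * (V t x m - W t x m) \<le> \<sigma> * (V t x n - W t x n)"
    have tT: "t \<in> {0..T}" using t by auto
    have g: "has_simplex_derivative (\<lambda>m. \<sigma> * (V t x m - W t x m)) (\<lambda>m y. \<sigma> *\<^sub>R (DV t x m y - DW t x m y))"
      unfolding has_simplex_derivative_def
    proof (intro ballI allI impI)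
      fix m y z assume "m \<in> ?P" "admissible m y z"
      then have "((\<lambda>s. \<sigma> * ((V t x (m + s *\<^sub>R direction y z) - V t x m) / s - (W t x (m + s *\<^sub>R direction y z) - W t x m) / s))
          \<longlongrightarrow> \<sigma> * (DV t x m y $ z - DW t x m y $ z)) (at_right 0)"
        using gV[OF tT, of x] gW[OF tT, of x] by (intro tendsto_intros) (auto simp: has_simplex_derivative_def)
      moreover have "\<sigma> * ((a - b) / s - (c - d) / s) = (\<sigma> * (a - c) - \<sigma> * (b - d)) / s" for a b c d s :: real
        by (simp add: diff_divide_distrib right_diff_distrib)
      ultimately show "((\<lambda>s. (\<sigma> * (V t x (m + s *\<^sub>R direction y z) - W t x (m + s *\<^sub>R direction y z)) - \<sigma> * (V t x m - W t x m)) / s)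
          \<longlongrightarrow> (\<sigma> *\<^sub>R (DV t x m y - DW t x m y)) $ z) (at_right 0)"
        by simp
    qed
    have "0 \<le> (\<Sum>y\<in>UNIV. m $ y * ((\<sigma> *\<^sub>R (DV t x m y - DW t x m y)) \<bullet> \<alpha> y (dlW t m y)))"
      by (rule weighted_min_nonneg[OF g m min \<alpha>])
    also have "\<dots> = \<sigma> * - (Vt t x m - Wt t x m)"
      unfolding diff_t[OF tT m] by (simp add: sum_distrib_left mult_ac)
    finally have "\<sigma> * (Vt t x m - Wt t x m) \<le> 0" by (simp add: algebra_simps)
    moreover have "((\<lambda>t. \<sigma> * (V t x m - W t x m)) has_real_derivative \<sigma> * (Vt t x m - Wt t x m)) (at t within {0..T})"
      by (auto intro!: derivative_eq_intros dV[OF m tT] dW[OF m tT])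
    ultimately show "\<exists>D\<le>0. ((\<lambda>t. \<sigma> * (V t x m - W t x m)) has_real_derivative D) (at t within {0..T})" by blast
  qed
  show ?thesis using le[of 1] le[of "-1"] by simp
qed

section \<open>The mean field game system\<close>

lemma norm_le_card_mult:
  fixes v :: "real ^ 'd::finite"
  assumes "\<And>j. \<bar>v $ j\<bar> \<le> b"
  shows "norm v \<le> real CARD('d) * b"
  using norm_le_l1_cart[of v] sum_bounded_above[of UNIV "\<lambda>j. \<bar>v $ j\<bar>" b] assms by simp

lemma one_le_card: "1 \<le> real CARD('d::finite)"
  by (simp add: Suc_leI)

definition dl :: "real ^ 'd::finite \<Rightarrow> 'd \<Rightarrow> real ^ 'd" where
  "dl u x = fdiff (($) u) x"

text \<open>The motion of a unit mass at \<open>y\<close> that jumps to the states \<open>j\<close> at the rates \<open>w $ j\<close>; the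
  entry \<open>w $ y\<close> cancels.\<close>

definition gen :: "'d::finite \<Rightarrow> real ^ 'd \<Rightarrow> real ^ 'd" where
  "gen y w = w - (\<Sum>j\<in>UNIV. w $ j) *\<^sub>R axis y 1"

lemma dl_nth: "dl u x $ y = u $ y - u $ x"
  by (simp add: dl_def fdiff_def)

lemma dl_diff: "dl (u - v) x = dl u x - dl v x"
  by (simp add: vec_eq_iff dl_nth)

lemma dl_scaleR: "dl (s *\<^sub>R u) x = s *\<^sub>R dl u x"
  by (simp add: vec_eq_iff dl_nth algebra_simps)

lemma norm_dl_le: "norm (dl u x) \<le> 2 * real CARD('d) * norm u"
  for u :: "real ^ 'd::finite"
proof -
  have "norm (dl u x) \<le> real CARD('d) * (2 * norm u)"
  proof (rule norm_le_card_mult)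
    fix j
    show "\<bar>dl u x $ j\<bar> \<le> 2 * norm u"
      using component_le_norm_cart[of u j] component_le_norm_cart[of u x] by (simp add: dl_nth)
  qed
  then show ?thesis by simp
qed

lemma gen_diff: "gen y (v - w) = gen y v - gen y w"
  by (simp add: gen_def sum_subtractf algebra_simps)

lemma sum_gen: "(\<Sum>j\<in>UNIV. gen y w $ j) = 0"
  by (simp add: gen_def sum_subtractf sum_distrib_left[symmetric] axis_def)

lemma norm_gen_le: "norm (gen y w) \<le> (1 + real CARD('d)) * norm w"
  for w :: "real ^ 'd::finite"
proof -
  have "\<bar>\<Sum>j\<in>UNIV. w $ j\<bar> \<le> (\<Sum>j\<in>(UNIV::'d set). norm w)"
    by (rule order_trans[OF sum_abs]) (intro sum_mono component_le_norm_cart)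
  then have "norm ((\<Sum>j\<in>UNIV. w $ j) *\<^sub>R axis y (1::real)) \<le> real CARD('d) * norm w" by simp
  then show ?thesis unfolding gen_def
    using norm_triangle_ineq4[of w "(\<Sum>j\<in>UNIV. w $ j) *\<^sub>R axis y 1"] by (simp add: algebra_simps)
qed

text \<open>The jump generator is adjoint to the finite difference. This duality makes the
  first-order terms cancel when the forward and the backward equation are paired.\<close>

lemma inner_gen: "\<phi> \<bullet> gen y w = w \<bullet> dl \<phi> y"
proof -
  have "w \<bullet> dl \<phi> y = (\<Sum>j\<in>UNIV. w $ j * \<phi> $ j) - (\<Sum>j\<in>UNIV. w $ j * \<phi> $ y)"
    by (simp add: inner_vec_def dl_nth right_diff_distrib sum_subtractf)
  moreover have "\<phi> \<bullet> gen y w = \<phi> \<bullet> w - (\<Sum>j\<in>UNIV. w $ j) * \<phi> $ y"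
    by (simp add: gen_def inner_diff_right inner_axis)
  ultimately show ?thesis
    by (simp add: inner_vec_def[of \<phi> w] mult.commute flip: sum_distrib_left)
qed

text \<open>Nonnegativity of a variance. It lets the dissipation, a mean of squares, control the
  square of a mean of norms.\<close>

lemma weighted_mean_sq_le:
  fixes m :: "real ^ 'd::finite"
  assumes "m \<in> simplex_P"
  shows "(\<Sum>y\<in>UNIV. m $ y * f y)\<^sup>2 \<le> (\<Sum>y\<in>UNIV. m $ y * (f y)\<^sup>2)"
proof -
  let ?a = "\<Sum>y\<in>UNIV. m $ y * f y"
  have "0 \<le> (\<Sum>y\<in>UNIV. m $ y * (f y - ?a)\<^sup>2)"
    using simplex_P_nonneg[OF assms] by (intro sum_nonneg) simp
  also have "\<dots> = (\<Sum>y\<in>UNIV. m $ y * (f y)\<^sup>2 - 2 * ?a * (m $ y * f y) + ?a\<^sup>2 * m $ y)"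
    by (intro sum.cong refl) (simp add: power2_eq_square algebra_simps)
  also have "\<dots> = (\<Sum>y\<in>UNIV. m $ y * (f y)\<^sup>2) - 2 * ?a * ?a + ?a\<^sup>2 * (\<Sum>y\<in>UNIV. m $ y)"
    by (simp add: sum.distrib sum_subtractf sum_distrib_left)
  finally show ?thesis using simplex_P_sum[OF assms] by (simp add: power2_eq_square)
qed

lemma weighted_mean_le:
  fixes m :: "real ^ 'd::finite"
  assumes "m \<in> simplex_P" "\<And>y. f y \<le> b"
  shows "(\<Sum>y\<in>UNIV. m $ y * f y) \<le> b"
proof -
  have "(\<Sum>y\<in>UNIV. m $ y * f y) \<le> (\<Sum>y\<in>UNIV. m $ y * b)"
    using simplex_P_nonneg[OF assms(1)] assms(2) by (intro sum_mono mult_left_mono) auto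
  then show ?thesis using simplex_P_sum[OF assms(1)] by (simp add: sum_distrib_right[symmetric])
qed

lemma norm_weighted_sum_le:
  fixes m :: "real ^ 'd::finite" and g :: "'d \<Rightarrow> 'a::real_normed_vector"
  assumes "m \<in> simplex_P"
  shows "norm (\<Sum>y\<in>UNIV. m $ y *\<^sub>R g y) \<le> (\<Sum>y\<in>UNIV. m $ y * norm (g y))"
  by (rule order_trans[OF norm_sum]) (use simplex_P_nonneg[OF assms] in simp)

lemma norm_component_sum_le:
  fixes r :: "real ^ 'd::finite" and g :: "'d \<Rightarrow> 'a::real_normed_vector"
  assumes "\<And>y. norm (g y) \<le> b"
  shows "norm (\<Sum>y\<in>UNIV. r $ y *\<^sub>R g y) \<le> real CARD('d) * (b * norm r)"
proof -
  have "norm (\<Sum>y\<in>UNIV. r $ y *\<^sub>R g y) \<le> (\<Sum>y\<in>UNIV. \<bar>r $ y\<bar> * norm (g y))"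
    by (rule order_trans[OF norm_sum]) simp
  also have "\<dots> \<le> (\<Sum>y\<in>(UNIV::'d set). norm r * b)"
    by (intro sum_mono mult_mono component_le_norm_cart assms) auto
  finally show ?thesis by (simp add: mult.commute)
qed

lemma has_vector_derivative_vec_nth:
  "(u has_vector_derivative u') F \<Longrightarrow> ((\<lambda>t. u t $ x) has_vector_derivative u' $ x) F"
  using bounded_linear.has_vector_derivative[OF bounded_linear_vec_nth] .

text \<open>\<open>\<beta>\<close> is a globally Lipschitz function that agrees with the optimal control on the ball of
  radius \<open>K\<close>, and \<open>B2 x p\<close> is the second derivative of \<open>H x\<close> at \<open>p\<close>.\<close>

locale mfg_system =
  fixes T C c K :: real and H :: "'d::finite \<Rightarrow> real ^ 'd \<Rightarrow> real"
    and \<beta> :: "'d \<Rightarrow> real ^ 'd \<Rightarrow> real ^ 'd" and B2 :: "'d \<Rightarrow> real ^ 'd \<Rightarrow> real ^ 'd \<Rightarrow> real ^ 'd"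
    and F G :: "'d \<Rightarrow> real ^ 'd \<Rightarrow> real" and AF AG :: "'d \<Rightarrow> real ^ 'd \<Rightarrow> real ^ 'd"
  assumes T: "0 < T" and C: "1 \<le> C" and c: "0 < c"
    and H_lip: "\<bar>H x p - H x q\<bar> \<le> C * norm (p - q)"
    and \<beta>_nonneg: "0 \<le> \<beta> x p $ j"
    and \<beta>_bound: "norm (\<beta> x p) \<le> C"
    and \<beta>_lip: "norm (\<beta> x p - \<beta> x q) \<le> C * norm (p - q)"
    and H_expand: "norm p \<le> K \<Longrightarrow> norm q \<le> K \<Longrightarrow>
      \<bar>H x q - H x p + \<beta> x p \<bullet> (q - p)\<bar> \<le> C * (norm (q - p))\<^sup>2"
    and \<beta>_expand: "norm p \<le> K \<Longrightarrow> norm q \<le> K \<Longrightarrow>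
      norm (\<beta> x q - \<beta> x p + B2 x p (q - p)) \<le> C * (norm (q - p))\<^sup>2"
    and B2_linear: "linear (B2 x p)"
    and B2_bound: "norm p \<le> K \<Longrightarrow> norm (B2 x p h) \<le> C * norm h"
    and B2_lip: "norm p \<le> K \<Longrightarrow> norm q \<le> K \<Longrightarrow> norm (B2 x p h - B2 x q h) \<le> C * norm (p - q) * norm h"
    and B2_pos: "norm p \<le> K \<Longrightarrow> c * (norm h)\<^sup>2 \<le> h \<bullet> B2 x p h"
    and H_conv: "norm p \<le> K \<Longrightarrow> norm q \<le> K \<Longrightarrow>
      c * (norm (q - p))\<^sup>2 \<le> H x q - H x p + \<beta> x p \<bullet> (q - p)"
    and F_grad: "simplex_gradient C (F x) (AF x)"
    and G_grad: "simplex_gradient C (G x) (AG x)"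
    and AF_bound: "m \<in> simplex_P \<Longrightarrow> norm (AF x m) \<le> C"
    and AG_bound: "m \<in> simplex_P \<Longrightarrow> norm (AG x m) \<le> C"
    and MonF: "Mon F" and MonG: "Mon G"
    and K_bound: "bounds_value_differences T H F G K"
begin

lemma N1: "1 \<le> real CARD('d)" by (rule one_le_card)
lemma N0: "0 \<le> real CARD('d)" using N1 by linarith
lemma C0: "0 \<le> C" using C by simp

section \<open>Lipschitz bounds for the coefficients of the system\<close>

lemma cost_lip:
  assumes g: "simplex_gradient C g A" and A: "\<And>m. m \<in> simplex_P \<Longrightarrow> norm (A m) \<le> C"
    and m: "m \<in> simplex_P" "m' \<in> simplex_P"
  shows "\<bar>g m - g m'\<bar> \<le> 3 * C * norm (m - m')"
proof -
  have d: "norm (m - m') \<le> 2"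
    using norm_triangle_ineq4[of m m'] norm_simplex_P_le[OF m(1)] norm_simplex_P_le[OF m(2)] by simp
  have 1: "\<bar>g m - g m' - A m' \<bullet> (m - m')\<bar> \<le> C * (norm (m - m'))\<^sup>2"
    using g m by (auto simp: simplex_gradient_def)
  have "(norm (m - m'))\<^sup>2 \<le> 2 * norm (m - m')"
    using d by (simp add: power2_eq_square mult_right_mono)
  then have 2: "C * (norm (m - m'))\<^sup>2 \<le> C * (2 * norm (m - m'))" using C0 by (rule mult_left_mono)
  have "\<bar>A m' \<bullet> (m - m')\<bar> \<le> norm (A m') * norm (m - m')" by (rule Cauchy_Schwarz_ineq2)
  also have "\<dots> \<le> C * norm (m - m')" using A[OF m(2)] by (rule mult_right_mono) simp
  finally show ?thesis using 1 2 by linarith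
qed

lemma F_lip: "m \<in> simplex_P \<Longrightarrow> m' \<in> simplex_P \<Longrightarrow> \<bar>F x m - F x m'\<bar> \<le> 3 * C * norm (m - m')"
  by (rule cost_lip[OF F_grad AF_bound])

lemma G_lip: "m \<in> simplex_P \<Longrightarrow> m' \<in> simplex_P \<Longrightarrow> \<bar>G x m - G x m'\<bar> \<le> 3 * C * norm (m - m')"
  by (rule cost_lip[OF G_grad AG_bound])

lemma F_gradD:
  "m \<in> simplex_P \<Longrightarrow> m' \<in> simplex_P \<Longrightarrow> norm (AF x m - AF x m') \<le> C * norm (m - m')"
  "m \<in> simplex_P \<Longrightarrow> m' \<in> simplex_P \<Longrightarrow> \<bar>F x m' - F x m - AF x m \<bullet> (m' - m)\<bar> \<le> C * (norm (m' - m))\<^sup>2"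
  using F_grad[of x] by (auto simp: simplex_gradient_def)

lemma G_gradD:
  "m \<in> simplex_P \<Longrightarrow> m' \<in> simplex_P \<Longrightarrow> norm (AG x m - AG x m') \<le> C * norm (m - m')"
  "m \<in> simplex_P \<Longrightarrow> m' \<in> simplex_P \<Longrightarrow> \<bar>G x m' - G x m - AG x m \<bullet> (m' - m)\<bar> \<le> C * (norm (m' - m))\<^sup>2"
  using G_grad[of x] by (auto simp: simplex_gradient_def)

text \<open>The right hand side of the Kolmogorov forward equation when every player uses the
  feedback \<open>\<beta>\<close> of the finite differences of \<open>u\<close>.\<close>

definition drift :: "real ^ 'd \<Rightarrow> real ^ 'd \<Rightarrow> real ^ 'd" where
  "drift m u = (\<Sum>y\<in>UNIV. m $ y *\<^sub>R gen y (\<beta> y (dl u y)))"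

definition ham :: "real ^ 'd \<Rightarrow> real ^ 'd \<Rightarrow> real ^ 'd" where
  "ham m u = (\<chi> x. H x (dl u x) - F x m)"

definition fin :: "real ^ 'd \<Rightarrow> real ^ 'd" where
  "fin m = (\<chi> x. G x m)"

text \<open>The size of a value difference that the dissipation controls: the gain from convexity at
  \<open>y\<close> carries the weight \<open>m $ y\<close>, so nothing is gained at empty
  states.\<close>

definition spread :: "real ^ 'd \<Rightarrow> real ^ 'd \<Rightarrow> real" where
  "spread m v = (\<Sum>y\<in>UNIV. m $ y * norm (dl v y))"

text \<open>The initial distribution is not prescribed. For \<open>t0 = T\<close> the derivative
  conditions are void, so that membership in the simplex and the terminal condition remain.\<close>

definition mfg :: "real \<Rightarrow> (real \<Rightarrow> real ^ 'd) \<Rightarrow> (real \<Rightarrow> real ^ 'd) \<Rightarrow> bool" where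
  "mfg t0 m u \<longleftrightarrow>
     (\<forall>t\<in>{t0..T}. m t \<in> simplex_P \<and>
        (m has_vector_derivative drift (m t) (u t)) (at t within {t0..T}) \<and>
        (u has_vector_derivative ham (m t) (u t)) (at t within {t0..T})) \<and>
     u T = fin (m T)"

lemma spread_le: "m \<in> simplex_P \<Longrightarrow> spread m v \<le> 2 * real CARD('d) * norm v"
  unfolding spread_def by (rule weighted_mean_le) (auto intro: norm_dl_le)

lemma spread_nonneg: "m \<in> simplex_P \<Longrightarrow> 0 \<le> spread m v"
  unfolding spread_def by (intro sum_nonneg mult_nonneg_nonneg simplex_P_nonneg) auto

lemma spread_sq: "m \<in> simplex_P \<Longrightarrow> (spread m v)\<^sup>2 \<le> (\<Sum>y\<in>UNIV. m $ y * (norm (dl v y))\<^sup>2)"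
  unfolding spread_def by (rule weighted_mean_sq_le)

lemma inner_drift: "\<phi> \<bullet> drift m u = (\<Sum>y\<in>UNIV. m $ y * (\<beta> y (dl u y) \<bullet> dl \<phi> y))"
  by (simp add: drift_def inner_sum_right inner_gen)

lemma sum_drift: "(\<Sum>j\<in>UNIV. drift m u $ j) = 0"
proof -
  have "(\<Sum>j\<in>UNIV. drift m u $ j) = (\<Sum>y\<in>UNIV. m $ y * (\<Sum>j\<in>UNIV. gen y (\<beta> y (dl u y)) $ j))"
    unfolding drift_def by (simp add: sum_distrib_left) (rule sum.swap)
  then show ?thesis by (simp add: sum_gen)
qed

lemma norm_gen_\<beta>_le: "norm (gen y (\<beta> y p)) \<le> (1 + real CARD('d)) * C"
  using norm_gen_le[of y "\<beta> y p"] mult_left_mono[OF \<beta>_bound, of "1 + real CARD('d)" y p] N0 by linarith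

lemma drift_bound: "m \<in> simplex_P \<Longrightarrow> norm (drift m u) \<le> (1 + real CARD('d)) * C"
  unfolding drift_def
  by (rule order_trans[OF norm_weighted_sum_le]) (auto intro!: weighted_mean_le norm_gen_\<beta>_le)

text \<open>The change of the control at \<open>y\<close> acts on the mass at \<open>y\<close> only.
  This gives \<open>spread\<close> in place of the full norm of \<open>u - u'\<close>, and hence
  exactly the forcing that the dissipation can pay for.\<close>

lemma drift_lip_spread:
  assumes "m \<in> simplex_P"
  shows "norm (drift m u - drift m' u') \<le> real CARD('d) * ((1 + real CARD('d)) * C * norm (m - m')) + (1 + real CARD('d)) * C * spread m (u - u')"
proof -
  have eq: "drift m u - drift m' u' = (\<Sum>y\<in>UNIV. (m - m') $ y *\<^sub>R gen y (\<beta> y (dl u' y)))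
      + (\<Sum>y\<in>UNIV. m $ y *\<^sub>R (gen y (\<beta> y (dl u y) - \<beta> y (dl u' y))))"
    by (simp add: drift_def gen_diff sum.distrib[symmetric] sum_subtractf[symmetric] algebra_simps)
  have 1: "norm (\<Sum>y\<in>UNIV. (m - m') $ y *\<^sub>R gen y (\<beta> y (dl u' y))) \<le> real CARD('d) * ((1 + real CARD('d)) * C * norm (m - m'))"
    by (rule norm_component_sum_le) (rule norm_gen_\<beta>_le)
  have "norm (\<Sum>y\<in>UNIV. m $ y *\<^sub>R (gen y (\<beta> y (dl u y) - \<beta> y (dl u' y))))
      \<le> (\<Sum>y\<in>UNIV. m $ y * norm (gen y (\<beta> y (dl u y) - \<beta> y (dl u' y))))"
    by (rule norm_weighted_sum_le[OF assms])
  also have "\<dots> \<le> (\<Sum>y\<in>UNIV. m $ y * ((1 + real CARD('d)) * (C * norm (dl (u - u') y))))"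
  proof (intro sum_mono mult_left_mono simplex_P_nonneg[OF assms])
    fix y
    have "norm (gen y (\<beta> y (dl u y) - \<beta> y (dl u' y))) \<le> (1 + real CARD('d)) * norm (\<beta> y (dl u y) - \<beta> y (dl u' y))"
      by (rule norm_gen_le)
    also have "\<dots> \<le> (1 + real CARD('d)) * (C * norm (dl (u - u') y))"
      unfolding dl_diff using N0 by (intro mult_left_mono \<beta>_lip) auto
    finally show "norm (gen y (\<beta> y (dl u y) - \<beta> y (dl u' y))) \<le> (1 + real CARD('d)) * (C * norm (dl (u - u') y))" .
  qed
  also have "\<dots> = (1 + real CARD('d)) * C * spread m (u - u')"
    by (simp add: spread_def sum_distrib_left mult_ac)
  finally show ?thesis unfolding eq using 1 norm_triangle_ineq order_trans add_mono by meson
qed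

definition LB :: real where "LB = 2 * real CARD('d) * (1 + real CARD('d)) * C + 3 * real CARD('d) * C + 2 * real CARD('d) * real CARD('d) * C"

lemma LB_ge: "real CARD('d) * ((1 + real CARD('d)) * C) \<le> LB" "(1 + real CARD('d)) * C * (2 * real CARD('d)) \<le> LB" "real CARD('d) * (3 * C) \<le> LB" "real CARD('d) * (2 * real CARD('d) * C) \<le> LB" "0 \<le> LB"
  using N0 C0 by (auto simp: LB_def algebra_simps)

lemma drift_lip:
  assumes "m \<in> simplex_P"
  shows "norm (drift m u - drift m' u') \<le> LB * (norm (m - m') + norm (u - u'))"
proof -
  have "(1 + real CARD('d)) * C * spread m (u - u') \<le> (1 + real CARD('d)) * C * (2 * real CARD('d) * norm (u - u'))"
    using N0 C0 spread_le[OF assms] by (intro mult_left_mono) auto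
  also have "\<dots> = (1 + real CARD('d)) * C * (2 * real CARD('d)) * norm (u - u')" by simp
  also have "\<dots> \<le> LB * norm (u - u')" by (intro mult_right_mono LB_ge) auto
  finally have 1: "(1 + real CARD('d)) * C * spread m (u - u') \<le> LB * norm (u - u')" .
  have "real CARD('d) * ((1 + real CARD('d)) * C * norm (m - m')) = real CARD('d) * ((1 + real CARD('d)) * C) * norm (m - m')" by simp
  also have "\<dots> \<le> LB * norm (m - m')" by (intro mult_right_mono LB_ge) auto
  finally show ?thesis using 1 drift_lip_spread[OF assms, of u m' u'] by (simp add: distrib_left)
qed

lemma ham_lip:
  assumes "m \<in> simplex_P" "m' \<in> simplex_P"
  shows "norm (ham m u - ham m' u') \<le> LB * (norm (m - m') + norm (u - u'))"
proof -
  have "norm (ham m u - ham m' u') \<le> real CARD('d) * (2 * real CARD('d) * C * norm (u - u') + 3 * C * norm (m - m'))"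
  proof (rule norm_le_card_mult)
    fix x
    have "\<bar>H x (dl u x) - H x (dl u' x)\<bar> \<le> C * norm (dl (u - u') x)"
      unfolding dl_diff by (rule H_lip)
    also have "\<dots> \<le> C * (2 * real CARD('d) * norm (u - u'))" using C0 by (intro mult_left_mono norm_dl_le) auto
    finally show "\<bar>(ham m u - ham m' u') $ x\<bar> \<le> 2 * real CARD('d) * C * norm (u - u') + 3 * C * norm (m - m')"
      using F_lip[OF assms, of x] by (simp add: ham_def algebra_simps)
  qed
  also have "\<dots> = real CARD('d) * (2 * real CARD('d) * C) * norm (u - u') + real CARD('d) * (3 * C) * norm (m - m')" by (simp add: algebra_simps)
  also have "\<dots> \<le> LB * norm (u - u') + LB * norm (m - m')"
    by (intro add_mono mult_right_mono LB_ge) auto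
  finally show ?thesis by (simp add: algebra_simps)
qed

lemma fin_lip:
  assumes "m \<in> simplex_P" "m' \<in> simplex_P"
  shows "norm (fin m - fin m') \<le> LB * norm (m - m')"
proof -
  have "norm (fin m - fin m') \<le> real CARD('d) * (3 * C * norm (m - m'))"
    by (rule norm_le_card_mult) (use G_lip[OF assms] in \<open>simp add: fin_def\<close>)
  also have "\<dots> = real CARD('d) * (3 * C) * norm (m - m')" by simp
  also have "\<dots> \<le> LB * norm (m - m')" by (intro mult_right_mono LB_ge) auto
  finally show ?thesis .
qed

lemma continuous_on_drift:
  fixes S :: "real set"
  assumes "continuous_on S m" "continuous_on S u" "m ` S \<subseteq> simplex_P"
  shows "continuous_on S (\<lambda>t. drift (m t) (u t))"
  unfolding continuous_on_def
proof (intro ballI)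
  fix t assume t: "t \<in> S"
  have lim: "((\<lambda>s. LB * (norm (m s - m t) + norm (u s - u t))) \<longlongrightarrow> LB * (norm (m t - m t) + norm (u t - u t))) (at t within S)"
    using assms t by (intro tendsto_intros) (auto simp: continuous_on_def)
  have bd: "norm (drift (m s) (u s) - drift (m t) (u t)) \<le> LB * (norm (m s - m t) + norm (u s - u t))"
    if "s \<in> S" for s using that t assms(3) by (intro drift_lip) auto
  have "\<forall>\<^sub>F s in at t within S. norm (drift (m s) (u s) - drift (m t) (u t)) \<le> LB * (norm (m s - m t) + norm (u s - u t))"
    unfolding eventually_at using bd by (intro exI[of _ "1::real"]) simp
  then have "((\<lambda>s. drift (m s) (u s) - drift (m t) (u t)) \<longlongrightarrow> 0) (at t within S)"
    by (rule Lim_null_comparison) (use lim in simp)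
  then show "((\<lambda>s. drift (m s) (u s)) \<longlongrightarrow> drift (m t) (u t)) (at t within S)" by (simp add: LIM_zero_iff)
qed

lemma continuous_on_ham:
  fixes S :: "real set"
  assumes "continuous_on S m" "continuous_on S u" "m ` S \<subseteq> simplex_P"
  shows "continuous_on S (\<lambda>t. ham (m t) (u t))"
  unfolding continuous_on_def
proof (intro ballI)
  fix t assume t: "t \<in> S"
  have lim: "((\<lambda>s. LB * (norm (m s - m t) + norm (u s - u t))) \<longlongrightarrow> LB * (norm (m t - m t) + norm (u t - u t))) (at t within S)"
    using assms t by (intro tendsto_intros) (auto simp: continuous_on_def)
  have bd: "norm (ham (m s) (u s) - ham (m t) (u t)) \<le> LB * (norm (m s - m t) + norm (u s - u t))"
    if "s \<in> S" for s using that t assms(3) by (intro ham_lip) auto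
  have "\<forall>\<^sub>F s in at t within S. norm (ham (m s) (u s) - ham (m t) (u t)) \<le> LB * (norm (m s - m t) + norm (u s - u t))"
    unfolding eventually_at using bd by (intro exI[of _ "1::real"]) simp
  then have "((\<lambda>s. ham (m s) (u s) - ham (m t) (u t)) \<longlongrightarrow> 0) (at t within S)"
    by (rule Lim_null_comparison) (use lim in simp)
  then show "((\<lambda>s. ham (m s) (u s)) \<longlongrightarrow> ham (m t) (u t)) (at t within S)" by (simp add: LIM_zero_iff)
qed

lemma backward_integral:
  fixes f :: "real \<Rightarrow> 'a::banach"
  assumes "continuous_on {a..b} f" "t \<in> {a..b}"
  shows "((\<lambda>t. integral {t..b} f) has_vector_derivative - f t) (at t within {a..b})"
proof -
  have "((\<lambda>t. integral {a..b} f - integral {a..t} f) has_vector_derivative 0 - f t) (at t within {a..b})"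
    by (intro derivative_intros integral_has_vector_derivative assms) 
  moreover have "integral {a..b} f - integral {a..s} f = integral {s..b} f" if "s \<in> {a..b}" for s
    using Henstock_Kurzweil_Integration.integral_combine[of a s b f] that assms(1)
    by (auto simp: integrable_continuous_real algebra_simps)
  ultimately show ?thesis
    using assms(2) by (auto intro: has_vector_derivative_transform[rotated 2])
qed

section \<open>The backward equation along a given flow\<close>

text \<open>Supplies value functions on all of \<open>{0..T}\<close>, to which the bound
  \<open>K\<close> applies. The right hand side is globally Lipschitz, and an exponential weight
  makes the integral operator a contraction on the whole interval at once.\<close>

lemma hjb_exists:
  assumes m: "continuous_on {0..T} m" "m ` {0..T} \<subseteq> simplex_P"
  shows "\<exists>u. (\<forall>t\<in>{0..T}. (u has_vector_derivative ham (m t) (u t)) (at t within {0..T})) \<and> u T = fin (m T)"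
proof -
  \<comment> \<open>The weight turns the Lipschitz constant \<open>LB\<close> into a contraction
    constant \<open>LB / k\<close>; this choice of \<open>k\<close> keeps it at most 1/2. The fixed
    point \<open>z\<close> is the solution divided by the weight.\<close>
  define k where "k = 2 * LB + 1"
  have k: "k > 0" "LB / k \<le> 1/2" using LB_ge(5) by (auto simp: k_def field_simps)
  define w where "w t = exp (k * (T - t))" for t
  have w0: "w t > 0" for t by (simp add: w_def)
  define J where "J z t = fin (m T) - integral {t..T} (\<lambda>s. ham (m s) (w s *\<^sub>R z s))" for z t
  define \<Phi> where "\<Phi> z t = (1 / w t) *\<^sub>R J z t" for z t
  have cont: "continuous_on {0..T} (\<lambda>s. ham (m s) (w s *\<^sub>R z s))" if "continuous_on {0..T} z" for z
    by (rule continuous_on_ham) (use m that in \<open>auto simp: w_def intro!: continuous_intros\<close>)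
  have dJ: "(J z has_vector_derivative ham (m t) (w t *\<^sub>R z t)) (at t within {0..T})"
    if "continuous_on {0..T} z" "t \<in> {0..T}" for z t
  proof -
    have "((\<lambda>t. fin (m T) - integral {t..T} (\<lambda>s. ham (m s) (w s *\<^sub>R z s))) has_vector_derivative
        0 - - ham (m t) (w t *\<^sub>R z t)) (at t within {0..T})"
      by (intro derivative_intros backward_integral cont that)
    then show ?thesis by (simp add: J_def[abs_def])
  qed
  have "\<exists>z. continuous_on {0..T} z \<and> z ` {0..T} \<subseteq> UNIV \<and> (\<forall>t\<in>{0..T}. \<Phi> z t = z t)"
  proof (rule path_fixpoint)
    show "continuous_on {0..T} (\<Phi> z) \<and> \<Phi> z ` {0..T} \<subseteq> UNIV" if "continuous_on {0..T} z" for z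
    proof -
      have "continuous_on {0..T} (J z)"
        by (rule continuous_on_vector_derivative) (use dJ[OF that] in auto)
      then show ?thesis using w0 unfolding \<Phi>_def w_def by (auto intro!: continuous_intros)
    qed
    fix z z' :: "real \<Rightarrow> real^'d" and \<delta> t
    assume z: "continuous_on {0..T} z" "continuous_on {0..T} z'"
      and le: "\<And>t. t \<in> {0..T} \<Longrightarrow> norm (z t - z' t) \<le> \<delta>" and t: "t \<in> {0..T}"
    have \<delta>0: "0 \<le> \<delta>" using le[OF t] norm_ge_zero order_trans by blast
    have "norm ((J z T - J z' T) - (J z t - J z' t)) \<le> (- (LB * \<delta> / k) * w T) - (- (LB * \<delta> / k) * w t)"
    proof (rule norm_increment_le)
      fix s assume s: "s \<in> {t..T}"
      then have s': "s \<in> {0..T}" using t by auto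
      show "((\<lambda>s. J z s - J z' s) has_vector_derivative ham (m s) (w s *\<^sub>R z s) - ham (m s) (w s *\<^sub>R z' s)) (at s within {t..T})"
        by (rule has_vector_derivative_within_subset[of _ _ _ "{0..T}"])
           (use t in \<open>auto intro!: derivative_intros dJ z s'\<close>)
      show "((\<lambda>s. - (LB * \<delta> / k) * w s) has_real_derivative LB * \<delta> * w s) (at s within {t..T})"
        unfolding w_def using k by (auto intro!: derivative_eq_intros)
      have "norm (ham (m s) (w s *\<^sub>R z s) - ham (m s) (w s *\<^sub>R z' s)) \<le> LB * (norm (m s - m s) + norm (w s *\<^sub>R z s - w s *\<^sub>R z' s))"
        by (rule ham_lip) (use m s' in auto)
      also have "\<dots> = LB * (w s * norm (z s - z' s))"
        using w0[of s] by (simp flip: scaleR_diff_right)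
      also have "\<dots> \<le> LB * (w s * \<delta>)"
        using le[OF s'] w0[of s] LB_ge(5) by (intro mult_left_mono) auto
      finally show "norm (ham (m s) (w s *\<^sub>R z s) - ham (m s) (w s *\<^sub>R z' s)) \<le> LB * \<delta> * w s" by (simp add: mult_ac)
    qed (use t in auto)
    also have "\<dots> \<le> LB * \<delta> / k * w t" using w0[of T] k LB_ge(5) \<delta>0 by simp
    also have "\<dots> = (LB / k) * \<delta> * w t" by simp
    also have "\<dots> \<le> (1/2) * \<delta> * w t" using k w0[of t] \<delta>0 by (intro mult_right_mono) auto
    finally have "norm (J z t - J z' t) \<le> \<delta> / 2 * w t" by (simp add: J_def norm_minus_commute)
    then show "norm (\<Phi> z t - \<Phi> z' t) \<le> \<delta> / 2"
    proof -
      have "\<Phi> z t - \<Phi> z' t = (1 / w t) *\<^sub>R (J z t - J z' t)" by (simp add: \<Phi>_def scaleR_diff_right)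
      then show ?thesis using \<open>norm (J z t - J z' t) \<le> _\<close> w0[of t] by (simp add: pos_divide_le_eq)
    qed
  qed auto
  then obtain z where z: "continuous_on {0..T} z" "\<And>t. t \<in> {0..T} \<Longrightarrow> \<Phi> z t = z t" by blast
  have Jz: "J z t = w t *\<^sub>R z t" if "t \<in> {0..T}" for t
    using z(2)[OF that, symmetric] w0[of t] by (simp add: \<Phi>_def)
  show ?thesis
  proof (intro exI[of _ "J z"] conjI ballI)
    fix t assume t: "t \<in> {0..T}"
    show "(J z has_vector_derivative ham (m t) (J z t)) (at t within {0..T})"
      using dJ[OF z(1) t] Jz[OF t] by simp
  next
    show "J z T = fin (m T)" by (simp add: J_def)
  qed
qed

lemma hjb_unique:
  assumes "t0 \<le> T" and m: "m ` {t0..T} \<subseteq> simplex_P"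
    and u: "\<And>t. t \<in> {t0..T} \<Longrightarrow> (u has_vector_derivative ham (m t) (u t)) (at t within {t0..T})"
    and v: "\<And>t. t \<in> {t0..T} \<Longrightarrow> (v has_vector_derivative ham (m t) (v t)) (at t within {t0..T})"
    and "u T = v T" and t: "t \<in> {t0..T}"
  shows "u t = v t"
proof -
  have "norm (u t - v t) \<le> (norm (u T - v T) + 0 * (T - t0)) * exp (LB * (T - t0))"
  proof (rule gronwall_norm_backward[OF _ _ _ _ t])
    fix s assume s: "s \<in> {t0..T}"
    show "((\<lambda>s. u s - v s) has_vector_derivative ham (m s) (u s) - ham (m s) (v s)) (at s within {t0..T})"
      by (intro derivative_intros u v s)
    show "norm (ham (m s) (u s) - ham (m s) (v s)) \<le> LB * norm (u s - v s) + 0"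
      using ham_lip[of "m s" "m s" "u s" "v s"] m s by (force simp: image_subset_iff)
  qed (use LB_ge in auto)
  then show ?thesis using assms(5) by simp
qed

lemma mfgD:
  assumes "mfg t0 m u" "t \<in> {t0..T}"
  shows "m t \<in> simplex_P" "(m has_vector_derivative drift (m t) (u t)) (at t within {t0..T})"
    "(u has_vector_derivative ham (m t) (u t)) (at t within {t0..T})"
  using assms by (auto simp: mfg_def)

lemma mfg_fin: "mfg t0 m u \<Longrightarrow> u T = fin (m T)"
  by (simp add: mfg_def)

lemma mfg_continuous:
  assumes "mfg t0 m u"
  shows "continuous_on {t0..T} m" "continuous_on {t0..T} u"
  by (rule continuous_on_vector_derivative; use mfgD[OF assms] in blast)+

text \<open>The bound \<open>K\<close> is assumed for value functions on the whole horizon. A flow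
  that starts at \<open>t0\<close> is therefore kept constant before \<open>t0\<close>, and backward
  uniqueness identifies the value function of the extended flow with \<open>u\<close> on
  \<open>{t0..T}\<close>.\<close>

lemma mfg_dl_bound:
  assumes mu: "mfg t0 m u" and t0: "0 \<le> t0" "t0 \<le> T" and t: "t \<in> {t0..T}"
  shows "norm (dl (u t) x) \<le> K"
proof -
  define n where "n t = m (max t t0)" for t
  have n: "continuous_on {0..T} n" "n ` {0..T} \<subseteq> simplex_P"
    unfolding n_def using mfgD(1)[OF mu] t0
    by (auto intro!: continuous_on_compose2[OF mfg_continuous(1)[OF mu]] continuous_intros)
  obtain v where v: "\<And>t. t \<in> {0..T} \<Longrightarrow> (v has_vector_derivative ham (n t) (v t)) (at t within {0..T})"
    "v T = fin (n T)" using hjb_exists[OF n] by blast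
  have nm: "n t = m t" if "t \<in> {t0..T}" for t using that by (simp add: n_def max_absorb1)
  have eq: "u t = v t"
  proof (rule hjb_unique[where m = n and ?t0.0 = t0])
    fix s assume s: "s \<in> {t0..T}"
    show "(u has_vector_derivative ham (n s) (u s)) (at s within {t0..T})"
      using mfgD(3)[OF mu s] nm[OF s] by simp
    show "(v has_vector_derivative ham (n s) (v s)) (at s within {t0..T})"
      by (rule has_vector_derivative_within_subset[OF v(1)]) (use s t0 in auto)
  qed (use t0 t n mfg_fin[OF mu] v(2) nm[of T] in auto)
  have "value_function T H F G n (\<lambda>t x. v t $ x)"
    unfolding value_function_def
  proof (intro conjI allI ballI)
    fix x s assume s: "s \<in> {0..T}"
    show "((\<lambda>s. v s $ x) has_real_derivative H x (fdiff (($) (v s)) x) - F x (n s)) (at s within {0..T})"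
      using has_vector_derivative_vec_nth[OF v(1)[OF s], of x]
      by (simp add: has_real_derivative_iff_has_vector_derivative ham_def dl_def)
  qed (simp add: v(2) fin_def)
  then have "\<forall>t\<in>{0..T}. \<forall>x. norm (fdiff (\<lambda>x. v t $ x) x) \<le> K"
    using K_bound n unfolding bounds_value_differences_def by blast
  then show ?thesis using eq t t0 by (auto simp: dl_def)
qed

end

section \<open>Stability, uniqueness and existence for the forward-backward system\<close>

lemma has_vector_derivative_singleton:
  "(f has_vector_derivative d) (at a within {a})"
  by (auto simp: has_vector_derivative_def has_derivative_def at_within_def bounded_linear_scaleR_left)

lemma has_vector_derivative_join:
  fixes f g :: "real \<Rightarrow> 'a::real_normed_vector"
  assumes "a \<le> b" "b \<le> c"
    and f: "\<And>t. t \<in> {a..b} \<Longrightarrow> (f has_vector_derivative f' t) (at t within {a..b})"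
    and g: "\<And>t. t \<in> {b..c} \<Longrightarrow> (g has_vector_derivative g' t) (at t within {b..c})"
    and eq: "f b = g b" "f' b = g' b" and t: "t \<in> {a..c}"
  shows "((\<lambda>t. if t \<le> b then f t else g t) has_vector_derivative (if t \<le> b then f' t else g' t)) (at t within {a..c})"
proof -
  have ab: "insert b {a..b} = {a..b}" "insert b {b..c} = {b..c}" "{a..b} \<inter> {b..c} = {b}" using assms(1,2) by auto
  have "((\<lambda>t. if t \<in> {a..b} then f t else g t) has_vector_derivative
      (if t \<in> {a..b} then f' t else g' t)) (at t within {a..c})"
    by (rule has_vector_derivative_If_within_closures[where T = "{b..c}"])
       (use assms in \<open>auto simp: ab\<close>)
  moreover have "(if t \<in> {a..b} then f' t else g' t) = (if t \<le> b then f' t else g' t)" using t by auto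
  ultimately have "((\<lambda>t. if t \<in> {a..b} then f t else g t) has_vector_derivative
      (if t \<le> b then f' t else g' t)) (at t within {a..c})" by simp
  then show ?thesis
    by (rule has_vector_derivative_transform[OF t, rotated]) auto
qed

context mfg_system
begin

text \<open>The monotonicity argument of Lasry and Lions, quantified by the stability estimate with
  \<open>\<epsilon> = 0\<close> and the forcing \<open>spread\<close>. All momenta involved lie in
  the ball of radius \<open>K\<close>, where uniform convexity is available.\<close>

lemma mfg_lipschitz:
  "\<exists>\<Lambda>\<ge>0. \<forall>t0 m u m' u'. 0 \<le> t0 \<longrightarrow> t0 \<le> T \<longrightarrow> mfg t0 m u \<longrightarrow> mfg t0 m' u' \<longrightarrow>
     (\<forall>t\<in>{t0..T}. norm (m t - m' t) \<le> \<Lambda> * norm (m t0 - m' t0) \<and> norm (u t - u' t) \<le> \<Lambda> * norm (m t0 - m' t0))"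
proof -
  obtain C' where C': "C' \<ge> 0" and stab: "\<forall>a b (\<rho> :: real \<Rightarrow> real^'d) \<rho>' v v' r \<epsilon>.
    a \<le> b \<longrightarrow> b - a \<le> T \<longrightarrow> 0 \<le> \<epsilon> \<longrightarrow>
    (\<forall>t\<in>{a..b}. (\<rho> has_vector_derivative \<rho>' t) (at t within {a..b}) \<and>
       (v has_vector_derivative v' t) (at t within {a..b}) \<and>
       norm (\<rho>' t) \<le> LB * (norm (\<rho> t) + r t + \<epsilon>) \<and>
       norm (v' t) \<le> LB * (norm (v t) + norm (\<rho> t) + \<epsilon>) \<and>
       v' t \<bullet> \<rho> t + v t \<bullet> \<rho>' t \<le> - c * (r t)\<^sup>2 + LB * \<epsilon> * (norm (v t) + norm (\<rho> t))) \<longrightarrow>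
    norm (v b) \<le> LB * (norm (\<rho> b) + \<epsilon>) \<longrightarrow> - (LB * \<epsilon> * norm (\<rho> b)) \<le> v b \<bullet> \<rho> b \<longrightarrow>
    (\<forall>t\<in>{a..b}. norm (\<rho> t) \<le> C' * (norm (\<rho> a) + \<epsilon>) \<and> norm (v t) \<le> C' * (norm (\<rho> a) + \<epsilon>))"
    using forward_backward_stability[OF LB_ge(5) c less_imp_le[OF T]] by blast
  have main: "\<forall>t\<in>{t0..T}. norm (m t - m' t) \<le> C' * (norm (m t0 - m' t0) + 0) \<and>
      norm (u t - u' t) \<le> C' * (norm (m t0 - m' t0) + 0)"
    if t0: "0 \<le> t0" "t0 \<le> T" and mu: "mfg t0 m u" "mfg t0 m' u'" for t0 m u m' u'
  proof (rule stab[rule_format, where \<rho>' = "\<lambda>t. drift (m t) (u t) - drift (m' t) (u' t)"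
        and v' = "\<lambda>t. ham (m t) (u t) - ham (m' t) (u' t)" and r = "\<lambda>t. spread (m t) (u t - u' t)", THEN ballI, rotated -1])
    show "t0 \<le> T" "T - t0 \<le> T" "(0::real) \<le> 0" using t0 by auto
  next
    fix t assume t: "t \<in> {t0..T}"
    note P = mfgD(1)[OF mu(1) t] mfgD(1)[OF mu(2) t]
    let ?p = "\<lambda>y. dl (u t) y" and ?q = "\<lambda>y. dl (u' t) y"
    let ?\<rho> = "m t - m' t" and ?v = "u t - u' t"
    have K: "norm (?p y) \<le> K" "norm (?q y) \<le> K" for y
      using mfg_dl_bound[OF mu(1) t0 t] mfg_dl_bound[OF mu(2) t0 t] by auto
    have 1: "((\<lambda>t. m t - m' t) has_vector_derivative drift (m t) (u t) - drift (m' t) (u' t)) (at t within {t0..T})"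
      by (intro derivative_intros mfgD[OF mu(1) t] mfgD[OF mu(2) t])
    have 2: "((\<lambda>t. u t - u' t) has_vector_derivative ham (m t) (u t) - ham (m' t) (u' t)) (at t within {t0..T})"
      by (intro derivative_intros mfgD[OF mu(1) t] mfgD[OF mu(2) t])
    have 3: "norm (drift (m t) (u t) - drift (m' t) (u' t)) \<le> LB * (norm ?\<rho> + spread (m t) ?v + 0)"
    proof -
      have "real CARD('d) * ((1 + real CARD('d)) * C * norm ?\<rho>) \<le> LB * norm ?\<rho>"
        using mult_right_mono[OF LB_ge(1), of "norm ?\<rho>"] by (simp add: mult_ac)
      moreover have "(1 + real CARD('d)) * C * spread (m t) ?v \<le> LB * spread (m t) ?v"
      proof (rule mult_right_mono[OF _ spread_nonneg[OF P(1)]])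
        have "1 \<le> 2 * real CARD('d)" using N1 by linarith
        then have "(1 + real CARD('d)) * C * 1 \<le> (1 + real CARD('d)) * C * (2 * real CARD('d))"
          by (rule mult_left_mono) (use C0 in simp)
        then show "(1 + real CARD('d)) * C \<le> LB" using LB_ge(2) by linarith
      qed
      ultimately show ?thesis using drift_lip_spread[OF P(1), of "u t" "m' t" "u' t"] by (simp add: distrib_left)
    qed
    have 4: "norm (ham (m t) (u t) - ham (m' t) (u' t)) \<le> LB * (norm ?v + norm ?\<rho> + 0)"
      using ham_lip[OF P, of "u t" "u' t"] by (simp add: add.commute)
    have 5: "(ham (m t) (u t) - ham (m' t) (u' t)) \<bullet> ?\<rho> + ?v \<bullet> (drift (m t) (u t) - drift (m' t) (u' t))
        \<le> - c * (spread (m t) ?v)\<^sup>2 + LB * 0 * (norm ?v + norm ?\<rho>)"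
    proof -
      \<comment> \<open>Sorted by the mass that carries them, the Hamiltonian and drift terms become
        two Bregman remainders of \<open>H\<close>, because \<open>- \<beta>\<close> is its slope.
        The one weighted by \<open>m\<close> provides the dissipation; for the one weighted by
        \<open>m'\<close> the sign suffices.\<close>
      have "(ham (m t) (u t) - ham (m' t) (u' t)) \<bullet> ?\<rho> + ?v \<bullet> (drift (m t) (u t) - drift (m' t) (u' t))
          = - (\<Sum>x\<in>UNIV. m t $ x * (H x (?q x) - H x (?p x) + \<beta> x (?p x) \<bullet> (?q x - ?p x)))
            - (\<Sum>x\<in>UNIV. m' t $ x * (H x (?p x) - H x (?q x) + \<beta> x (?q x) \<bullet> (?p x - ?q x)))
            - (\<Sum>x\<in>UNIV. (F x (m t) - F x (m' t)) * (m t $ x - m' t $ x))"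
        unfolding inner_diff_right[of ?v] inner_drift inner_vec_def[of "ham (m t) (u t) - ham (m' t) (u' t)"]
          sum_subtractf[symmetric] sum.distrib[symmetric] sum_negf[symmetric]
        by (intro sum.cong refl) (simp add: ham_def dl_diff inner_diff_right algebra_simps)
      moreover have "0 \<le> (\<Sum>x\<in>UNIV. (F x (m t) - F x (m' t)) * (m t $ x - m' t $ x))"
        using MonF P by (auto simp: Mon_def)
      moreover have "0 \<le> (\<Sum>x\<in>UNIV. m' t $ x * (H x (?p x) - H x (?q x) + \<beta> x (?q x) \<bullet> (?p x - ?q x)))"
      proof (intro sum_nonneg mult_nonneg_nonneg simplex_P_nonneg[OF P(2)])
        fix x
        have "0 \<le> c * (norm (?p x - ?q x))\<^sup>2" using c by simp
        then show "0 \<le> H x (?p x) - H x (?q x) + \<beta> x (?q x) \<bullet> (?p x - ?q x)"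
          using H_conv[OF K(2) K(1), of x x x] by linarith
      qed
      moreover have "c * (spread (m t) ?v)\<^sup>2 \<le> (\<Sum>x\<in>UNIV. m t $ x * (H x (?q x) - H x (?p x) + \<beta> x (?p x) \<bullet> (?q x - ?p x)))"
      proof -
        have "c * (spread (m t) ?v)\<^sup>2 \<le> c * (\<Sum>y\<in>UNIV. m t $ y * (norm (dl ?v y))\<^sup>2)"
          using spread_sq[OF P(1)] c by (intro mult_left_mono) auto
        also have "\<dots> = (\<Sum>y\<in>UNIV. m t $ y * (c * (norm (?q y - ?p y))\<^sup>2))"
          by (simp add: sum_distrib_left dl_diff norm_minus_commute mult_ac)
        also have "\<dots> \<le> (\<Sum>x\<in>UNIV. m t $ x * (H x (?q x) - H x (?p x) + \<beta> x (?p x) \<bullet> (?q x - ?p x)))"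
          by (intro sum_mono mult_left_mono H_conv K simplex_P_nonneg[OF P(1)])
        finally show ?thesis .
      qed
      ultimately show ?thesis by simp
    qed
    show "((\<lambda>t. m t - m' t) has_vector_derivative drift (m t) (u t) - drift (m' t) (u' t)) (at t within {t0..T}) \<and>
       ((\<lambda>t. u t - u' t) has_vector_derivative ham (m t) (u t) - ham (m' t) (u' t)) (at t within {t0..T}) \<and>
       norm (drift (m t) (u t) - drift (m' t) (u' t)) \<le> LB * (norm ?\<rho> + spread (m t) ?v + 0) \<and>
       norm (ham (m t) (u t) - ham (m' t) (u' t)) \<le> LB * (norm ?v + norm ?\<rho> + 0) \<and>
       (ham (m t) (u t) - ham (m' t) (u' t)) \<bullet> ?\<rho> + ?v \<bullet> (drift (m t) (u t) - drift (m' t) (u' t))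
        \<le> - c * (spread (m t) ?v)\<^sup>2 + LB * 0 * (norm ?v + norm ?\<rho>)"
      using 1 2 3 4 5 by blast
  next
    have TT: "T \<in> {t0..T}" using t0 by simp
    note P = mfgD(1)[OF mu(1) TT] mfgD(1)[OF mu(2) TT]
    show "norm (u T - u' T) \<le> LB * (norm (m T - m' T) + 0)"
      using fin_lip[OF P] by (simp add: mfg_fin[OF mu(1)] mfg_fin[OF mu(2)])
    have "0 \<le> (\<Sum>x\<in>UNIV. (G x (m T) - G x (m' T)) * (m T $ x - m' T $ x))"
      using MonG P by (auto simp: Mon_def)
    also have "\<dots> = (u T - u' T) \<bullet> (m T - m' T)"
      by (simp add: mfg_fin[OF mu(1)] mfg_fin[OF mu(2)] fin_def inner_vec_def)
    finally show "- (LB * 0 * norm (m T - m' T)) \<le> (u T - u' T) \<bullet> (m T - m' T)" by simp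
  qed
  then show ?thesis using C' by (intro exI[of _ C']) auto
qed

lemma mfg_unique:
  assumes "0 \<le> t0" "t0 \<le> T" "mfg t0 m u" "mfg t0 m' u'" "m t0 = m' t0" "t \<in> {t0..T}"
  shows "m t = m' t" "u t = u' t"
proof -
  obtain \<Lambda> where "\<forall>t0 m u m' u'. 0 \<le> t0 \<longrightarrow> t0 \<le> T \<longrightarrow> mfg t0 m u \<longrightarrow> mfg t0 m' u' \<longrightarrow>
     (\<forall>t\<in>{t0..T}. norm (m t - m' t) \<le> \<Lambda> * norm (m t0 - m' t0) \<and> norm (u t - u' t) \<le> \<Lambda> * norm (m t0 - m' t0))"
    using mfg_lipschitz by blast
  then have "norm (m t - m' t) \<le> \<Lambda> * norm (m t0 - m' t0) \<and> norm (u t - u' t) \<le> \<Lambda> * norm (m t0 - m' t0)"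
    using assms by blast
  then show "m t = m' t" "u t = u' t" using assms(5) by auto
qed

definition rate :: real where "rate = real CARD('d) * C"

text \<open>The factor 2 makes room for the backward component of the window map next to the forward
  one.\<close>

definition LW :: real where "LW = 2 * (rate + 2 * LB)"

lemma rate_nonneg: "0 \<le> rate" using N0 C0 by (simp add: rate_def)

lemma LW_nonneg: "0 \<le> LW" using rate_nonneg LB_ge(5) by (simp add: LW_def)

text \<open>Mass leaves \<open>z\<close> at total rate at most \<open>CARD('d) * C\<close>, since
  each of the \<open>CARD('d)\<close> entries of the control is at most \<open>C\<close>; what
  arrives is nonnegative.\<close>

lemma rate_drift_nonneg:
  assumes "m \<in> simplex_P"
  shows "0 \<le> (rate *\<^sub>R m + drift m u) $ z"
proof -
  let ?b = "\<lambda>y. \<beta> y (dl u y)"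
  have "(\<Sum>j\<in>UNIV. ?b z $ j) \<le> (\<Sum>j\<in>(UNIV::'d set). C)"
  proof (rule sum_mono)
    fix j show "?b z $ j \<le> C" using component_le_norm_cart[of "?b z" j] \<beta>_bound[of z "dl u z"] by linarith
  qed
  then have "m $ z * (\<Sum>j\<in>UNIV. ?b z $ j) \<le> m $ z * rate"
    using simplex_P_nonneg[OF assms] by (intro mult_left_mono) (auto simp: rate_def)
  moreover have "drift m u $ z = (\<Sum>y\<in>UNIV. m $ y * ?b y $ z) - m $ z * (\<Sum>j\<in>UNIV. ?b z $ j)"
    by (simp add: drift_def gen_def right_diff_distrib sum_subtractf axis_def if_distrib[of "\<lambda>x. _ * x"] cong: if_cong)
  moreover have "0 \<le> (\<Sum>y\<in>UNIV. m $ y * ?b y $ z)"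
    by (intro sum_nonneg mult_nonneg_nonneg simplex_P_nonneg[OF assms] \<beta>_nonneg)
  ultimately show ?thesis by (simp add: mult.commute)
qed

text \<open>The forward equation is solved in the form \<open>(e\<^sup>k\<^sup>t m)' = e\<^sup>k\<^sup>t (k m + drift m u)\<close>, whose right hand
  side is nonnegative for \<open>k = rate\<close>; this keeps the iterates in the simplex.\<close>

lemma window_solution:
  assumes ab: "a \<le> b" and m0: "m0 \<in> simplex_P"
    and g: "\<And>m m'. m \<in> simplex_P \<Longrightarrow> m' \<in> simplex_P \<Longrightarrow> norm (g m - g m') \<le> \<Lambda> * norm (m - m')"
    and \<Lambda>: "0 \<le> \<Lambda>" and small: "(b - a) * ((1 + \<Lambda>) * LW) \<le> 1 / 2"
  shows "\<exists>m u. m a = m0 \<and> u b = g (m b) \<and> (\<forall>t\<in>{a..b}. m t \<in> simplex_P \<and>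
    (m has_vector_derivative drift (m t) (u t)) (at t within {a..b}) \<and>
    (u has_vector_derivative ham (m t) (u t)) (at t within {a..b}))"
proof -
  define w where "w t = exp (rate * (t - a))" for t
  have w0: "w t > 0" for t by (simp add: w_def)
  have wa: "w a = 1" by (simp add: w_def)
  define R where "R z s = w s *\<^sub>R (rate *\<^sub>R fst (z s) + drift (fst (z s)) (snd (z s)))" for z s
  define W where "W z t = m0 + integral {a..t} (R z)" for z t
  define M where "M z t = (1 / w t) *\<^sub>R W z t" for z t
  \<comment> \<open>The terminal value is computed from the new forward path \<open>M z\<close> and
    not from \<open>z\<close>. So the terminal condition holds for every iterate, and its
    contribution to the contraction is \<open>\<Lambda>\<close> times the one of the forward
    component.\<close>
  define U where "U z t = g (M z b) - integral {t..b} (\<lambda>s. ham (fst (z s)) (snd (z s)))" for z t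
  define \<Phi> where "\<Phi> z t = (M z t, U z t)" for z t
  define S where "S = (simplex_P :: (real^'d) set) \<times> (UNIV :: (real^'d) set)"
  have fst_snd: "continuous_on {a..b} (\<lambda>s. fst (z s))" "continuous_on {a..b} (\<lambda>s. snd (z s))" "(\<lambda>s. fst (z s)) ` {a..b} \<subseteq> simplex_P"
    if "continuous_on {a..b} z" "z ` {a..b} \<subseteq> S" for z
    using that by (auto simp: S_def intro!: continuous_intros)
  have cR: "continuous_on {a..b} (R z)" if "continuous_on {a..b} z" "z ` {a..b} \<subseteq> S" for z
    unfolding R_def w_def using that fst_snd[OF that] by (intro continuous_intros continuous_on_drift) auto
  have dW: "(W z has_vector_derivative R z t) (at t within {a..b})"
    if "continuous_on {a..b} z" "z ` {a..b} \<subseteq> S" "t \<in> {a..b}" for z t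
  proof -
    have "((\<lambda>t. m0 + integral {a..t} (R z)) has_vector_derivative 0 + R z t) (at t within {a..b})"
      by (intro derivative_intros integral_has_vector_derivative cR that)
    then show ?thesis by (simp add: W_def[abs_def])
  qed
  have dM: "(M z has_vector_derivative rate *\<^sub>R (fst (z t) - M z t) + drift (fst (z t)) (snd (z t))) (at t within {a..b})"
    if "continuous_on {a..b} z" "z ` {a..b} \<subseteq> S" "t \<in> {a..b}" for z t
  proof -
    have "((\<lambda>t. exp (- (rate * (t - a)))) has_real_derivative - rate * exp (- (rate * (t - a)))) (at t within {a..b})"
      by (auto intro!: derivative_eq_intros)
    then have "((\<lambda>t. exp (- (rate * (t - a))) *\<^sub>R W z t) has_vector_derivative
        exp (- (rate * (t - a))) *\<^sub>R R z t + (- rate * exp (- (rate * (t - a)))) *\<^sub>R W z t) (at t within {a..b})"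
      by (intro has_vector_derivative_scaleR dW that)
    moreover have "exp (- (rate * (t - a))) = 1 / w t" for t by (simp add: w_def exp_minus inverse_eq_divide)
    ultimately have "(M z has_vector_derivative (1 / w t) *\<^sub>R R z t + (- rate * (1 / w t)) *\<^sub>R W z t) (at t within {a..b})"
      by (simp add: M_def[abs_def])
    moreover have "(1 / w t) *\<^sub>R R z t + (- rate * (1 / w t)) *\<^sub>R W z t
        = rate *\<^sub>R (fst (z t) - M z t) + drift (fst (z t)) (snd (z t))"
      using w0[of t] by (simp add: R_def M_def algebra_simps)
    ultimately show ?thesis by simp
  qed
  have dU: "(U z has_vector_derivative ham (fst (z t)) (snd (z t))) (at t within {a..b})"
    if "continuous_on {a..b} z" "z ` {a..b} \<subseteq> S" "t \<in> {a..b}" for z t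
  proof -
    have "((\<lambda>t. g (M z b) - integral {t..b} (\<lambda>s. ham (fst (z s)) (snd (z s)))) has_vector_derivative
        0 - - ham (fst (z t)) (snd (z t))) (at t within {a..b})"
      by (intro derivative_intros backward_integral continuous_on_ham fst_snd that)
    then show ?thesis by (simp add: U_def[abs_def])
  qed
  have MP: "M z t \<in> simplex_P" if z: "continuous_on {a..b} z" "z ` {a..b} \<subseteq> S" and t: "t \<in> {a..b}" for z t
  proof -
    have dW': "(W z has_vector_derivative R z s) (at s within {a..t})" if "s \<in> {a..t}" for s
      by (rule has_vector_derivative_within_subset[OF dW[OF z]]) (use that t in auto)
    have zP: "fst (z s) \<in> simplex_P" if "s \<in> {a..t}" for s using fst_snd(3)[OF z] that t by auto
    have Wa: "W z a = m0" by (simp add: W_def)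
    have "0 \<le> W z t $ j" for j
    proof -
      have "- W z t $ j \<le> - W z a $ j"
      proof (rule nonincreasing_within[where f = "\<lambda>t. - W z t $ j" and f' = "\<lambda>s. - R z s $ j"])
        fix s assume s: "s \<in> {a..t}"
        show "((\<lambda>t. - W z t $ j) has_real_derivative - R z s $ j) (at s within {a..t})"
          unfolding has_real_derivative_iff_has_vector_derivative
          by (intro derivative_intros has_vector_derivative_vec_nth dW' s)
        show "- R z s $ j \<le> 0"
          using rate_drift_nonneg[OF zP[OF s], of "snd (z s)" j] w0[of s] by (simp add: R_def)
      qed (use t in auto)
      then show ?thesis using simplex_P_nonneg[OF m0, of j] by (simp add: Wa)
    qed
    \<comment> \<open>The drift has zero total, so the total of \<open>W z\<close> grows at the rate
      of the weight alone; dividing by \<open>w\<close> restores total mass one.\<close>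
    moreover have "(\<Sum>j\<in>UNIV. W z t $ j) = w t"
    proof -
      have "norm (((\<Sum>j\<in>UNIV. W z t $ j) - w t) - ((\<Sum>j\<in>UNIV. W z a $ j) - w a)) \<le> 0 - 0"
      proof (rule norm_increment_le[where f = "\<lambda>t. (\<Sum>j\<in>UNIV. W z t $ j) - w t" and g = "\<lambda>_. 0" and g' = "\<lambda>_. 0"
            and f' = "\<lambda>s. (\<Sum>j\<in>UNIV. R z s $ j) - rate * w s"])
        fix s assume s: "s \<in> {a..t}"
        have "(w has_real_derivative rate * w s) (at s within {a..t})"
          unfolding w_def by (auto intro!: derivative_eq_intros)
        then have "(w has_vector_derivative rate * w s) (at s within {a..t})"
          by (simp add: has_real_derivative_iff_has_vector_derivative)
        then show "((\<lambda>t. (\<Sum>j\<in>UNIV. W z t $ j) - w t) has_vector_derivative (\<Sum>j\<in>UNIV. R z s $ j) - rate * w s) (at s within {a..t})"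
          by (intro derivative_intros has_vector_derivative_vec_nth dW' s)
        have "(\<Sum>j\<in>UNIV. R z s $ j) = w s * (rate * (\<Sum>j\<in>UNIV. fst (z s) $ j) + (\<Sum>j\<in>UNIV. drift (fst (z s)) (snd (z s)) $ j))"
          by (simp add: R_def sum_distrib_left sum.distrib distrib_left)
        then show "norm ((\<Sum>j\<in>UNIV. R z s $ j) - rate * w s) \<le> 0"
          using simplex_P_sum[OF zP[OF s]] by (simp add: sum_drift)
      qed (use t in auto)
      then show ?thesis using simplex_P_sum[OF m0] by (simp add: Wa wa)
    qed
    ultimately show ?thesis using w0[of t] by (simp add: simplex_P_def M_def sum_divide_distrib[symmetric])
  qed
  have "\<exists>z. continuous_on {a..b} z \<and> z ` {a..b} \<subseteq> S \<and> (\<forall>t\<in>{a..b}. \<Phi> z t = z t)"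
  proof (rule path_fixpoint)
    show "closed S" unfolding S_def by (intro closed_Times compact_imp_closed compact_simplex_P closed_UNIV)
    show "(m0, 0) \<in> S" using m0 by (simp add: S_def)
    show "continuous_on {a..b} (\<Phi> z) \<and> \<Phi> z ` {a..b} \<subseteq> S" if z: "continuous_on {a..b} z" "z ` {a..b} \<subseteq> S" for z
    proof -
      have "continuous_on {a..b} (M z)" "continuous_on {a..b} (U z)"
        by (rule continuous_on_vector_derivative; use dM[OF z] dU[OF z] in blast)+
      then show ?thesis using MP[OF z] unfolding \<Phi>_def S_def by (auto intro!: continuous_intros)
    qed
    fix z z' :: "real \<Rightarrow> (real^'d) \<times> (real^'d)" and \<delta> t
    assume z: "continuous_on {a..b} z" "z ` {a..b} \<subseteq> S" and z': "continuous_on {a..b} z'" "z' ` {a..b} \<subseteq> S"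
      and le: "\<And>t. t \<in> {a..b} \<Longrightarrow> norm (z t - z' t) \<le> \<delta>" and t: "t \<in> {a..b}"
    have \<delta>0: "0 \<le> \<delta>" using le[OF t] norm_ge_zero order_trans by blast
    have lef: "norm (fst (z s) - fst (z' s)) \<le> \<delta>" "norm (snd (z s) - snd (z' s)) \<le> \<delta>" if "s \<in> {a..b}" for s
    proof -
      have "norm (fst p) \<le> norm p" "norm (snd p) \<le> norm p" for p :: "(real^'d) \<times> (real^'d)"
        by (metis norm_fst_le prod.collapse) (metis norm_snd_le prod.collapse)
      from this[of "z s - z' s"] le[OF that] show "norm (fst (z s) - fst (z' s)) \<le> \<delta>" "norm (snd (z s) - snd (z' s)) \<le> \<delta>"
        by simp_all
    qed
    have zP: "fst (z s) \<in> simplex_P" "fst (z' s) \<in> simplex_P" if "s \<in> {a..b}" for s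
      using fst_snd(3)[OF z] fst_snd(3)[OF z'] that by auto
    have Mle: "norm (M z t - M z' t) \<le> (b - a) * ((rate + 2 * LB) * \<delta>)" if t: "t \<in> {a..b}" for t
    proof -
      have "norm ((W z t - W z' t) - (W z a - W z' a)) \<le> (w t * ((rate + 2 * LB) * \<delta>)) * t - (w t * ((rate + 2 * LB) * \<delta>)) * a"
      proof (rule norm_increment_le[where f = "\<lambda>t. W z t - W z' t" and g = "\<lambda>s. (w t * ((rate + 2 * LB) * \<delta>)) * s"])
        fix s assume s: "s \<in> {a..t}"
        then have s': "s \<in> {a..b}" using t by auto
        show "((\<lambda>t. W z t - W z' t) has_vector_derivative R z s - R z' s) (at s within {a..t})"
          by (rule has_vector_derivative_within_subset[of _ _ _ "{a..b}"])
             (use t in \<open>auto intro!: derivative_intros dW z z' s'\<close>)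
        show "((\<lambda>s. (w t * ((rate + 2 * LB) * \<delta>)) * s) has_real_derivative w t * ((rate + 2 * LB) * \<delta>)) (at s within {a..t})"
          by (auto intro!: derivative_eq_intros)
        have "norm (rate *\<^sub>R (fst (z s) - fst (z' s)) + (drift (fst (z s)) (snd (z s)) - drift (fst (z' s)) (snd (z' s))))
            \<le> rate * norm (fst (z s) - fst (z' s)) + LB * (norm (fst (z s) - fst (z' s)) + norm (snd (z s) - snd (z' s)))"
          using rate_nonneg by (intro norm_triangle_le add_mono drift_lip zP s') simp_all
        also have "\<dots> \<le> rate * \<delta> + LB * (\<delta> + \<delta>)"
          using lef[OF s'] rate_nonneg LB_ge(5) by (intro add_mono mult_left_mono) auto
        finally have *: "norm (rate *\<^sub>R (fst (z s) - fst (z' s)) + (drift (fst (z s)) (snd (z s)) - drift (fst (z' s)) (snd (z' s))))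
            \<le> (rate + 2 * LB) * \<delta>" by (simp add: algebra_simps)
        have "R z s - R z' s = w s *\<^sub>R (rate *\<^sub>R (fst (z s) - fst (z' s)) + (drift (fst (z s)) (snd (z s)) - drift (fst (z' s)) (snd (z' s))))"
          by (simp add: R_def algebra_simps)
        then have "norm (R z s - R z' s) \<le> w s * ((rate + 2 * LB) * \<delta>)"
          using * w0[of s] by simp
        also have "\<dots> \<le> w t * ((rate + 2 * LB) * \<delta>)"
          using s rate_nonneg LB_ge(5) \<delta>0 by (intro mult_right_mono) (auto simp: w_def intro!: mult_left_mono)
        finally show "norm (R z s - R z' s) \<le> w t * ((rate + 2 * LB) * \<delta>)" .
      qed (use t in auto)
      then have "norm (W z t - W z' t) \<le> w t * ((t - a) * ((rate + 2 * LB) * \<delta>))" by (simp add: W_def algebra_simps)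
      then have "norm (M z t - M z' t) \<le> (t - a) * ((rate + 2 * LB) * \<delta>)"
      proof -
        have "M z t - M z' t = (1 / w t) *\<^sub>R (W z t - W z' t)" by (simp add: M_def scaleR_diff_right)
        then show ?thesis using \<open>norm (W z t - W z' t) \<le> _\<close> w0[of t] by (simp add: pos_divide_le_eq mult.commute)
      qed
      also have "\<dots> \<le> (b - a) * ((rate + 2 * LB) * \<delta>)"
        using t rate_nonneg LB_ge(5) \<delta>0 by (intro mult_right_mono) auto
      finally show ?thesis .
    qed
    have Ule: "norm (U z t - U z' t) \<le> \<Lambda> * ((b - a) * ((rate + 2 * LB) * \<delta>)) + (b - a) * (2 * LB * \<delta>)"
    proof -
      have bb: "b \<in> {a..b}" using ab by simp
      have "norm ((U z b - U z' b) - (U z t - U z' t)) \<le> (2 * LB * \<delta>) * b - (2 * LB * \<delta>) * t"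
      proof (rule norm_increment_le[where f = "\<lambda>t. U z t - U z' t" and g = "\<lambda>s. (2 * LB * \<delta>) * s"])
        fix s assume s: "s \<in> {t..b}"
        then have s': "s \<in> {a..b}" using t by auto
        show "((\<lambda>t. U z t - U z' t) has_vector_derivative
            ham (fst (z s)) (snd (z s)) - ham (fst (z' s)) (snd (z' s))) (at s within {t..b})"
          by (rule has_vector_derivative_within_subset[of _ _ _ "{a..b}"])
             (use t in \<open>auto intro!: derivative_intros dU z z' s'\<close>)
        show "((\<lambda>s. (2 * LB * \<delta>) * s) has_real_derivative 2 * LB * \<delta>) (at s within {t..b})"
          by (auto intro!: derivative_eq_intros)
        have "norm (ham (fst (z s)) (snd (z s)) - ham (fst (z' s)) (snd (z' s)))
            \<le> LB * (norm (fst (z s) - fst (z' s)) + norm (snd (z s) - snd (z' s)))"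
          by (rule ham_lip[OF zP[OF s']])
        also have "\<dots> \<le> LB * (\<delta> + \<delta>)" using lef[OF s'] LB_ge(5) by (intro mult_left_mono) auto
        finally show "norm (ham (fst (z s)) (snd (z s)) - ham (fst (z' s)) (snd (z' s))) \<le> 2 * LB * \<delta>" by simp
      qed (use t in auto)
      also have "\<dots> = (b - t) * (2 * LB * \<delta>)" by (simp add: algebra_simps)
      also have "\<dots> \<le> (b - a) * (2 * LB * \<delta>)" using t LB_ge(5) \<delta>0 by (intro mult_right_mono) auto
      finally have 1: "norm ((U z b - U z' b) - (U z t - U z' t)) \<le> (b - a) * (2 * LB * \<delta>)" .
      have "norm (U z b - U z' b) \<le> \<Lambda> * norm (M z b - M z' b)"
        using g[OF MP[OF z bb] MP[OF z' bb]] by (simp add: U_def)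
      also have "\<dots> \<le> \<Lambda> * ((b - a) * ((rate + 2 * LB) * \<delta>))" by (intro mult_left_mono Mle bb \<Lambda>)
      finally have 2: "norm (U z b - U z' b) \<le> \<Lambda> * ((b - a) * ((rate + 2 * LB) * \<delta>))" .
      have "norm (U z t - U z' t) \<le> norm (U z b - U z' b) + norm ((U z b - U z' b) - (U z t - U z' t))"
        using norm_triangle_ineq4[of "U z b - U z' b" "(U z b - U z' b) - (U z t - U z' t)"] by simp
      then show ?thesis using 1 2 by linarith
    qed
    have "norm (\<Phi> z t - \<Phi> z' t) \<le> norm (M z t - M z' t) + norm (U z t - U z' t)"
      unfolding \<Phi>_def diff_Pair by (rule norm_Pair_le)
    also have "\<dots> \<le> (b - a) * ((rate + 2 * LB) * \<delta>) + (\<Lambda> * ((b - a) * ((rate + 2 * LB) * \<delta>)) + (b - a) * (2 * LB * \<delta>))"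
      by (intro add_mono Mle Ule t)
    also have "\<dots> = ((b - a) * ((1 + \<Lambda>) * (rate + 2 * LB) + 2 * LB)) * \<delta>" by (simp add: algebra_simps)
    also have "\<dots> \<le> ((b - a) * ((1 + \<Lambda>) * LW)) * \<delta>"
    proof (intro mult_right_mono mult_left_mono \<delta>0)
      have "2 * LB \<le> (1 + \<Lambda>) * (rate + 2 * LB)"
        using mult_mono[of 1 "1 + \<Lambda>" "2 * LB" "rate + 2 * LB"] \<Lambda> rate_nonneg LB_ge(5) by simp
      then show "(1 + \<Lambda>) * (rate + 2 * LB) + 2 * LB \<le> (1 + \<Lambda>) * LW" by (simp add: LW_def algebra_simps)
    qed (use ab in auto)
    also have "\<dots> \<le> 1 / 2 * \<delta>" by (intro mult_right_mono small \<delta>0)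
    finally show "norm (\<Phi> z t - \<Phi> z' t) \<le> \<delta> / 2" by simp
  qed
  then obtain z where z: "continuous_on {a..b} z" "z ` {a..b} \<subseteq> S" "\<And>t. t \<in> {a..b} \<Longrightarrow> \<Phi> z t = z t" by blast
  have zMU: "z t = (M z t, U z t)" if "t \<in> {a..b}" for t using z(3)[OF that] by (simp add: \<Phi>_def)
  show ?thesis
  proof (rule exI[of _ "M z"], rule exI[of _ "U z"], intro conjI ballI)
    show "M z a = m0" by (simp add: M_def W_def wa)
    show "U z b = g (M z b)" by (simp add: U_def)
  next
    fix t assume t: "t \<in> {a..b}"
    show "M z t \<in> simplex_P" by (rule MP[OF z(1,2) t])
    show "(M z has_vector_derivative drift (M z t) (U z t)) (at t within {a..b})"
      using dM[OF z(1,2) t] by (simp add: zMU[OF t])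
    show "(U z has_vector_derivative ham (M z t) (U z t)) (at t within {a..b})"
      using dU[OF z(1,2) t] by (simp add: zMU[OF t])
  qed
qed

text \<open>Induction on the number of windows between \<open>t0\<close> and \<open>T\<close>. The
  part of the game after a window acts on it as a terminal cost, namely the map from the
  distribution at its right end to the value there.\<close>

lemma mfg_exists:
  assumes "0 \<le> t0" "t0 \<le> T" "m0 \<in> simplex_P"
  shows "\<exists>m u. mfg t0 m u \<and> m t0 = m0"
proof -
  obtain \<Lambda> where \<Lambda>: "0 \<le> \<Lambda>" and lip: "\<forall>t0 m u m' u'. 0 \<le> t0 \<longrightarrow> t0 \<le> T \<longrightarrow> mfg t0 m u \<longrightarrow> mfg t0 m' u' \<longrightarrow>
     (\<forall>t\<in>{t0..T}. norm (m t - m' t) \<le> \<Lambda> * norm (m t0 - m' t0) \<and> norm (u t - u' t) \<le> \<Lambda> * norm (m t0 - m' t0))"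
    using mfg_lipschitz by blast
  \<comment> \<open>The contraction condition asks for
    \<open>h * ((1 + \<Lambda>) * LW) \<le> 1 / 2\<close>; the summand 1 keeps the denominator
    positive.\<close>
  define h where "h = 1 / (2 * ((1 + \<Lambda>) * LW + 1))"
  have p: "0 \<le> (1 + \<Lambda>) * LW" using \<Lambda> LW_nonneg by simp
  then have h: "0 < h" "h * ((1 + \<Lambda>) * LW) \<le> 1 / 2" by (simp_all add: h_def field_simps)
  have main: "\<exists>m u. mfg t0 m u \<and> m t0 = m0"
    if "0 \<le> t0" "t0 \<le> T" "T - t0 \<le> real n * h" "m0 \<in> simplex_P" for n t0 m0
    using that
  proof (induction n arbitrary: t0 m0)
    case 0
    then have "t0 = T" by simp
    \<comment> \<open>On a one-point interval every derivative statement holds, so constants form a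
      solution and the induction can start without a window.\<close>
    moreover have "mfg T (\<lambda>_. m0) (\<lambda>_. fin m0)"
      using 0(4) by (auto simp: mfg_def has_vector_derivative_singleton)
    ultimately show ?case by blast
  next
    case (Suc n)
    define b where "b = min T (t0 + h)"
    have b: "t0 \<le> b" "b \<le> T" "b - t0 \<le> h" "T - b \<le> real n * h" "0 \<le> b"
      using Suc.prems h(1) by (auto simp: b_def min_def algebra_simps)
    \<comment> \<open>A choice of one solution after \<open>b\<close> for each distribution at
      \<open>b\<close>. Its value at \<open>b\<close> serves as terminal cost of the window; the
      Lipschitz constant is \<open>\<Lambda>\<close>, which does not deteriorate with the number of
      windows.\<close>
    have "\<forall>m0. \<exists>p. m0 \<in> simplex_P \<longrightarrow> mfg b (fst p) (snd p) \<and> fst p b = m0"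
      using Suc.IH[OF b(5,2,4)] by fastforce
    then obtain s where s: "\<And>m0. m0 \<in> simplex_P \<Longrightarrow> mfg b (fst (s m0)) (snd (s m0)) \<and> fst (s m0) b = m0"
      by metis
    have bT: "b \<in> {b..T}" using b by simp
    have "\<exists>m u. m t0 = m0 \<and> u b = snd (s (m b)) b \<and> (\<forall>t\<in>{t0..b}. m t \<in> simplex_P \<and>
      (m has_vector_derivative drift (m t) (u t)) (at t within {t0..b}) \<and>
      (u has_vector_derivative ham (m t) (u t)) (at t within {t0..b}))"
    proof (rule window_solution[where \<Lambda> = \<Lambda> and g = "\<lambda>m. snd (s m) b"])
      show "norm (snd (s m) b - snd (s m') b) \<le> \<Lambda> * norm (m - m')" if "m \<in> simplex_P" "m' \<in> simplex_P" for m m'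
        using lip[rule_format, OF b(5,2) s[OF that(1), THEN conjunct1] s[OF that(2), THEN conjunct1] bT]
          s[OF that(1)] s[OF that(2)] by simp
      show "(b - t0) * ((1 + \<Lambda>) * LW) \<le> 1 / 2"
        using mult_right_mono[OF b(3) p] h(2) by linarith
    qed (use b Suc.prems \<Lambda> in auto)
    then obtain m u where mu: "m t0 = m0" "u b = snd (s (m b)) b"
      "\<And>t. t \<in> {t0..b} \<Longrightarrow> m t \<in> simplex_P"
      "\<And>t. t \<in> {t0..b} \<Longrightarrow> (m has_vector_derivative drift (m t) (u t)) (at t within {t0..b})"
      "\<And>t. t \<in> {t0..b} \<Longrightarrow> (u has_vector_derivative ham (m t) (u t)) (at t within {t0..b})" by blast
    have mb: "m b \<in> simplex_P" using mu(3)[of b] b by simp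
    define n v where "n = fst (s (m b))" and "v = snd (s (m b))"
    have nv: "mfg b n v" "n b = m b" "v b = u b" using s[OF mb] mu(2) by (auto simp: n_def v_def)
    let ?m = "\<lambda>t. if t \<le> b then m t else n t" and ?u = "\<lambda>t. if t \<le> b then u t else v t"
    have "mfg t0 ?m ?u" unfolding mfg_def
    proof (intro conjI ballI)
      fix t assume t: "t \<in> {t0..T}"
      show "?m t \<in> simplex_P" using mu(3)[of t] mfgD(1)[OF nv(1), of t] t by auto
      \<comment> \<open>At \<open>b\<close> both pieces have the same distribution and value, hence
        the same right hand side, so the one-sided derivatives match.\<close>
      have "(?m has_vector_derivative (if t \<le> b then drift (m t) (u t) else drift (n t) (v t))) (at t within {t0..T})"
        by (rule has_vector_derivative_join[OF b(1,2) mu(4) mfgD(2)[OF nv(1)] _ _ t]) (use nv in auto)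
      then show "(?m has_vector_derivative drift (?m t) (?u t)) (at t within {t0..T})" by (simp split: if_splits)
      have "(?u has_vector_derivative (if t \<le> b then ham (m t) (u t) else ham (n t) (v t))) (at t within {t0..T})"
        by (rule has_vector_derivative_join[OF b(1,2) mu(5) mfgD(3)[OF nv(1)] _ _ t]) (use nv in auto)
      then show "(?u has_vector_derivative ham (?m t) (?u t)) (at t within {t0..T})" by (simp split: if_splits)
    next
      show "?u T = fin (?m T)" using mfg_fin[OF nv(1)] nv b by (cases "T = b") auto
    qed
    moreover have "?m t0 = m0" using b mu(1) by simp
    ultimately show ?case by blast
  qed
  obtain n where "(T - t0) / h \<le> real n" using real_arch_simple by blast
  then have "T - t0 \<le> real n * h" using h(1) by (simp add: field_simps)
  then show ?thesis using main assms by blast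
qed

end

section \<open>Differentiability of the solution map\<close>

text \<open>Each quotient is linearized at its own base point, with a quadratic remainder that after
  division by the step is at most \<open>A * B\<^sup>2\<close> times the step. Writing the
  difference with \<open>L1\<close> alone costs \<open>L1 w2 - L2 w2\<close>, the change of the
  linearization between the base points.\<close>

lemma quotient_linearization:
  fixes L1 L2 :: "'z::real_normed_vector \<Rightarrow> 'x::real_normed_vector"
  assumes lin: "linear L1" "linear L2" and s: "0 < s" "0 < s'"
    and z: "z1' - z1 = s *\<^sub>R w1" "z2' - z2 = s' *\<^sub>R w2"
    and w: "norm w1 \<le> B" "norm w2 \<le> B" and A: "0 \<le> A" "0 \<le> \<delta>"
    and f1: "norm (f1' - f1 - L1 (z1' - z1)) \<le> A * (norm (z1' - z1))\<^sup>2"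
    and f2: "norm (f2' - f2 - L2 (z2' - z2)) \<le> A * (norm (z2' - z2))\<^sup>2"
    and L: "norm (L1 w2 - L2 w2) \<le> A * \<delta> * norm w2"
  shows "norm (((1 / s) *\<^sub>R (f1' - f1) - (1 / s') *\<^sub>R (f2' - f2)) - L1 (w1 - w2)) \<le> A * B\<^sup>2 * (s + s') + A * \<delta> * B"
proof -
  have q: "norm ((1 / r) *\<^sub>R (f' - f) - L w) \<le> A * B\<^sup>2 * r"
    if "linear L" "0 < r" "z' - z = r *\<^sub>R w" "norm w \<le> B" "norm (f' - f - L (z' - z)) \<le> A * (norm (z' - z))\<^sup>2"
    for L :: "'z \<Rightarrow> 'x" and r z z' w f f'
  proof -
    have "(1 / r) *\<^sub>R (f' - f) - L w = (1 / r) *\<^sub>R (f' - f - L (z' - z))"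
      using that(1,2,3) by (simp add: linear_scale scaleR_diff_right)
    then have "norm ((1 / r) *\<^sub>R (f' - f) - L w) = (1 / r) * norm (f' - f - L (z' - z))"
      using that(2) by simp
    also have "\<dots> \<le> (1 / r) * (A * (r * norm w)\<^sup>2)"
      using that(2,3,5) by (intro mult_left_mono) auto
    also have "\<dots> = A * (norm w)\<^sup>2 * r" using that(2) by (simp add: power2_eq_square)
    also have "\<dots> \<le> A * B\<^sup>2 * r"
      using that A by (intro mult_right_mono mult_left_mono power_mono) auto
    finally show ?thesis .
  qed
  have B: "A * \<delta> * norm w2 \<le> A * \<delta> * B" using w A by (intro mult_left_mono) auto
  have eq: "((1 / s) *\<^sub>R (f1' - f1) - (1 / s') *\<^sub>R (f2' - f2)) - L1 (w1 - w2)
      = ((1 / s) *\<^sub>R (f1' - f1) - L1 w1) - ((1 / s') *\<^sub>R (f2' - f2) - L2 w2) + (L1 w2 - L2 w2)"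
    by (simp add: linear_diff[OF lin(1)])
  show ?thesis unfolding eq
    using q[OF lin(1) s(1) z(1) w(1) f1] q[OF lin(2) s(2) z(2) w(2) f2] L B
      norm_triangle_ineq[of "((1 / s) *\<^sub>R (f1' - f1) - L1 w1) - ((1 / s') *\<^sub>R (f2' - f2) - L2 w2)" "L1 w2 - L2 w2"]
      norm_triangle_ineq4[of "(1 / s) *\<^sub>R (f1' - f1) - L1 w1" "(1 / s') *\<^sub>R (f2' - f2) - L2 w2"]
    by (simp add: distrib_left)
qed

lemma norm_fst_le': "norm (fst p) \<le> norm p" and norm_snd_le': "norm (snd p) \<le> norm p"
  by (metis norm_fst_le prod.collapse) (metis norm_snd_le prod.collapse)

lemma norm_dl_mono:
  fixes v :: "real ^ 'd::finite"
  assumes "norm v \<le> b"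
  shows "norm (dl v y) \<le> 2 * real CARD('d) * b"
  by (rule order_trans[OF norm_dl_le]) (rule mult_left_mono[OF assms], simp)

context mfg_system
begin

section \<open>Linearized coefficients\<close>

text \<open>The derivative of \<open>drift\<close> at \<open>z\<close> in the direction
  \<open>w\<close>, by the product rule. The second sum is subtracted because \<open>B2\<close> is
  the derivative of \<open>- \<beta>\<close>.\<close>

definition lin_drift :: "(real ^ 'd) \<times> (real ^ 'd) \<Rightarrow> (real ^ 'd) \<times> (real ^ 'd) \<Rightarrow> real ^ 'd" where
  "lin_drift z w = (\<Sum>y\<in>UNIV. fst w $ y *\<^sub>R gen y (\<beta> y (dl (snd z) y)))
     - (\<Sum>y\<in>UNIV. fst z $ y *\<^sub>R gen y (B2 y (dl (snd z) y) (dl (snd w) y)))"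

definition lin_ham :: "(real ^ 'd) \<times> (real ^ 'd) \<Rightarrow> (real ^ 'd) \<times> (real ^ 'd) \<Rightarrow> real ^ 'd" where
  "lin_ham z w = (\<chi> x. - (\<beta> x (dl (snd z) x) \<bullet> dl (snd w) x) - AF x (fst z) \<bullet> fst w)"

definition lin_fin :: "real ^ 'd \<Rightarrow> real ^ 'd \<Rightarrow> real ^ 'd" where
  "lin_fin m \<rho> = (\<chi> x. AG x m \<bullet> \<rho>)"

text \<open>States at which the second-order information on \<open>H\<close> may be used. Solutions
  of the game remain among them.\<close>

definition good :: "(real ^ 'd) \<times> (real ^ 'd) \<Rightarrow> bool" where
  "good z \<longleftrightarrow> fst z \<in> simplex_P \<and> (\<forall>x. norm (dl (snd z) x) \<le> K)"

definition CA :: real where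
  "CA = 8 * real CARD('d) * real CARD('d) * (1 + real CARD('d)) * C
     + real CARD('d) * (4 * real CARD('d) * real CARD('d) * C + C)
     + real CARD('d) * ((1 + real CARD('d)) * C) + (1 + real CARD('d)) * C
     + real CARD('d) * (2 * real CARD('d) * C + C)"

lemma CA_ge: "8 * real CARD('d) * real CARD('d) * (1 + real CARD('d)) * C \<le> CA"
  "real CARD('d) * (4 * real CARD('d) * real CARD('d) * C + C) \<le> CA"
  "real CARD('d) * ((1 + real CARD('d)) * C) \<le> CA" "(1 + real CARD('d)) * C \<le> CA"
  "real CARD('d) * (2 * real CARD('d) * C + C) \<le> CA" "real CARD('d) * C \<le> CA" "0 \<le> CA"
proof -
  have "0 \<le> 8 * real CARD('d) * real CARD('d) * (1 + real CARD('d)) * C"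
    "0 \<le> real CARD('d) * (4 * real CARD('d) * real CARD('d) * C + C)"
    "0 \<le> real CARD('d) * ((1 + real CARD('d)) * C)" "0 \<le> (1 + real CARD('d)) * C"
    "0 \<le> real CARD('d) * (2 * real CARD('d) * C + C)"
    using N0 C0 by simp_all
  note p = this
  show "8 * real CARD('d) * real CARD('d) * (1 + real CARD('d)) * C \<le> CA"
    "real CARD('d) * (4 * real CARD('d) * real CARD('d) * C + C) \<le> CA"
    "real CARD('d) * ((1 + real CARD('d)) * C) \<le> CA" "(1 + real CARD('d)) * C \<le> CA"
    "real CARD('d) * (2 * real CARD('d) * C + C) \<le> CA" "0 \<le> CA"
    unfolding CA_def using p by linarith+
  have "real CARD('d) * C \<le> real CARD('d) * (2 * real CARD('d) * C + C)"
    using N0 C0 by (intro mult_left_mono) auto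
  then show "real CARD('d) * C \<le> CA" unfolding CA_def using p by linarith
qed

lemma gen_linear: "linear (gen y)"
  by (rule linearI) (simp_all add: gen_def sum.distrib algebra_simps sum_distrib_left[symmetric])

lemma dl_linear: "linear (\<lambda>v. dl v y)"
  by (rule linearI) (simp_all add: vec_eq_iff dl_nth algebra_simps)

lemma linear_lin_drift: "linear (lin_drift z)"
proof -
  have 1: "linear (\<lambda>w. fst w $ y *\<^sub>R gen y (\<beta> y (dl (snd z) y)))" for y
    by (rule linearI) (simp_all add: algebra_simps)
  have 2: "linear (\<lambda>w :: (real^'d) \<times> (real^'d). gen y (B2 y (dl (snd z) y) (dl (snd w) y)))" for y
    using linear_compose[OF linear_compose[OF linear_compose[OF linear_snd dl_linear] B2_linear[of y "dl (snd z) y"]] gen_linear[of y], of y]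
    by (simp add: o_def)
  show ?thesis unfolding lin_drift_def
    by (intro linear_compose_sub linear_compose_sum ballI 1 linear_compose_scale_right 2)
qed

lemma linear_lin_ham: "linear (lin_ham z)"
  by (rule linearI)
     (simp_all add: lin_ham_def vec_eq_iff linear_add[OF dl_linear] dl_scaleR inner_add_right algebra_simps)

lemma linear_lin_fin: "linear (lin_fin m)"
  by (rule linearI) (simp_all add: lin_fin_def vec_eq_iff inner_add_right)

text \<open>The remainder of a product: the increment of the mass times the increment of the
  control, plus the mass times the second-order remainder of the control.\<close>

lemma drift_expand:
  assumes z: "good z" and z': "good z'"
  shows "norm (drift (fst z') (snd z') - drift (fst z) (snd z) - lin_drift z (z' - z)) \<le> CA * (norm (z' - z))\<^sup>2"
proof -
  let ?p = "\<lambda>y. dl (snd z) y" and ?p' = "\<lambda>y. dl (snd z') y" and ?d = "norm (z' - z)"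
  let ?N = "real CARD('d)"
  have P: "fst z \<in> simplex_P" and K: "norm (?p y) \<le> K" "norm (?p' y) \<le> K" for y
    using z z' by (auto simp: good_def)
  have fd: "norm (fst z' - fst z) \<le> ?d" and sd: "norm (snd z' - snd z) \<le> ?d"
    using norm_fst_le'[of "z' - z"] norm_snd_le'[of "z' - z"] by auto
  have dd: "norm (?p' y - ?p y) \<le> 2 * ?N * ?d" for y
    using norm_dl_mono[OF sd, of y] by (simp add: dl_diff)
  have eq: "drift (fst z') (snd z') - drift (fst z) (snd z) - lin_drift z (z' - z)
      = (\<Sum>y\<in>UNIV. (fst z' - fst z) $ y *\<^sub>R gen y (\<beta> y (?p' y) - \<beta> y (?p y)))
      + (\<Sum>y\<in>UNIV. fst z $ y *\<^sub>R gen y (\<beta> y (?p' y) - \<beta> y (?p y) + B2 y (?p y) (?p' y - ?p y)))"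
    by (simp add: drift_def lin_drift_def dl_diff linear_diff[OF gen_linear] linear_add[OF gen_linear]
        sum.distrib[symmetric] sum_subtractf[symmetric] algebra_simps)
  have "norm (\<Sum>y\<in>UNIV. (fst z' - fst z) $ y *\<^sub>R gen y (\<beta> y (?p' y) - \<beta> y (?p y)))
      \<le> ?N * ((1 + ?N) * (C * (2 * ?N * ?d)) * norm (fst z' - fst z))"
  proof (rule norm_component_sum_le)
    fix y
    have "norm (\<beta> y (?p' y) - \<beta> y (?p y)) \<le> C * (2 * ?N * ?d)"
      using \<beta>_lip[of y "?p' y" "?p y"] mult_left_mono[OF dd[of y] C0] by linarith
    then show "norm (gen y (\<beta> y (?p' y) - \<beta> y (?p y))) \<le> (1 + ?N) * (C * (2 * ?N * ?d))"
      using norm_gen_le[of y "\<beta> y (?p' y) - \<beta> y (?p y)"] N0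
      by (meson add_nonneg_nonneg mult_left_mono order_trans zero_le_one)
  qed
  also have "\<dots> \<le> ?N * ((1 + ?N) * (C * (2 * ?N * ?d)) * ?d)"
    using fd N0 C0 by (intro mult_left_mono) auto
  finally have 1: "norm (\<Sum>y\<in>UNIV. (fst z' - fst z) $ y *\<^sub>R gen y (\<beta> y (?p' y) - \<beta> y (?p y)))
      \<le> ?N * ((1 + ?N) * (C * (2 * ?N * ?d)) * ?d)" .
  have 2: "norm (\<Sum>y\<in>UNIV. fst z $ y *\<^sub>R gen y (\<beta> y (?p' y) - \<beta> y (?p y) + B2 y (?p y) (?p' y - ?p y)))
      \<le> (1 + ?N) * (C * (2 * ?N * ?d)\<^sup>2)"
  proof (rule order_trans[OF norm_weighted_sum_le[OF P]], rule weighted_mean_le[OF P])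
    fix y
    have "norm (\<beta> y (?p' y) - \<beta> y (?p y) + B2 y (?p y) (?p' y - ?p y)) \<le> C * (norm (?p' y - ?p y))\<^sup>2"
      by (rule \<beta>_expand[OF K])
    also have "\<dots> \<le> C * (2 * ?N * ?d)\<^sup>2" using dd C0 by (intro mult_left_mono power_mono) auto
    finally show "norm (gen y (\<beta> y (?p' y) - \<beta> y (?p y) + B2 y (?p y) (?p' y - ?p y))) \<le> (1 + ?N) * (C * (2 * ?N * ?d)\<^sup>2)"
      using norm_gen_le[of y "\<beta> y (?p' y) - \<beta> y (?p y) + B2 y (?p y) (?p' y - ?p y)"] N0
      by (meson add_nonneg_nonneg mult_left_mono order_trans zero_le_one)
  qed
  have "?N * ((1 + ?N) * (C * (2 * ?N * ?d)) * ?d) + (1 + ?N) * (C * (2 * ?N * ?d)\<^sup>2)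
      = 6 * ?N * ?N * (1 + ?N) * C * ?d\<^sup>2" by (simp add: power2_eq_square algebra_simps)
  also have "\<dots> \<le> 8 * ?N * ?N * (1 + ?N) * C * ?d\<^sup>2"
    using N0 C0 by (intro mult_right_mono) auto
  also have "\<dots> \<le> CA * ?d\<^sup>2" by (intro mult_right_mono CA_ge) auto
  finally show ?thesis unfolding eq using 1 2 by (intro norm_triangle_le) linarith
qed

lemma ham_expand:
  assumes z: "good z" and z': "good z'"
  shows "norm (ham (fst z') (snd z') - ham (fst z) (snd z) - lin_ham z (z' - z)) \<le> CA * (norm (z' - z))\<^sup>2"
proof -
  let ?p = "\<lambda>y. dl (snd z) y" and ?p' = "\<lambda>y. dl (snd z') y" and ?d = "norm (z' - z)"
  let ?N = "real CARD('d)"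
  have P: "fst z \<in> simplex_P" "fst z' \<in> simplex_P" and K: "norm (?p y) \<le> K" "norm (?p' y) \<le> K" for y
    using z z' by (auto simp: good_def)
  have fd: "norm (fst z' - fst z) \<le> ?d" and sd: "norm (snd z' - snd z) \<le> ?d"
    using norm_fst_le'[of "z' - z"] norm_snd_le'[of "z' - z"] by auto
  have dd: "norm (?p' y - ?p y) \<le> 2 * ?N * ?d" for y
    using norm_dl_mono[OF sd, of y] by (simp add: dl_diff)
  have "norm (ham (fst z') (snd z') - ham (fst z) (snd z) - lin_ham z (z' - z)) \<le> ?N * (C * (2 * ?N * ?d)\<^sup>2 + C * ?d\<^sup>2)"
  proof (rule norm_le_card_mult)
    fix x
    have "C * (norm (?p' x - ?p x))\<^sup>2 \<le> C * (2 * ?N * ?d)\<^sup>2" using dd C0 by (intro mult_left_mono power_mono) auto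
    then have 1: "\<bar>H x (?p' x) - H x (?p x) + \<beta> x (?p x) \<bullet> (?p' x - ?p x)\<bar> \<le> C * (2 * ?N * ?d)\<^sup>2"
      using H_expand[OF K, of x x x] by linarith
    have "C * (norm (fst z' - fst z))\<^sup>2 \<le> C * ?d\<^sup>2" using fd C0 by (intro mult_left_mono power_mono) auto
    then have 2: "\<bar>F x (fst z') - F x (fst z) - AF x (fst z) \<bullet> (fst z' - fst z)\<bar> \<le> C * ?d\<^sup>2"
      using F_gradD(2)[OF P, of x] by linarith
    have "(ham (fst z') (snd z') - ham (fst z) (snd z) - lin_ham z (z' - z)) $ x
        = (H x (?p' x) - H x (?p x) + \<beta> x (?p x) \<bullet> (?p' x - ?p x)) - (F x (fst z') - F x (fst z) - AF x (fst z) \<bullet> (fst z' - fst z))"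
      by (simp add: ham_def lin_ham_def dl_diff)
    then show "\<bar>(ham (fst z') (snd z') - ham (fst z) (snd z) - lin_ham z (z' - z)) $ x\<bar> \<le> C * (2 * ?N * ?d)\<^sup>2 + C * ?d\<^sup>2"
      using 1 2 by linarith
  qed
  also have "\<dots> = ?N * (4 * ?N * ?N * C + C) * ?d\<^sup>2" by (simp add: power2_eq_square algebra_simps)
  also have "\<dots> \<le> CA * ?d\<^sup>2" by (intro mult_right_mono CA_ge) auto
  finally show ?thesis .
qed

lemma fin_expand:
  assumes P: "m \<in> simplex_P" "m' \<in> simplex_P"
  shows "norm (fin m' - fin m - lin_fin m (m' - m)) \<le> CA * (norm (m' - m))\<^sup>2"
proof -
  have "norm (fin m' - fin m - lin_fin m (m' - m)) \<le> real CARD('d) * (C * (norm (m' - m))\<^sup>2)"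
    by (rule norm_le_card_mult) (use G_gradD(2)[OF P] in \<open>simp add: fin_def lin_fin_def\<close>)
  also have "\<dots> = real CARD('d) * C * (norm (m' - m))\<^sup>2" by simp
  also have "\<dots> \<le> CA * (norm (m' - m))\<^sup>2" by (intro mult_right_mono CA_ge) auto
  finally show ?thesis .
qed

lemma lin_drift_lip:
  assumes z: "good z" and z': "good z'"
  shows "norm (lin_drift z w - lin_drift z' w) \<le> CA * norm (z - z') * norm w"
proof -
  let ?p = "\<lambda>y. dl (snd z) y" and ?q = "\<lambda>y. dl (snd z') y" and ?d = "norm (z - z')" and ?h = "\<lambda>y. dl (snd w) y"
  let ?N = "real CARD('d)"
  have P: "fst z \<in> simplex_P" and K: "norm (?p y) \<le> K" "norm (?q y) \<le> K" for y
    using z z' by (auto simp: good_def)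
  have fd: "norm (fst z - fst z') \<le> ?d" and sd: "norm (snd z - snd z') \<le> ?d"
    using norm_fst_le'[of "z - z'"] norm_snd_le'[of "z - z'"] by auto
  have dd: "norm (?p y - ?q y) \<le> 2 * ?N * ?d" for y
    using norm_dl_mono[OF sd, of y] by (simp add: dl_diff)
  have hd: "norm (?h y) \<le> 2 * ?N * norm w" for y
    by (rule norm_dl_mono[OF norm_snd_le'])
  have g: "norm (gen y v) \<le> (1 + ?N) * b" if "norm v \<le> b" for y :: 'd and v b
    using norm_gen_le[of y v] that N0 by (meson add_nonneg_nonneg mult_left_mono order_trans zero_le_one)
  have eq: "lin_drift z w - lin_drift z' w
      = (\<Sum>y\<in>UNIV. fst w $ y *\<^sub>R gen y (\<beta> y (?p y) - \<beta> y (?q y)))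
      - ((\<Sum>y\<in>UNIV. (fst z - fst z') $ y *\<^sub>R gen y (B2 y (?q y) (?h y)))
      + (\<Sum>y\<in>UNIV. fst z $ y *\<^sub>R gen y (B2 y (?p y) (?h y) - B2 y (?q y) (?h y))))"
    by (simp add: lin_drift_def linear_diff[OF gen_linear]
        sum.distrib[symmetric] sum_subtractf[symmetric] algebra_simps)
  have 1: "norm (\<Sum>y\<in>UNIV. fst w $ y *\<^sub>R gen y (\<beta> y (?p y) - \<beta> y (?q y)))
      \<le> ?N * ((1 + ?N) * (C * (2 * ?N * ?d)) * norm (fst w))"
  proof (rule norm_component_sum_le, rule g)
    fix y
    show "norm (\<beta> y (?p y) - \<beta> y (?q y)) \<le> C * (2 * ?N * ?d)"
      using \<beta>_lip[of y "?p y" "?q y"] mult_left_mono[OF dd[of y] C0] by linarith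
  qed
  have 2: "norm (\<Sum>y\<in>UNIV. (fst z - fst z') $ y *\<^sub>R gen y (B2 y (?q y) (?h y)))
      \<le> ?N * ((1 + ?N) * (C * (2 * ?N * norm w)) * norm (fst z - fst z'))"
  proof (rule norm_component_sum_le, rule g)
    fix y
    show "norm (B2 y (?q y) (?h y)) \<le> C * (2 * ?N * norm w)"
      using B2_bound[OF K(2)[of y], where x = y and h = "?h y"] mult_left_mono[OF hd[of y] C0] by linarith
  qed
  have 3: "norm (\<Sum>y\<in>UNIV. fst z $ y *\<^sub>R gen y (B2 y (?p y) (?h y) - B2 y (?q y) (?h y)))
      \<le> (1 + ?N) * (C * (2 * ?N * ?d) * (2 * ?N * norm w))"
  proof (rule order_trans[OF norm_weighted_sum_le[OF P]], rule weighted_mean_le[OF P], rule g)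
    fix y
    have "C * norm (?p y - ?q y) * norm (?h y) \<le> C * (2 * ?N * ?d) * (2 * ?N * norm w)"
      using dd hd C0 N0 by (intro mult_mono) auto
    then show "norm (B2 y (?p y) (?h y) - B2 y (?q y) (?h y)) \<le> C * (2 * ?N * ?d) * (2 * ?N * norm w)"
      using B2_lip[OF K(1)[of y] K(2)[of y], where x = y and h = "?h y"] by linarith
  qed
  have "?N * ((1 + ?N) * (C * (2 * ?N * ?d)) * norm (fst w)) \<le> ?N * ((1 + ?N) * (C * (2 * ?N * ?d)) * norm w)"
    using norm_fst_le'[of w] N0 C0 by (intro mult_left_mono) auto
  moreover have "?N * ((1 + ?N) * (C * (2 * ?N * norm w)) * norm (fst z - fst z')) \<le> ?N * ((1 + ?N) * (C * (2 * ?N * norm w)) * ?d)"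
    using fd N0 C0 by (intro mult_left_mono) auto
  moreover have "?N * ((1 + ?N) * (C * (2 * ?N * ?d)) * norm w) + (?N * ((1 + ?N) * (C * (2 * ?N * norm w)) * ?d)
      + (1 + ?N) * (C * (2 * ?N * ?d) * (2 * ?N * norm w))) = 8 * ?N * ?N * (1 + ?N) * C * (?d * norm w)"
    by (simp add: algebra_simps)
  moreover have "8 * ?N * ?N * (1 + ?N) * C * (?d * norm w) \<le> CA * (?d * norm w)"
    by (intro mult_right_mono CA_ge) auto
  moreover have "norm (a - (b + c)) \<le> norm a + (norm b + norm c)" for a b c :: "real^'d"
    using norm_triangle_ineq4[of a "b + c"] norm_triangle_ineq[of b c] by linarith
  ultimately show ?thesis unfolding eq using 1 2 3 by (smt (verit) mult.assoc)
qed

lemma lin_ham_lip: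
  assumes z: "good z" and z': "good z'"
  shows "norm (lin_ham z w - lin_ham z' w) \<le> CA * norm (z - z') * norm w"
proof -
  let ?p = "\<lambda>y. dl (snd z) y" and ?q = "\<lambda>y. dl (snd z') y" and ?d = "norm (z - z')" and ?h = "\<lambda>y. dl (snd w) y"
  let ?N = "real CARD('d)"
  have P: "fst z \<in> simplex_P" "fst z' \<in> simplex_P" using z z' by (auto simp: good_def)
  have fd: "norm (fst z - fst z') \<le> ?d" and sd: "norm (snd z - snd z') \<le> ?d"
    using norm_fst_le'[of "z - z'"] norm_snd_le'[of "z - z'"] by auto
  have dd: "norm (?p y - ?q y) \<le> 2 * ?N * ?d" for y
    using norm_dl_mono[OF sd, of y] by (simp add: dl_diff)
  have hd: "norm (?h y) \<le> 2 * ?N * norm w" for y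
    by (rule norm_dl_mono[OF norm_snd_le'])
  have "norm (lin_ham z w - lin_ham z' w) \<le> ?N * ((C * (2 * ?N * ?d)) * (2 * ?N * norm w) + (C * ?d) * norm w)"
  proof (rule norm_le_card_mult)
    fix x
    have "\<bar>(\<beta> x (?p x) - \<beta> x (?q x)) \<bullet> ?h x\<bar> \<le> norm (\<beta> x (?p x) - \<beta> x (?q x)) * norm (?h x)"
      by (rule Cauchy_Schwarz_ineq2)
    also have "\<dots> \<le> (C * (2 * ?N * ?d)) * (2 * ?N * norm w)"
    proof (intro mult_mono hd)
      show "norm (\<beta> x (?p x) - \<beta> x (?q x)) \<le> C * (2 * ?N * ?d)"
        using \<beta>_lip[of x "?p x" "?q x"] mult_left_mono[OF dd[of x] C0] by linarith
    qed (use C0 in auto)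
    finally have 1: "\<bar>(\<beta> x (?p x) - \<beta> x (?q x)) \<bullet> ?h x\<bar> \<le> (C * (2 * ?N * ?d)) * (2 * ?N * norm w)" .
    have "\<bar>(AF x (fst z) - AF x (fst z')) \<bullet> fst w\<bar> \<le> norm (AF x (fst z) - AF x (fst z')) * norm (fst w)"
      by (rule Cauchy_Schwarz_ineq2)
    also have "\<dots> \<le> (C * ?d) * norm w"
    proof (intro mult_mono norm_fst_le')
      show "norm (AF x (fst z) - AF x (fst z')) \<le> C * ?d"
        using F_gradD(1)[OF P, of x] mult_left_mono[OF fd C0] by linarith
    qed (use C0 in auto)
    finally have 2: "\<bar>(AF x (fst z) - AF x (fst z')) \<bullet> fst w\<bar> \<le> (C * ?d) * norm w" .
    have "(lin_ham z w - lin_ham z' w) $ x = - ((\<beta> x (?p x) - \<beta> x (?q x)) \<bullet> ?h x) - (AF x (fst z) - AF x (fst z')) \<bullet> fst w"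
      by (simp add: lin_ham_def inner_diff_left)
    then show "\<bar>(lin_ham z w - lin_ham z' w) $ x\<bar> \<le> (C * (2 * ?N * ?d)) * (2 * ?N * norm w) + (C * ?d) * norm w"
      using 1 2 by linarith
  qed
  also have "\<dots> = ?N * (4 * ?N * ?N * C + C) * (?d * norm w)" by (simp add: algebra_simps)
  also have "\<dots> \<le> CA * (?d * norm w)" by (intro mult_right_mono CA_ge) auto
  finally show ?thesis by simp
qed

lemma lin_fin_lip:
  assumes P: "m \<in> simplex_P" "m' \<in> simplex_P"
  shows "norm (lin_fin m \<rho> - lin_fin m' \<rho>) \<le> CA * norm (m - m') * norm \<rho>"
proof -
  have "norm (lin_fin m \<rho> - lin_fin m' \<rho>) \<le> real CARD('d) * (C * norm (m - m') * norm \<rho>)"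
  proof (rule norm_le_card_mult)
    fix x
    have "\<bar>(AG x m - AG x m') \<bullet> \<rho>\<bar> \<le> norm (AG x m - AG x m') * norm \<rho>" by (rule Cauchy_Schwarz_ineq2)
    also have "\<dots> \<le> C * norm (m - m') * norm \<rho>" by (intro mult_right_mono G_gradD(1)[OF P]) auto
    finally show "\<bar>(lin_fin m \<rho> - lin_fin m' \<rho>) $ x\<bar> \<le> C * norm (m - m') * norm \<rho>"
      by (simp add: lin_fin_def inner_diff_left)
  qed
  also have "\<dots> = real CARD('d) * C * (norm (m - m') * norm \<rho>)" by simp
  also have "\<dots> \<le> CA * (norm (m - m') * norm \<rho>)" by (intro mult_right_mono CA_ge) auto
  finally show ?thesis by simp
qed

lemma lin_drift_bound:
  assumes z: "good z"
  shows "norm (lin_drift z (\<rho>, v)) \<le> CA * (norm \<rho> + spread (fst z) v)"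
proof -
  let ?p = "\<lambda>y. dl (snd z) y" and ?N = "real CARD('d)"
  have P: "fst z \<in> simplex_P" and K: "norm (?p y) \<le> K" for y using z by (auto simp: good_def)
  have 1: "norm (\<Sum>y\<in>UNIV. \<rho> $ y *\<^sub>R gen y (\<beta> y (?p y))) \<le> ?N * ((1 + ?N) * C * norm \<rho>)"
    by (rule norm_component_sum_le) (rule norm_gen_\<beta>_le)
  have "norm (\<Sum>y\<in>UNIV. fst z $ y *\<^sub>R gen y (B2 y (?p y) (dl v y)))
      \<le> (\<Sum>y\<in>UNIV. fst z $ y * norm (gen y (B2 y (?p y) (dl v y))))" by (rule norm_weighted_sum_le[OF P])
  also have "\<dots> \<le> (\<Sum>y\<in>UNIV. fst z $ y * ((1 + ?N) * (C * norm (dl v y))))"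
  proof (intro sum_mono mult_left_mono simplex_P_nonneg[OF P])
    fix y
    show "norm (gen y (B2 y (?p y) (dl v y))) \<le> (1 + ?N) * (C * norm (dl v y))"
      using norm_gen_le[of y "B2 y (?p y) (dl v y)"] B2_bound[OF K, of y y "dl v y"] N0
      by (meson add_nonneg_nonneg mult_left_mono order_trans zero_le_one)
  qed
  also have "\<dots> = (1 + ?N) * C * spread (fst z) v" by (simp add: spread_def sum_distrib_left mult_ac)
  also have "\<dots> \<le> CA * spread (fst z) v" by (intro mult_right_mono CA_ge spread_nonneg P)
  finally have 2: "norm (\<Sum>y\<in>UNIV. fst z $ y *\<^sub>R gen y (B2 y (?p y) (dl v y))) \<le> CA * spread (fst z) v" .
  have "?N * ((1 + ?N) * C * norm \<rho>) = ?N * ((1 + ?N) * C) * norm \<rho>" by simp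
  also have "\<dots> \<le> CA * norm \<rho>" by (intro mult_right_mono CA_ge) auto
  finally show ?thesis using 1 2 norm_triangle_ineq4[of "\<Sum>y\<in>UNIV. \<rho> $ y *\<^sub>R gen y (\<beta> y (?p y))" "\<Sum>y\<in>UNIV. fst z $ y *\<^sub>R gen y (B2 y (?p y) (dl v y))"]
    by (simp add: lin_drift_def distrib_left)
qed

lemma lin_ham_bound:
  assumes z: "good z"
  shows "norm (lin_ham z (\<rho>, v)) \<le> CA * (norm v + norm \<rho>)"
proof -
  let ?p = "\<lambda>y. dl (snd z) y" and ?N = "real CARD('d)"
  have P: "fst z \<in> simplex_P" using z by (auto simp: good_def)
  have "norm (lin_ham z (\<rho>, v)) \<le> ?N * (C * (2 * ?N * norm v) + C * norm \<rho>)"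
  proof (rule norm_le_card_mult)
    fix x
    have "\<bar>\<beta> x (?p x) \<bullet> dl v x\<bar> \<le> norm (\<beta> x (?p x)) * norm (dl v x)" by (rule Cauchy_Schwarz_ineq2)
    also have "\<dots> \<le> C * (2 * ?N * norm v)" by (intro mult_mono \<beta>_bound norm_dl_le) (use C0 in auto)
    finally have 1: "\<bar>\<beta> x (?p x) \<bullet> dl v x\<bar> \<le> C * (2 * ?N * norm v)" .
    have "\<bar>AF x (fst z) \<bullet> \<rho>\<bar> \<le> norm (AF x (fst z)) * norm \<rho>" by (rule Cauchy_Schwarz_ineq2)
    also have "\<dots> \<le> C * norm \<rho>" by (intro mult_right_mono AF_bound P) auto
    finally show "\<bar>lin_ham z (\<rho>, v) $ x\<bar> \<le> C * (2 * ?N * norm v) + C * norm \<rho>"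
      using 1 by (simp add: lin_ham_def)
  qed
  also have "\<dots> \<le> ?N * ((2 * ?N * C + C) * (norm v + norm \<rho>))"
    using N0 C0 by (intro mult_left_mono) (auto simp: algebra_simps)
  also have "\<dots> = ?N * (2 * ?N * C + C) * (norm v + norm \<rho>)" by simp
  also have "\<dots> \<le> CA * (norm v + norm \<rho>)" by (intro mult_right_mono CA_ge) auto
  finally show ?thesis .
qed

lemma lin_fin_bound:
  assumes P: "m \<in> simplex_P"
  shows "norm (lin_fin m \<rho>) \<le> CA * norm \<rho>"
proof -
  have "norm (lin_fin m \<rho>) \<le> real CARD('d) * (C * norm \<rho>)"
  proof (rule norm_le_card_mult)
    fix x
    have "\<bar>AG x m \<bullet> \<rho>\<bar> \<le> norm (AG x m) * norm \<rho>" by (rule Cauchy_Schwarz_ineq2)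
    also have "\<dots> \<le> C * norm \<rho>" by (intro mult_right_mono AG_bound P) auto
    finally show "\<bar>lin_fin m \<rho> $ x\<bar> \<le> C * norm \<rho>" by (simp add: lin_fin_def)
  qed
  also have "\<dots> = real CARD('d) * C * norm \<rho>" by simp
  also have "\<dots> \<le> CA * norm \<rho>" by (intro mult_right_mono CA_ge) auto
  finally show ?thesis .
qed

text \<open>The terms with \<open>\<beta>\<close> cancel by the duality of generator and finite
  difference. What remains is the Hessian of \<open>H\<close> weighted by the mass and the
  derivative of the cost along \<open>\<rho>\<close>, whose sign is infinitesimal monotonicity and
  therefore asks for a direction of zero total.\<close>

lemma lin_dissipation:
  assumes z: "good z" and \<rho>: "(\<Sum>j\<in>UNIV. \<rho> $ j) = 0"
  shows "lin_ham z (\<rho>, v) \<bullet> \<rho> + v \<bullet> lin_drift z (\<rho>, v) \<le> - c * (spread (fst z) v)\<^sup>2"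
proof -
  let ?p = "\<lambda>y. dl (snd z) y"
  have P: "fst z \<in> simplex_P" and K: "norm (?p y) \<le> K" for y using z by (auto simp: good_def)
  have "lin_ham z (\<rho>, v) \<bullet> \<rho> + v \<bullet> lin_drift z (\<rho>, v)
      = - (\<Sum>x\<in>UNIV. (AF x (fst z) \<bullet> \<rho>) * \<rho> $ x) - (\<Sum>y\<in>UNIV. fst z $ y * (dl v y \<bullet> B2 y (?p y) (dl v y)))"
    unfolding lin_drift_def inner_diff_right inner_sum_right inner_vec_def[of "lin_ham z (\<rho>, v)"]
      sum_subtractf[symmetric] sum.distrib[symmetric] sum_negf[symmetric]
    by (intro sum.cong refl) (simp add: lin_ham_def inner_gen inner_commute algebra_simps)
  also have "\<dots> \<le> - (\<Sum>y\<in>UNIV. fst z $ y * (dl v y \<bullet> B2 y (?p y) (dl v y)))"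
    using Mon_gradient_nonneg[OF MonF F_grad P \<rho>] by simp
  also have "\<dots> \<le> - (\<Sum>y\<in>UNIV. fst z $ y * (c * (norm (dl v y))\<^sup>2))"
    by (intro le_imp_neg_le sum_mono mult_left_mono B2_pos K simplex_P_nonneg[OF P])
  also have "\<dots> = - (c * (\<Sum>y\<in>UNIV. fst z $ y * (norm (dl v y))\<^sup>2))"
    by (simp add: sum_distrib_left mult_ac)
  also have "\<dots> \<le> - (c * (spread (fst z) v)\<^sup>2)"
    using mult_left_mono[OF spread_sq[OF P, of v], of c] c by simp
  finally show ?thesis by simp
qed

lemma lin_fin_nonneg:
  assumes "m \<in> simplex_P" "(\<Sum>j\<in>UNIV. \<rho> $ j) = 0"
  shows "0 \<le> lin_fin m \<rho> \<bullet> \<rho>"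
  using Mon_gradient_nonneg[OF MonG G_grad assms] by (simp add: lin_fin_def inner_vec_def)

section \<open>The decoupling field and its difference quotients\<close>

definition sol :: "real \<Rightarrow> real ^ 'd \<Rightarrow> (real \<Rightarrow> real ^ 'd) \<times> (real \<Rightarrow> real ^ 'd)" where
  "sol t m = (SOME p. mfg t (fst p) (snd p) \<and> fst p t = m)"

text \<open>The decoupling field of the forward-backward system, which is the candidate for the
  master equation. Uniqueness makes it independent of the choice in \<open>sol\<close>.\<close>

definition val :: "real \<Rightarrow> real ^ 'd \<Rightarrow> real ^ 'd" where
  "val t m = snd (sol t m) t"

lemma sol:
  assumes "0 \<le> t" "t \<le> T" "m \<in> simplex_P"
  shows "mfg t (fst (sol t m)) (snd (sol t m))" "fst (sol t m) t = m"
proof -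
  have "\<exists>p. mfg t (fst p) (snd p) \<and> fst p t = m" using mfg_exists[OF assms] by auto
  from someI_ex[OF this] show "mfg t (fst (sol t m)) (snd (sol t m))" "fst (sol t m) t = m"
    by (auto simp: sol_def)
qed

lemma mfg_restrict:
  assumes "mfg t0 m u" "t0 \<le> t"
  shows "mfg t m u"
  unfolding mfg_def
proof (intro conjI ballI)
  fix s assume s: "s \<in> {t..T}"
  then have s': "s \<in> {t0..T}" using assms(2) by auto
  show "m s \<in> simplex_P" by (rule mfgD(1)[OF assms(1) s'])
  show "(m has_vector_derivative drift (m s) (u s)) (at s within {t..T})"
    by (rule has_vector_derivative_within_subset[OF mfgD(2)[OF assms(1) s']]) (use assms(2) in auto)
  show "(u has_vector_derivative ham (m s) (u s)) (at s within {t..T})"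
    by (rule has_vector_derivative_within_subset[OF mfgD(3)[OF assms(1) s']]) (use assms(2) in auto)
next
  show "u T = fin (m T)" by (rule mfg_fin[OF assms(1)])
qed

text \<open>Restricted to \<open>{t..T}\<close> the solution starts from \<open>m t\<close>, and
  uniqueness identifies it with the chosen one. This is the dynamic programming principle of the
  game.\<close>

lemma val_eq:
  assumes "mfg t0 m u" "0 \<le> t0" "t \<in> {t0..T}"
  shows "val t (m t) = u t"
proof -
  have t: "0 \<le> t" "t \<le> T" "t0 \<le> t" "t \<in> {t..T}" using assms by auto
  have P: "m t \<in> simplex_P" by (rule mfgD(1)[OF assms(1,3)])
  show ?thesis unfolding val_def
    by (rule mfg_unique(2)[OF t(1,2) sol(1)[OF t(1,2) P] mfg_restrict[OF assms(1) t(3)] sol(2)[OF t(1,2) P] t(4)])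
qed

lemma mfg_good:
  assumes "mfg t0 m u" "0 \<le> t0" "t0 \<le> T" "t \<in> {t0..T}"
  shows "good (m t, u t)"
  using mfgD(1)[OF assms(1,4)] mfg_dl_bound[OF assms] by (simp add: good_def)

lemma val_good:
  assumes "0 \<le> t" "t \<le> T" "m \<in> simplex_P"
  shows "good (m, val t m)"
  using mfg_good[OF sol(1)[OF assms] assms(1,2), of t] sol(2)[OF assms] assms by (simp add: val_def)

lemma val_fin: "m \<in> simplex_P \<Longrightarrow> val T m = fin m"
  using mfg_fin[OF sol(1), of T m] sol(2)[of T m] T by (simp add: val_def)

lemma val_lipschitz:
  "\<exists>\<Lambda>\<ge>0. \<forall>t m m'. 0 \<le> t \<longrightarrow> t \<le> T \<longrightarrow> m \<in> simplex_P \<longrightarrow> m' \<in> simplex_P \<longrightarrow>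
    norm (val t m - val t m') \<le> \<Lambda> * norm (m - m')"
proof -
  obtain \<Lambda> where \<Lambda>: "0 \<le> \<Lambda>" and lip: "\<forall>t0 m u m' u'. 0 \<le> t0 \<longrightarrow> t0 \<le> T \<longrightarrow> mfg t0 m u \<longrightarrow> mfg t0 m' u' \<longrightarrow>
     (\<forall>t\<in>{t0..T}. norm (m t - m' t) \<le> \<Lambda> * norm (m t0 - m' t0) \<and> norm (u t - u' t) \<le> \<Lambda> * norm (m t0 - m' t0))"
    using mfg_lipschitz by blast
  have "norm (val t m - val t m') \<le> \<Lambda> * norm (m - m')"
    if t: "0 \<le> t" "t \<le> T" and P: "m \<in> simplex_P" "m' \<in> simplex_P" for t m m'
    using lip[rule_format, OF t sol(1)[OF t P(1)] sol(1)[OF t P(2)], of t] sol(2)[OF t] P t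
    by (simp add: val_def)
  then show ?thesis using \<Lambda> by blast
qed

text \<open>Both quotients belong to the same direction \<open>e\<close>, so the difference of the
  two quotients of distributions vanishes at the initial time and the stability estimate leaves
  nothing but the error term. That error consists of the quadratic remainders, of the order of the
  steps, and of the change of coefficients between the two base trajectories, of the order of
  \<open>norm (a - a')\<close>.\<close>

lemma quotient_stability:
  "\<exists>Q\<ge>0. \<forall>t0 a a' s s' e. 0 \<le> t0 \<longrightarrow> t0 \<le> T \<longrightarrow> a \<in> simplex_P \<longrightarrow> a' \<in> simplex_P \<longrightarrow> 0 < s \<longrightarrow> 0 < s' \<longrightarrow>
     a + s *\<^sub>R e \<in> simplex_P \<longrightarrow> a' + s' *\<^sub>R e \<in> simplex_P \<longrightarrow> norm e \<le> 2 \<longrightarrow>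
     norm ((1 / s) *\<^sub>R (val t0 (a + s *\<^sub>R e) - val t0 a) - (1 / s') *\<^sub>R (val t0 (a' + s' *\<^sub>R e) - val t0 a'))
       \<le> Q * (norm (a - a') + s + s')"
proof -
  obtain \<Lambda> where \<Lambda>: "0 \<le> \<Lambda>" and lip: "\<forall>t0 m u m' u'. 0 \<le> t0 \<longrightarrow> t0 \<le> T \<longrightarrow> mfg t0 m u \<longrightarrow> mfg t0 m' u' \<longrightarrow>
     (\<forall>t\<in>{t0..T}. norm (m t - m' t) \<le> \<Lambda> * norm (m t0 - m' t0) \<and> norm (u t - u' t) \<le> \<Lambda> * norm (m t0 - m' t0))"
    using mfg_lipschitz by blast
  \<comment> \<open>The summand \<open>CA\<close> bounds the linearized coefficients. In the other
    one, 16 is the square of 4 in the bound \<open>4 * \<Lambda>\<close> for a quotient of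
    pairs.\<close>
  define Q where "Q = CA * (1 + 16 * \<Lambda>\<^sup>2)"
  have Q0: "0 \<le> Q" and CAQ: "CA \<le> Q" "16 * CA * \<Lambda>\<^sup>2 \<le> Q" using CA_ge(7) by (auto simp: Q_def algebra_simps)
  obtain C' where C': "C' \<ge> 0" and stab: "\<forall>a b (\<rho> :: real \<Rightarrow> real^'d) \<rho>' v v' r \<epsilon>.
    a \<le> b \<longrightarrow> b - a \<le> T \<longrightarrow> 0 \<le> \<epsilon> \<longrightarrow>
    (\<forall>t\<in>{a..b}. (\<rho> has_vector_derivative \<rho>' t) (at t within {a..b}) \<and>
       (v has_vector_derivative v' t) (at t within {a..b}) \<and>
       norm (\<rho>' t) \<le> Q * (norm (\<rho> t) + r t + \<epsilon>) \<and>
       norm (v' t) \<le> Q * (norm (v t) + norm (\<rho> t) + \<epsilon>) \<and>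
       v' t \<bullet> \<rho> t + v t \<bullet> \<rho>' t \<le> - c * (r t)\<^sup>2 + Q * \<epsilon> * (norm (v t) + norm (\<rho> t))) \<longrightarrow>
    norm (v b) \<le> Q * (norm (\<rho> b) + \<epsilon>) \<longrightarrow> - (Q * \<epsilon> * norm (\<rho> b)) \<le> v b \<bullet> \<rho> b \<longrightarrow>
    (\<forall>t\<in>{a..b}. norm (\<rho> t) \<le> C' * (norm (\<rho> a) + \<epsilon>) \<and> norm (v t) \<le> C' * (norm (\<rho> a) + \<epsilon>))"
    using forward_backward_stability[OF Q0 c less_imp_le[OF T]] by blast
  have main: "norm ((1 / s) *\<^sub>R (val t0 (a + s *\<^sub>R e) - val t0 a) - (1 / s') *\<^sub>R (val t0 (a' + s' *\<^sub>R e) - val t0 a'))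
       \<le> C' * (norm (a - a') + s + s')"
    if t0: "0 \<le> t0" "t0 \<le> T" and P: "a \<in> simplex_P" "a' \<in> simplex_P" and s: "0 < s" "0 < s'"
      and P': "a + s *\<^sub>R e \<in> simplex_P" "a' + s' *\<^sub>R e \<in> simplex_P" and e: "norm e \<le> 2"
    for t0 a a' s s' e
  proof -
    define m1 u1 where "m1 = fst (sol t0 a)" and "u1 = snd (sol t0 a)"
    define m2 u2 where "m2 = fst (sol t0 a')" and "u2 = snd (sol t0 a')"
    define n1 w1 where "n1 = fst (sol t0 (a + s *\<^sub>R e))" and "w1 = snd (sol t0 (a + s *\<^sub>R e))"
    define n2 w2 where "n2 = fst (sol t0 (a' + s' *\<^sub>R e))" and "w2 = snd (sol t0 (a' + s' *\<^sub>R e))"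
    have mf: "mfg t0 m1 u1" "mfg t0 m2 u2" "mfg t0 n1 w1" "mfg t0 n2 w2"
      and ini: "m1 t0 = a" "m2 t0 = a'" "n1 t0 = a + s *\<^sub>R e" "n2 t0 = a' + s' *\<^sub>R e"
      using sol[OF t0 P(1)] sol[OF t0 P(2)] sol[OF t0 P'(1)] sol[OF t0 P'(2)]
      by (auto simp: m1_def u1_def m2_def u2_def n1_def w1_def n2_def w2_def)
    define \<eta> where "\<eta> = norm (a - a') + s + s'"
    have \<eta>0: "0 \<le> \<eta>" using s by (simp add: \<eta>_def)
    define \<rho>1 where "\<rho>1 t = (1 / s) *\<^sub>R (n1 t - m1 t)" for t
    define \<rho>2 where "\<rho>2 t = (1 / s') *\<^sub>R (n2 t - m2 t)" for t
    define v1 where "v1 t = (1 / s) *\<^sub>R (w1 t - u1 t)" for t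
    define v2 where "v2 t = (1 / s') *\<^sub>R (w2 t - u2 t)" for t
    \<comment> \<open>Stability bounds increments by \<open>\<Lambda>\<close> times the initial
      displacement, which has norm at most \<open>2 * s\<close>; dividing by the step leaves
      \<open>2 * \<Lambda>\<close>.\<close>
    have sz: "norm (\<rho>1 t) \<le> 2 * \<Lambda>" "norm (v1 t) \<le> 2 * \<Lambda>" "norm (\<rho>2 t) \<le> 2 * \<Lambda>" "norm (v2 t) \<le> 2 * \<Lambda>"
      if t: "t \<in> {t0..T}" for t
    proof -
      have q: "norm x / r \<le> 2 * \<Lambda>" if "0 < r" "norm x \<le> \<Lambda> * (r * norm e)" for r and x :: "real^'d"
      proof -
        have "norm x \<le> \<Lambda> * (r * 2)"
          using that mult_left_mono[OF mult_left_mono[OF e less_imp_le[OF that(1)]] \<Lambda>] by simp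
        then show ?thesis using that(1) by (simp add: pos_divide_le_eq mult_ac)
      qed
      show "norm (\<rho>1 t) \<le> 2 * \<Lambda>" "norm (v1 t) \<le> 2 * \<Lambda>" "norm (\<rho>2 t) \<le> 2 * \<Lambda>" "norm (v2 t) \<le> 2 * \<Lambda>"
        unfolding \<rho>1_def v1_def \<rho>2_def v2_def
        using lip[rule_format, OF t0 mf(3,1) t] lip[rule_format, OF t0 mf(4,2) t] s
        by (auto intro!: q simp: ini)
    qed
    define \<delta> where "\<delta> = 2 * \<Lambda> * norm (a - a')"
    have \<delta>0: "0 \<le> \<delta>" using \<Lambda> by (simp add: \<delta>_def)
    have near: "norm ((m1 t, u1 t) - (m2 t, u2 t)) \<le> \<delta>" "norm (m1 t - m2 t) \<le> \<delta>" if t: "t \<in> {t0..T}" for t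
    proof -
      have 1: "norm (m1 t - m2 t) \<le> \<Lambda> * norm (a - a')" "norm (u1 t - u2 t) \<le> \<Lambda> * norm (a - a')"
        using lip[rule_format, OF t0 mf(1,2) t] by (auto simp: ini)
      then show "norm ((m1 t, u1 t) - (m2 t, u2 t)) \<le> \<delta>"
        using norm_Pair_le[of "m1 t - m2 t" "u1 t - u2 t"] by (simp add: \<delta>_def)
      show "norm (m1 t - m2 t) \<le> \<delta>"
        using 1 mult_nonneg_nonneg[OF \<Lambda> norm_ge_zero[of "a - a'"]] unfolding \<delta>_def by linarith
    qed
    let ?\<rho> = "\<lambda>t. \<rho>1 t - \<rho>2 t" and ?v = "\<lambda>t. v1 t - v2 t"
    let ?\<rho>' = "\<lambda>t. (1 / s) *\<^sub>R (drift (n1 t) (w1 t) - drift (m1 t) (u1 t)) - (1 / s') *\<^sub>R (drift (n2 t) (w2 t) - drift (m2 t) (u2 t))"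
    let ?v' = "\<lambda>t. (1 / s) *\<^sub>R (ham (n1 t) (w1 t) - ham (m1 t) (u1 t)) - (1 / s') *\<^sub>R (ham (n2 t) (w2 t) - ham (m2 t) (u2 t))"
    have good: "good (m1 t, u1 t)" "good (m2 t, u2 t)" "good (n1 t, w1 t)" "good (n2 t, w2 t)" if "t \<in> {t0..T}" for t
      using mfg_good[OF mf(1) t0 that] mfg_good[OF mf(2) t0 that] mfg_good[OF mf(3) t0 that] mfg_good[OF mf(4) t0 that] by auto
    have w: "norm (\<rho>1 t, v1 t) \<le> 4 * \<Lambda>" "norm (\<rho>2 t, v2 t) \<le> 4 * \<Lambda>" if "t \<in> {t0..T}" for t
      using sz[OF that] norm_Pair_le[of "\<rho>1 t" "v1 t"] norm_Pair_le[of "\<rho>2 t" "v2 t"] by linarith+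
    have zz: "(n1 t, w1 t) - (m1 t, u1 t) = s *\<^sub>R (\<rho>1 t, v1 t)" "(n2 t, w2 t) - (m2 t, u2 t) = s' *\<^sub>R (\<rho>2 t, v2 t)" for t
      using s by (simp_all add: \<rho>1_def v1_def \<rho>2_def v2_def)
    have err: "CA * (4 * \<Lambda>)\<^sup>2 * (s + s') + CA * \<delta> * (4 * \<Lambda>) \<le> Q * \<eta>"
    proof -
      have "CA * (4 * \<Lambda>)\<^sup>2 * (s + s') + CA * \<delta> * (4 * \<Lambda>) = 16 * CA * \<Lambda>\<^sup>2 * (s + s') + 8 * CA * \<Lambda>\<^sup>2 * norm (a - a')"
        by (simp add: \<delta>_def power2_eq_square algebra_simps)
      also have "\<dots> \<le> 16 * CA * \<Lambda>\<^sup>2 * (s + s') + 16 * CA * \<Lambda>\<^sup>2 * norm (a - a')"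
        using CA_ge(7) by (intro add_left_mono mult_right_mono) auto
      also have "\<dots> = 16 * CA * \<Lambda>\<^sup>2 * \<eta>" by (simp add: \<eta>_def algebra_simps)
      also have "\<dots> \<le> Q * \<eta>" by (intro mult_right_mono CAQ \<eta>0)
      finally show ?thesis .
    qed
    have bd: "norm (\<rho>2 t, v2 t) * (CA * norm ((m1 t, u1 t) - (m2 t, u2 t))) \<le> norm (\<rho>2 t, v2 t) * (CA * \<delta>)" if "t \<in> {t0..T}" for t
      using near(1)[OF that] CA_ge(7) by (intro mult_left_mono) auto
    have ed: "norm (?\<rho>' t - lin_drift (m1 t, u1 t) (?\<rho> t, ?v t)) \<le> Q * \<eta>" if t: "t \<in> {t0..T}" for t
    proof -
      have "norm (?\<rho>' t - lin_drift (m1 t, u1 t) ((\<rho>1 t, v1 t) - (\<rho>2 t, v2 t)))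
          \<le> CA * (4 * \<Lambda>)\<^sup>2 * (s + s') + CA * \<delta> * (4 * \<Lambda>)"
      proof (rule quotient_linearization[OF linear_lin_drift linear_lin_drift s zz w[OF t] CA_ge(7) \<delta>0])
        show "norm (lin_drift (m1 t, u1 t) (\<rho>2 t, v2 t) - lin_drift (m2 t, u2 t) (\<rho>2 t, v2 t)) \<le> CA * \<delta> * norm (\<rho>2 t, v2 t)"
          using lin_drift_lip[OF good(1,2)[OF t], of "(\<rho>2 t, v2 t)"] bd[OF t] by (simp add: mult_ac)
      qed (use drift_expand[OF good(1,3)[OF t]] drift_expand[OF good(2,4)[OF t]] in simp_all)
      then show ?thesis using err by simp
    qed
    have eh: "norm (?v' t - lin_ham (m1 t, u1 t) (?\<rho> t, ?v t)) \<le> Q * \<eta>" if t: "t \<in> {t0..T}" for t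
    proof -
      have "norm (?v' t - lin_ham (m1 t, u1 t) ((\<rho>1 t, v1 t) - (\<rho>2 t, v2 t)))
          \<le> CA * (4 * \<Lambda>)\<^sup>2 * (s + s') + CA * \<delta> * (4 * \<Lambda>)"
      proof (rule quotient_linearization[OF linear_lin_ham linear_lin_ham s zz w[OF t] CA_ge(7) \<delta>0])
        show "norm (lin_ham (m1 t, u1 t) (\<rho>2 t, v2 t) - lin_ham (m2 t, u2 t) (\<rho>2 t, v2 t)) \<le> CA * \<delta> * norm (\<rho>2 t, v2 t)"
          using lin_ham_lip[OF good(1,2)[OF t], of "(\<rho>2 t, v2 t)"] bd[OF t] by (simp add: mult_ac)
      qed (use ham_expand[OF good(1,3)[OF t]] ham_expand[OF good(2,4)[OF t]] in simp_all)
      then show ?thesis using err by simp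
    qed
    have TT: "T \<in> {t0..T}" using t0 by simp
    have PT: "m1 T \<in> simplex_P" "m2 T \<in> simplex_P" "n1 T \<in> simplex_P" "n2 T \<in> simplex_P"
      using mfgD(1)[OF mf(1) TT] mfgD(1)[OF mf(2) TT] mfgD(1)[OF mf(3) TT] mfgD(1)[OF mf(4) TT] by auto
    have ef: "norm (?v T - lin_fin (m1 T) (?\<rho> T)) \<le> Q * \<eta>"
    proof -
      have "norm ((1 / s) *\<^sub>R (fin (n1 T) - fin (m1 T)) - (1 / s') *\<^sub>R (fin (n2 T) - fin (m2 T)) - lin_fin (m1 T) (\<rho>1 T - \<rho>2 T))
          \<le> CA * (4 * \<Lambda>)\<^sup>2 * (s + s') + CA * \<delta> * (4 * \<Lambda>)"
      proof (rule quotient_linearization[OF linear_lin_fin linear_lin_fin s _ _ _ _ CA_ge(7) \<delta>0])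
        show "n1 T - m1 T = s *\<^sub>R \<rho>1 T" "n2 T - m2 T = s' *\<^sub>R \<rho>2 T"
          using s by (simp_all add: \<rho>1_def \<rho>2_def)
        show "norm (\<rho>1 T) \<le> 4 * \<Lambda>" "norm (\<rho>2 T) \<le> 4 * \<Lambda>" using sz[OF TT] \<Lambda> by linarith+
        have "norm (\<rho>2 T) * (CA * norm (m1 T - m2 T)) \<le> norm (\<rho>2 T) * (CA * \<delta>)"
          using near(2)[OF TT] CA_ge(7) by (intro mult_left_mono) auto
        then show "norm (lin_fin (m1 T) (\<rho>2 T) - lin_fin (m2 T) (\<rho>2 T)) \<le> CA * \<delta> * norm (\<rho>2 T)"
          using lin_fin_lip[OF PT(1,2), of "\<rho>2 T"] by (simp add: mult_ac)
      qed (use fin_expand[OF PT(1,3)] fin_expand[OF PT(2,4)] in simp_all)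
      then show ?thesis using err
        by (simp add: v1_def v2_def mfg_fin[OF mf(1)] mfg_fin[OF mf(2)] mfg_fin[OF mf(3)] mfg_fin[OF mf(4)])
    qed
    \<comment> \<open>Differences of probability vectors have zero total, which admits the quotients
      to infinitesimal monotonicity.\<close>
    have sum0: "(\<Sum>j\<in>UNIV. ?\<rho> t $ j) = 0" if t: "t \<in> {t0..T}" for t
    proof -
      have "(\<Sum>j\<in>UNIV. \<rho>1 t $ j) = 0" "(\<Sum>j\<in>UNIV. \<rho>2 t $ j) = 0"
        using good[OF t] by (auto simp: \<rho>1_def \<rho>2_def good_def simplex_P_sum sum_subtractf sum_distrib_left[symmetric] sum_divide_distrib[symmetric])
      then show ?thesis by (simp add: sum_subtractf)
    qed
    have res: "\<forall>t\<in>{t0..T}. norm (?\<rho> t) \<le> C' * (norm (?\<rho> t0) + \<eta>) \<and> norm (?v t) \<le> C' * (norm (?\<rho> t0) + \<eta>)"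
    proof (rule stab[rule_format, where \<rho>' = ?\<rho>' and v' = ?v' and r = "\<lambda>t. spread (m1 t) (?v t)", THEN ballI, rotated -1])
      show "t0 \<le> T" "T - t0 \<le> T" "0 \<le> \<eta>" using t0 \<eta>0 by auto
    next
      fix t assume t: "t \<in> {t0..T}"
      have 1: "(?\<rho> has_vector_derivative ?\<rho>' t) (at t within {t0..T})"
        unfolding \<rho>1_def \<rho>2_def
        by (intro derivative_intros bounded_linear.has_vector_derivative[OF bounded_linear_scaleR_right] mfgD(2)[OF mf(1) t]
            mfgD(2)[OF mf(2) t] mfgD(2)[OF mf(3) t] mfgD(2)[OF mf(4) t])
      have 2: "(?v has_vector_derivative ?v' t) (at t within {t0..T})"
        unfolding v1_def v2_def
        by (intro derivative_intros bounded_linear.has_vector_derivative[OF bounded_linear_scaleR_right] mfgD(3)[OF mf(1) t]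
            mfgD(3)[OF mf(2) t] mfgD(3)[OF mf(3) t] mfgD(3)[OF mf(4) t])
      have sp: "0 \<le> spread (m1 t) (?v t)" using spread_nonneg good(1)[OF t] by (simp add: good_def)
      have tri: "norm x \<le> norm y + norm (x - y)" for x y :: "real^'d" by (rule norm_triangle_sub)
      have "CA * (norm (?\<rho> t) + spread (m1 t) (?v t)) \<le> Q * (norm (?\<rho> t) + spread (m1 t) (?v t))"
        using sp by (intro mult_right_mono CAQ) auto
      then have 3: "norm (?\<rho>' t) \<le> Q * (norm (?\<rho> t) + spread (m1 t) (?v t) + \<eta>)"
        using tri[of "?\<rho>' t" "lin_drift (m1 t, u1 t) (?\<rho> t, ?v t)"] ed[OF t] lin_drift_bound[OF good(1)[OF t], of "?\<rho> t" "?v t"]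
        unfolding fst_conv distrib_left[of Q _ \<eta>] by linarith
      have "CA * (norm (?v t) + norm (?\<rho> t)) \<le> Q * (norm (?v t) + norm (?\<rho> t))"
        by (intro mult_right_mono CAQ) auto
      then have 4: "norm (?v' t) \<le> Q * (norm (?v t) + norm (?\<rho> t) + \<eta>)"
        using tri[of "?v' t" "lin_ham (m1 t, u1 t) (?\<rho> t, ?v t)"] eh[OF t] lin_ham_bound[OF good(1)[OF t], of "?\<rho> t" "?v t"]
        unfolding distrib_left[of Q _ \<eta>] by linarith
      have "?v' t \<bullet> ?\<rho> t + ?v t \<bullet> ?\<rho>' t
          = (lin_ham (m1 t, u1 t) (?\<rho> t, ?v t) \<bullet> ?\<rho> t + ?v t \<bullet> lin_drift (m1 t, u1 t) (?\<rho> t, ?v t))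
          + (?v' t - lin_ham (m1 t, u1 t) (?\<rho> t, ?v t)) \<bullet> ?\<rho> t + ?v t \<bullet> (?\<rho>' t - lin_drift (m1 t, u1 t) (?\<rho> t, ?v t))"
        by (simp only: inner_diff_left[of "?v' t"] inner_diff_right[of _ "?\<rho>' t"])
      moreover have "(?v' t - lin_ham (m1 t, u1 t) (?\<rho> t, ?v t)) \<bullet> ?\<rho> t \<le> Q * \<eta> * norm (?\<rho> t)"
        by (rule order_trans[OF norm_cauchy_schwarz]) (rule mult_right_mono[OF eh[OF t] norm_ge_zero])
      moreover have "?v t \<bullet> (?\<rho>' t - lin_drift (m1 t, u1 t) (?\<rho> t, ?v t)) \<le> Q * \<eta> * norm (?v t)"
        by (subst inner_commute, rule order_trans[OF norm_cauchy_schwarz]) (rule mult_right_mono[OF ed[OF t] norm_ge_zero])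
      ultimately have 5: "?v' t \<bullet> ?\<rho> t + ?v t \<bullet> ?\<rho>' t \<le> - c * (spread (m1 t) (?v t))\<^sup>2 + Q * \<eta> * (norm (?v t) + norm (?\<rho> t))"
        using lin_dissipation[OF good(1)[OF t] sum0[OF t], of "?v t"]
        unfolding fst_conv distrib_left[of "Q * \<eta>"] by linarith
      show "(?\<rho> has_vector_derivative ?\<rho>' t) (at t within {t0..T}) \<and>
         (?v has_vector_derivative ?v' t) (at t within {t0..T}) \<and>
         norm (?\<rho>' t) \<le> Q * (norm (?\<rho> t) + spread (m1 t) (?v t) + \<eta>) \<and>
         norm (?v' t) \<le> Q * (norm (?v t) + norm (?\<rho> t) + \<eta>) \<and>
         ?v' t \<bullet> ?\<rho> t + ?v t \<bullet> ?\<rho>' t \<le> - c * (spread (m1 t) (?v t))\<^sup>2 + Q * \<eta> * (norm (?v t) + norm (?\<rho> t))"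
        using 1 2 3 4 5 by blast
    next
      have "CA * norm (?\<rho> T) \<le> Q * norm (?\<rho> T)" by (intro mult_right_mono CAQ) auto
      then show "norm (?v T) \<le> Q * (norm (?\<rho> T) + \<eta>)"
        using norm_triangle_sub[of "?v T" "lin_fin (m1 T) (?\<rho> T)"] ef lin_fin_bound[OF PT(1), of "?\<rho> T"]
        unfolding distrib_left by linarith
      have "- (?v T - lin_fin (m1 T) (?\<rho> T)) \<bullet> ?\<rho> T \<le> norm (- (?v T - lin_fin (m1 T) (?\<rho> T))) * norm (?\<rho> T)"
        by (rule norm_cauchy_schwarz)
      also have "\<dots> \<le> Q * \<eta> * norm (?\<rho> T)" unfolding norm_minus_cancel by (rule mult_right_mono[OF ef norm_ge_zero])
      finally have "- (?v T - lin_fin (m1 T) (?\<rho> T)) \<bullet> ?\<rho> T \<le> Q * \<eta> * norm (?\<rho> T)" .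
      moreover have "0 \<le> lin_fin (m1 T) (?\<rho> T) \<bullet> ?\<rho> T" by (rule lin_fin_nonneg[OF PT(1) sum0[OF TT]])
      ultimately show "- (Q * \<eta> * norm (?\<rho> T)) \<le> ?v T \<bullet> ?\<rho> T"
        unfolding inner_minus_left inner_diff_left[of "?v T"] by linarith
    qed
    \<comment> \<open>At the initial time both quotients of distributions equal
      \<open>e\<close>.\<close>
    have "?\<rho> t0 = 0" using s by (simp add: \<rho>1_def \<rho>2_def ini)
    then have "norm (?v t0) \<le> C' * \<eta>" using res t0 by simp
    then show ?thesis by (simp add: v1_def v2_def u1_def u2_def w1_def w2_def val_def \<eta>_def)
  qed
  then show ?thesis using C' by (intro exI[of _ C']) blast
qed

text \<open>The bound on the quotients is uniform in the initial time, so a single constant serves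
  all \<open>t\<close>; this uniformity becomes the regularity claim.\<close>

lemma val_gradient:
  "\<exists>Cg A. \<forall>t\<in>{0..T}. \<forall>x. simplex_gradient Cg (\<lambda>m. val t m $ x) (A t x)"
proof -
  obtain Q where Q: "0 \<le> Q" and quot: "\<And>t0 a a' s s' e. 0 \<le> t0 \<Longrightarrow> t0 \<le> T \<Longrightarrow> a \<in> simplex_P \<Longrightarrow> a' \<in> simplex_P \<Longrightarrow>
     0 < s \<Longrightarrow> 0 < s' \<Longrightarrow> a + s *\<^sub>R e \<in> simplex_P \<Longrightarrow> a' + s' *\<^sub>R e \<in> simplex_P \<Longrightarrow> norm e \<le> 2 \<Longrightarrow>
     norm ((1 / s) *\<^sub>R (val t0 (a + s *\<^sub>R e) - val t0 a) - (1 / s') *\<^sub>R (val t0 (a' + s' *\<^sub>R e) - val t0 a'))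
       \<le> Q * (norm (a - a') + s + s')"
    using quotient_stability by blast
  have "\<exists>A. simplex_gradient (4 * Q * real CARD('d) ^ 3) (\<lambda>m. val t m $ x) A" if t: "t \<in> {0..T}" for t x
  proof -
    have "\<exists>D. transfer_expansion Q (\<lambda>m. val t m $ x) D"
    proof (rule difference_quotients_expansion[OF Q])
      fix y z :: 'd and a a' :: "real^'d" and s s' :: real
      assume *: "a \<in> simplex_P" "a' \<in> simplex_P" "0 < s" "0 < s'"
        "a + s *\<^sub>R direction y z \<in> simplex_P" "a' + s' *\<^sub>R direction y z \<in> simplex_P"
      let ?d = "(1 / s) *\<^sub>R (val t (a + s *\<^sub>R direction y z) - val t a) - (1 / s') *\<^sub>R (val t (a' + s' *\<^sub>R direction y z) - val t a')"
      have "\<bar>?d $ x\<bar> \<le> norm ?d" by (rule component_le_norm_cart)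
      also have "\<dots> \<le> Q * (norm (a - a') + s + s')"
        by (rule quot) (use * t norm_direction_le in auto)
      finally show "\<bar>(val t (a + s *\<^sub>R direction y z) $ x - val t a $ x) / s - (val t (a' + s' *\<^sub>R direction y z) $ x - val t a' $ x) / s'\<bar>
          \<le> Q * (norm (a - a') + s + s')" by simp
    qed
    then show ?thesis using transfer_expansion_simplex_gradient by blast
  qed
  then have "\<forall>t x. \<exists>A. t \<in> {0..T} \<longrightarrow> simplex_gradient (4 * Q * real CARD('d) ^ 3) (\<lambda>m. val t m $ x) A" by blast
  then obtain A where "\<forall>t x. t \<in> {0..T} \<longrightarrow> simplex_gradient (4 * Q * real CARD('d) ^ 3) (\<lambda>m. val t m $ x) (A t x)"
    by metis
  then show ?thesis by blast
qed

end

section \<open>The master equation\<close>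

text \<open>The slope in the expansion is evaluated at the later of the two times. Approaching
  \<open>\<tau>\<close> from the left this is \<open>g \<tau>\<close> itself; from the right it is
  \<open>g t\<close>, and continuity of \<open>g\<close> replaces it.\<close>

lemma has_real_derivative_if_backward_expansion:
  fixes f g :: "real \<Rightarrow> real"
  assumes g: "continuous_on {a..b} g" and h: "0 < h" and K: "0 \<le> K"
    and ex: "\<And>s t. a \<le> s \<Longrightarrow> s \<le> t \<Longrightarrow> t \<le> b \<Longrightarrow> t - s \<le> h \<Longrightarrow> \<bar>f t - f s - (t - s) * g t\<bar> \<le> K * (t - s)\<^sup>2"
    and \<tau>: "\<tau> \<in> {a..b}"
  shows "(f has_real_derivative g \<tau>) (at \<tau> within {a..b})"
proof -
  have bd: "\<bar>(f t - f \<tau>) / (t - \<tau>) - g \<tau>\<bar> \<le> K * \<bar>t - \<tau>\<bar> + \<bar>g t - g \<tau>\<bar>"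
    if t: "t \<in> {a..b}" "t \<noteq> \<tau>" "\<bar>t - \<tau>\<bar> \<le> h" for t
  proof -
    have *: "\<bar>f t - f \<tau> - (t - \<tau>) * g \<tau>\<bar> \<le> \<bar>t - \<tau>\<bar> * (K * \<bar>t - \<tau>\<bar> + \<bar>g t - g \<tau>\<bar>)"
    proof (cases "t < \<tau>")
      case True
      have "\<bar>f \<tau> - f t - (\<tau> - t) * g \<tau>\<bar> \<le> K * (\<tau> - t)\<^sup>2" by (rule ex) (use True t \<tau> in auto)
      moreover have "f t - f \<tau> - (t - \<tau>) * g \<tau> = - (f \<tau> - f t - (\<tau> - t) * g \<tau>)" by (simp add: algebra_simps)
      moreover have "K * (\<tau> - t)\<^sup>2 = \<bar>t - \<tau>\<bar> * (K * \<bar>t - \<tau>\<bar>)" using True by (simp add: power2_eq_square)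
      moreover have "0 \<le> \<bar>t - \<tau>\<bar> * \<bar>g t - g \<tau>\<bar>" by simp
      ultimately show ?thesis unfolding distrib_left by linarith
    next
      case False
      have "\<bar>f t - f \<tau> - (t - \<tau>) * g t\<bar> \<le> K * (t - \<tau>)\<^sup>2" by (rule ex) (use False t \<tau> in auto)
      moreover have "f t - f \<tau> - (t - \<tau>) * g \<tau> = (f t - f \<tau> - (t - \<tau>) * g t) + (t - \<tau>) * (g t - g \<tau>)"
        by (simp add: algebra_simps)
      moreover have "K * (t - \<tau>)\<^sup>2 = \<bar>t - \<tau>\<bar> * (K * \<bar>t - \<tau>\<bar>)" using False by (simp add: power2_eq_square)
      moreover have "\<bar>(t - \<tau>) * (g t - g \<tau>)\<bar> = \<bar>t - \<tau>\<bar> * \<bar>g t - g \<tau>\<bar>" by (simp add: abs_mult)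
      ultimately show ?thesis unfolding distrib_left by linarith
    qed
    have "f t - f \<tau> - (t - \<tau>) * g \<tau> = (t - \<tau>) * ((f t - f \<tau>) / (t - \<tau>) - g \<tau>)"
      using t(2) by (simp add: field_simps)
    then have "\<bar>t - \<tau>\<bar> * \<bar>(f t - f \<tau>) / (t - \<tau>) - g \<tau>\<bar> \<le> \<bar>t - \<tau>\<bar> * (K * \<bar>t - \<tau>\<bar> + \<bar>g t - g \<tau>\<bar>)"
      using * by (simp add: abs_mult)
    then show ?thesis using t(2) by (metis abs_le_zero_iff eq_iff_diff_eq_0 linorder_not_le mult_left_le_imp_le)
  qed
  have "((\<lambda>t. K * \<bar>t - \<tau>\<bar> + \<bar>g t - g \<tau>\<bar>) \<longlongrightarrow> K * \<bar>\<tau> - \<tau>\<bar> + \<bar>g \<tau> - g \<tau>\<bar>) (at \<tau> within {a..b})"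
    using g \<tau> by (intro tendsto_intros) (auto simp: continuous_on_def)
  then have lim: "((\<lambda>t. K * \<bar>t - \<tau>\<bar> + \<bar>g t - g \<tau>\<bar>) \<longlongrightarrow> 0) (at \<tau> within {a..b})" by simp
  have "\<forall>\<^sub>F t in at \<tau> within {a..b}. norm ((f t - f \<tau>) / (t - \<tau>) - g \<tau>) \<le> K * \<bar>t - \<tau>\<bar> + \<bar>g t - g \<tau>\<bar>"
    unfolding eventually_at using bd h by (intro exI[of _ h]) (auto simp: dist_real_def)
  then have "((\<lambda>t. (f t - f \<tau>) / (t - \<tau>) - g \<tau>) \<longlongrightarrow> 0) (at \<tau> within {a..b})"
    by (rule Lim_null_comparison) (rule lim)
  then show ?thesis by (simp add: has_field_derivative_iff LIM_zero_iff)
qed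

text \<open>The situation of a derivative \<open>a\<close> approximated by quotients of step
  \<open>s\<close> up to order \<open>s\<close>, when the quotients change in time by the order of
  the time difference divided by \<open>s\<close>. Balancing the two errors gives
  continuity.\<close>

lemma continuous_on_if_interpolation:
  fixes a :: "real \<Rightarrow> real"
  assumes s0: "0 < s0" and K: "0 \<le> K"
    and le: "\<And>t t' s. t \<in> S \<Longrightarrow> t' \<in> S \<Longrightarrow> 0 < s \<Longrightarrow> s \<le> s0 \<Longrightarrow> \<bar>a t - a t'\<bar> \<le> K * (s + \<bar>t - t'\<bar> / s + \<bar>t - t'\<bar>)"
  shows "continuous_on S a"
  unfolding continuous_on_iff
proof (intro ballI allI impI)
  fix t e :: real assume t: "t \<in> S" and e: "0 < e"
  define s where "s = min s0 (min 1 (e / (4 * (K + 1))))"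
  have s: "0 < s" "s \<le> s0" "s \<le> 1" "s \<le> e / (4 * (K + 1))"
    using s0 e K by (auto simp: s_def)
  show "\<exists>d>0. \<forall>t'\<in>S. dist t' t < d \<longrightarrow> dist (a t') (a t) < e"
  proof (intro exI[of _ "s * s"] conjI ballI impI)
    fix t' assume t': "t' \<in> S" "dist t' t < s * s"
    have d: "\<bar>t' - t\<bar> < s * s" using t' by (simp add: dist_real_def)
    have "\<bar>t' - t\<bar> / s \<le> s" using d s(1) by (simp add: pos_divide_le_eq)
    moreover have "s * s \<le> s * 1" by (rule mult_left_mono) (use s in auto)
    then have "\<bar>t' - t\<bar> \<le> s" using d by linarith
    ultimately have "K * (s + \<bar>t' - t\<bar> / s + \<bar>t' - t\<bar>) \<le> K * (3 * s)" using K by (intro mult_left_mono) auto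
    also have "\<dots> < 4 * ((K + 1) * s)" using K s(1) by (simp add: algebra_simps add_nonneg_pos add.commute)
    also have "\<dots> \<le> e" using s(4) K by (simp add: pos_le_divide_eq mult_ac)
    finally show "dist (a t') (a t) < e" using le[OF t'(1) t s(1,2)] by (simp add: dist_real_def)
  qed (use s in auto)
qed

context mfg_system
begin

section \<open>Regularity in time\<close>

lemma ham_bounded: "\<exists>B\<ge>0. \<forall>m u. good (m, u) \<longrightarrow> norm (ham m u) \<le> B"
proof -
  define S where "S = (\<Sum>x\<in>UNIV. \<bar>H x 0\<bar> + \<bar>F x (axis x 1)\<bar>)"
  define B where "B = real CARD('d) * (S + C * K + 6 * C)"
  have B: "norm (ham m u) \<le> B" if g: "good (m, u)" for m u
    unfolding B_def
  proof (rule norm_le_card_mult)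
    fix x
    have P: "m \<in> simplex_P" and Kx: "norm (dl u x) \<le> K" using g by (auto simp: good_def)
    have 1: "\<bar>H x (dl u x) - H x 0\<bar> \<le> C * K"
      using H_lip[of x "dl u x" 0] mult_left_mono[OF Kx C0] by simp
    have "norm (m - axis x 1) \<le> 2"
      using norm_triangle_ineq4[of m "axis x 1"] norm_simplex_P_le[OF P] by simp
    then have "3 * C * norm (m - axis x 1) \<le> 3 * C * 2" using C0 by (intro mult_left_mono) auto
    then have 2: "\<bar>F x m - F x (axis x 1)\<bar> \<le> 6 * C"
      using F_lip[OF P axis_in_simplex_P[of x], of x] by linarith
    have "\<bar>H x 0\<bar> + \<bar>F x (axis x 1)\<bar> \<le> S"
      unfolding S_def by (rule member_le_sum) auto
    then show "\<bar>ham m u $ x\<bar> \<le> S + C * K + 6 * C" using 1 2 by (simp add: ham_def)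
  qed
  \<comment> \<open>Nonnegativity of \<open>B\<close> is read off from one state that satisfies
    \<open>good\<close>, since the locale does not state the sign of \<open>K\<close>.\<close>
  have "good (axis undefined 1, val T (axis undefined 1))"
    by (rule val_good) (use T axis_in_simplex_P in auto)
  then have "0 \<le> B" using B norm_ge_zero order_trans by blast
  then show ?thesis using B by blast
qed

text \<open>An explicit Euler step is the sum of \<open>(1 - s * rate) *\<^sub>R m\<close> and
  \<open>s\<close> times the nonnegative vector \<open>rate *\<^sub>R m + drift m u\<close>.\<close>

lemma shift_drift_in_simplex_P:
  assumes P: "m \<in> simplex_P" and s: "0 \<le> s" "s * rate \<le> 1"
  shows "m + s *\<^sub>R drift m u \<in> simplex_P"
proof (rule shift_in_simplex_P[OF P sum_drift])
  fix j
  have "0 \<le> (1 - s * rate) * m $ j + s * (rate *\<^sub>R m + drift m u) $ j"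
    by (intro add_nonneg_nonneg mult_nonneg_nonneg rate_drift_nonneg P simplex_P_nonneg) (use s in auto)
  then show "0 \<le> m $ j + s * drift m u $ j" by (simp add: algebra_simps)
qed

text \<open>The transport term is the derivative of \<open>val t\<close> along the drift, so the
  time derivative has to be \<open>g\<close>, the Hamiltonian term minus that directional derivative
  \<open>a\<close>. The gradients \<open>A t x m\<close> are chosen separately for each
  \<open>t\<close>; the continuity of \<open>a\<close> in time is therefore recovered from that of
  \<open>val\<close>.\<close>

lemma master_solution:
  assumes \<alpha>: "\<And>x p. norm p \<le> K \<Longrightarrow> \<alpha> x p = \<beta> x p"
  shows "\<exists>Ut DU C'. classical_solution_with T H \<alpha> F G (\<lambda>t x m. val t m $ x) Ut DU \<and>
    (\<forall>t\<in>{0..T}. \<forall>x y. C'-lipschitz_on simplex_P (\<lambda>m. DU t x m y))"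
proof -
  obtain Cg A where grad: "\<And>t x. t \<in> {0..T} \<Longrightarrow> simplex_gradient Cg (\<lambda>m. val t m $ x) (A t x)"
    using val_gradient by blast
  have Cg: "0 \<le> Cg" using grad[of 0] T by (auto simp: simplex_gradient_def)
  have A: "\<bar>val t m' $ x - val t m $ x - A t x m \<bullet> (m' - m)\<bar> \<le> Cg * (norm (m' - m))\<^sup>2"
    if "t \<in> {0..T}" "m \<in> simplex_P" "m' \<in> simplex_P" for t m m' x
    using grad[OF that(1), of x] that by (auto simp: simplex_gradient_def)
  obtain \<Lambda> where \<Lambda>: "0 \<le> \<Lambda>" and lip: "\<And>t m m'. t \<in> {0..T} \<Longrightarrow> m \<in> simplex_P \<Longrightarrow> m' \<in> simplex_P \<Longrightarrow>
    norm (val t m - val t m') \<le> \<Lambda> * norm (m - m')"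
    using val_lipschitz by fastforce
  obtain HB where HB: "0 \<le> HB" "\<And>m u. good (m, u) \<Longrightarrow> norm (ham m u) \<le> HB" using ham_bounded by blast
  define EB where "EB = (1 + real CARD('d)) * C"
  have EB: "0 \<le> EB" "\<And>m u. m \<in> simplex_P \<Longrightarrow> norm (drift m u) \<le> EB"
    using N0 C0 drift_bound by (auto simp: EB_def)
  have traj: "norm (fst (sol t m) t' - m) \<le> EB * (t' - t)" "norm (snd (sol t m) t' - val t m) \<le> HB * (t' - t)"
    if t: "0 \<le> t" "t \<le> t'" "t' \<le> T" and P: "m \<in> simplex_P" for t t' m
  proof -
    have tT: "t \<le> T" using t by simp
    note S = sol[OF t(1) tT P]
    have "norm (fst (sol t m) t' - fst (sol t m) t) \<le> EB * t' - EB * t"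
    proof (rule norm_increment_le[OF t(2)])
      fix s assume s: "s \<in> {t..t'}"
      then have s': "s \<in> {t..T}" using t by auto
      show "(fst (sol t m) has_vector_derivative drift (fst (sol t m) s) (snd (sol t m) s)) (at s within {t..t'})"
        by (rule has_vector_derivative_within_subset[OF mfgD(2)[OF S(1) s']]) (use t in auto)
      show "((*) EB has_real_derivative EB) (at s within {t..t'})" by (auto intro!: derivative_eq_intros)
      show "norm (drift (fst (sol t m) s) (snd (sol t m) s)) \<le> EB" by (rule EB(2)[OF mfgD(1)[OF S(1) s']])
    qed
    then show "norm (fst (sol t m) t' - m) \<le> EB * (t' - t)" by (simp add: S(2) algebra_simps)
    have "norm (snd (sol t m) t' - snd (sol t m) t) \<le> HB * t' - HB * t"
    proof (rule norm_increment_le[OF t(2)])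
      fix s assume s: "s \<in> {t..t'}"
      then have s': "s \<in> {t..T}" using t by auto
      show "(snd (sol t m) has_vector_derivative ham (fst (sol t m) s) (snd (sol t m) s)) (at s within {t..t'})"
        by (rule has_vector_derivative_within_subset[OF mfgD(3)[OF S(1) s']]) (use t in auto)
      show "((*) HB has_real_derivative HB) (at s within {t..t'})" by (auto intro!: derivative_eq_intros)
      show "norm (ham (fst (sol t m) s) (snd (sol t m) s)) \<le> HB" by (rule HB(2)[OF mfg_good[OF S(1) t(1) tT s']])
    qed
    then show "norm (snd (sol t m) t' - val t m) \<le> HB * (t' - t)" by (simp add: val_def algebra_simps)
  qed
  have val_traj: "val t' (fst (sol t m) t') = snd (sol t m) t'" "fst (sol t m) t' \<in> simplex_P"
    if t: "0 \<le> t" "t \<le> t'" "t' \<le> T" and P: "m \<in> simplex_P" for t t' m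
    using val_eq[OF sol(1)[OF t(1) _ P] t(1), of t'] mfgD(1)[OF sol(1)[OF t(1) _ P], of t'] t by auto
  define Ct where "Ct = \<Lambda> * EB + HB"
  have Ct0: "0 \<le> Ct" using \<Lambda> EB(1) HB(1) by (simp add: Ct_def)
  \<comment> \<open>Along the trajectory from \<open>m\<close> the value moves at speed at most
    \<open>HB\<close>, and at time \<open>t'\<close> it is \<open>val t'\<close> at a point within
    \<open>EB * (t' - t)\<close> of \<open>m\<close>.\<close>
  have time_lip1: "norm (val t' m - val t m) \<le> Ct * (t' - t)"
    if t: "0 \<le> t" "t \<le> t'" "t' \<le> T" and P: "m \<in> simplex_P" for t t' m
  proof -
    have "norm (val t' m - val t' (fst (sol t m) t')) \<le> \<Lambda> * norm (m - fst (sol t m) t')"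
      by (rule lip) (use t P val_traj[OF t P] in auto)
    also have "\<dots> \<le> \<Lambda> * (EB * (t' - t))" using traj(1)[OF t P] \<Lambda> by (intro mult_left_mono) (auto simp: norm_minus_commute)
    finally have 1: "norm (val t' m - snd (sol t m) t') \<le> \<Lambda> * (EB * (t' - t))" by (simp add: val_traj(1)[OF t P])
    have "val t' m - val t m = (val t' m - snd (sol t m) t') + (snd (sol t m) t' - val t m)" by simp
    then have "norm (val t' m - val t m) \<le> norm (val t' m - snd (sol t m) t') + norm (snd (sol t m) t' - val t m)"
      by (metis norm_triangle_ineq)
    then show ?thesis using 1 traj(2)[OF t P] by (simp add: Ct_def algebra_simps)
  qed
  have time_lip: "norm (val t' m - val t m) \<le> Ct * \<bar>t' - t\<bar>"
    if t: "t \<in> {0..T}" "t' \<in> {0..T}" and P: "m \<in> simplex_P" for t t' m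
    using time_lip1[of t t' m] time_lip1[of t' t m] that
    by (cases "t \<le> t'") (auto simp: norm_minus_commute abs_if)
  define e where "e t m = drift m (val t m)" for t m
  define a where "a t x m = A t x m \<bullet> e t m" for t x m
  define g where "g t x m = ham m (val t m) $ x - a t x m" for t x m
  have eB: "norm (e t m) \<le> EB" if "m \<in> simplex_P" for t m using EB(2)[OF that] by (simp add: e_def)
  have e_lip: "norm (e t' m - e t m) \<le> LB * (Ct * \<bar>t' - t\<bar>)"
    if t: "t \<in> {0..T}" "t' \<in> {0..T}" and P: "m \<in> simplex_P" for t t' m
  proof -
    have "norm (e t' m - e t m) \<le> LB * (norm (m - m) + norm (val t' m - val t m))"
      unfolding e_def by (rule drift_lip[OF P])
    also have "\<dots> \<le> LB * (Ct * \<bar>t' - t\<bar>)" using time_lip[OF t P] LB_ge(5) by (intro mult_left_mono) auto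
    finally show ?thesis .
  qed
  \<comment> \<open>Steps up to \<open>h0\<close> satisfy \<open>s * rate \<le> 1\<close>, so Euler
    steps along the drift stay in the simplex.\<close>
  define h0 where "h0 = 1 / (rate + 1)"
  have h0: "0 < h0" "h0 * rate \<le> 1" using rate_nonneg by (auto simp: h0_def field_simps)
  have eP: "m + s *\<^sub>R e t m \<in> simplex_P" if "m \<in> simplex_P" "0 \<le> s" "s \<le> h0" for m s t
    unfolding e_def
    by (rule shift_drift_in_simplex_P) (use that h0 mult_right_mono[OF that(3) rate_nonneg] in auto)
  have a_expand: "\<bar>val t (m + s *\<^sub>R e t m) $ x - val t m $ x - s * a t x m\<bar> \<le> Cg * EB\<^sup>2 * s\<^sup>2"
    if t: "t \<in> {0..T}" and P: "m \<in> simplex_P" and s: "0 \<le> s" "s \<le> h0" for t m s x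
  proof -
    have "\<bar>val t (m + s *\<^sub>R e t m) $ x - val t m $ x - s * a t x m\<bar> \<le> Cg * (norm (s *\<^sub>R e t m))\<^sup>2"
      using A[OF t P eP[OF P s, of t], of x] by (simp add: a_def)
    also have "\<dots> \<le> Cg * (s * EB)\<^sup>2"
      using eB[OF P, of t] s Cg by (intro mult_left_mono power_mono) (auto intro!: mult_left_mono)
    finally show ?thesis by (simp add: power_mult_distrib mult_ac)
  qed
  \<comment> \<open>The summands come from the two expansions at \<open>t\<close> and
    \<open>t'\<close>, from the change in time of the two values in the quotient, and from the
    change in time of the direction \<open>e t m\<close>.\<close>
  define Ka where "Ka = 2 * Cg * EB\<^sup>2 + 2 * Ct + \<Lambda> * (LB * Ct)"
  have Ka0: "0 \<le> Ka" using Cg Ct0 \<Lambda> LB_ge(5) by (simp add: Ka_def)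
  have a_cont: "continuous_on {0..T} (\<lambda>t. a t x m)" if P: "m \<in> simplex_P" for x m
  proof (rule continuous_on_if_interpolation[OF h0(1) Ka0])
    fix t t' s assume t: "t \<in> {0..T}" "t' \<in> {0..T}" and s: "0 < s" "s \<le> h0"
    let ?d = "\<bar>t - t'\<bar>"
    have s': "0 \<le> s" using s by simp
    have 1: "\<bar>val t m $ x - val t' m $ x\<bar> \<le> Ct * ?d"
      using component_le_norm_cart[of "val t m - val t' m" x] time_lip[OF t(2,1) P] by simp
    have 2: "\<bar>val t (m + s *\<^sub>R e t m) $ x - val t' (m + s *\<^sub>R e t' m) $ x\<bar> \<le> Ct * ?d + \<Lambda> * (s * (LB * (Ct * ?d)))"
    proof -
      have "norm (val t (m + s *\<^sub>R e t m) - val t' (m + s *\<^sub>R e t m)) \<le> Ct * ?d"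
        by (rule time_lip[OF t(2,1) eP[OF P s' s(2)]])
      moreover have "norm (val t' (m + s *\<^sub>R e t m) - val t' (m + s *\<^sub>R e t' m)) \<le> \<Lambda> * (s * norm (e t m - e t' m))"
      proof -
        have "norm ((m + s *\<^sub>R e t m) - (m + s *\<^sub>R e t' m)) = s * norm (e t m - e t' m)"
          using s(1) by (simp flip: scaleR_diff_right)
        then show ?thesis using lip[OF t(2) eP[OF P s' s(2), of t] eP[OF P s' s(2), of t']] by simp
      qed
      moreover have "\<Lambda> * (s * norm (e t m - e t' m)) \<le> \<Lambda> * (s * (LB * (Ct * ?d)))"
        using e_lip[OF t(2,1) P] s \<Lambda> by (intro mult_left_mono) auto
      moreover have "norm (val t (m + s *\<^sub>R e t m) - val t' (m + s *\<^sub>R e t' m))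
          \<le> norm (val t (m + s *\<^sub>R e t m) - val t' (m + s *\<^sub>R e t m)) + norm (val t' (m + s *\<^sub>R e t m) - val t' (m + s *\<^sub>R e t' m))"
        by (rule norm_triangle_ineq[of "val t (m + s *\<^sub>R e t m) - val t' (m + s *\<^sub>R e t m)"
              "val t' (m + s *\<^sub>R e t m) - val t' (m + s *\<^sub>R e t' m)", simplified])
      moreover have "\<bar>(val t (m + s *\<^sub>R e t m) - val t' (m + s *\<^sub>R e t' m)) $ x\<bar> \<le> norm (val t (m + s *\<^sub>R e t m) - val t' (m + s *\<^sub>R e t' m))"
        by (rule component_le_norm_cart)
      ultimately show ?thesis unfolding vector_minus_component by linarith
    qed
    have "\<bar>s * a t x m - s * a t' x m\<bar> \<le> 2 * (Cg * EB\<^sup>2 * s\<^sup>2) + 2 * (Ct * ?d) + \<Lambda> * (s * (LB * (Ct * ?d)))"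
      using 1 2 a_expand[OF t(1) P s' s(2), of x] a_expand[OF t(2) P s' s(2), of x] by linarith
    also have "\<dots> = s * (2 * Cg * EB\<^sup>2 * s + 2 * Ct * (?d / s) + \<Lambda> * (LB * Ct) * ?d)"
      using s(1) by (simp add: power2_eq_square algebra_simps)
    finally have "s * \<bar>a t x m - a t' x m\<bar> \<le> s * (2 * Cg * EB\<^sup>2 * s + 2 * Ct * (?d / s) + \<Lambda> * (LB * Ct) * ?d)"
      using s(1) by (simp add: abs_mult flip: right_diff_distrib)
    then have "\<bar>a t x m - a t' x m\<bar> \<le> 2 * Cg * EB\<^sup>2 * s + 2 * Ct * (?d / s) + \<Lambda> * (LB * Ct) * ?d"
      by (rule mult_left_le_imp_le[OF _ s(1)])
    also have "\<dots> \<le> Ka * s + Ka * (?d / s) + Ka * ?d"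
      using s(1) Cg Ct0 \<Lambda> LB_ge(5) by (intro add_mono mult_right_mono) (auto simp: Ka_def)
    finally show "\<bar>a t x m - a t' x m\<bar> \<le> Ka * (s + ?d / s + ?d)" by (simp add: distrib_left)
  qed
  have val_cont_t: "continuous_on {0..T} (\<lambda>t. val t m)" if P: "m \<in> simplex_P" for m
  proof (rule lipschitz_on_continuous_on)
    show "Ct-lipschitz_on {0..T} (\<lambda>t. val t m)"
      by (rule lipschitz_onI) (use time_lip[OF _ _ P] Ct0 in \<open>auto simp: dist_norm\<close>)
  qed
  have g_cont: "continuous_on {0..T} (\<lambda>t. g t x m)" if P: "m \<in> simplex_P" for x m
  proof -
    have "continuous_on {0..T} (\<lambda>t. ham m (val t m))"
      by (rule continuous_on_ham) (use P val_cont_t[OF P] in \<open>auto intro: continuous_intros\<close>)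
    then show ?thesis unfolding g_def by (intro continuous_intros a_cont P)
  qed
  \<comment> \<open>One summand per error: the curvature of the value along the trajectory, the
    Hamiltonian term moved to the later time, the expansion of \<open>val t'\<close> along the
    drift, and \<open>\<Lambda>\<close> times the distance between trajectory and Euler
    step.\<close>
  define Kd where "Kd = LB * (EB + HB) + LB * Ct + Cg * EB\<^sup>2 + \<Lambda> * (LB * (EB + HB) + LB * Ct)"
  have Kd0: "0 \<le> Kd" using Cg Ct0 \<Lambda> LB_ge(5) EB(1) HB(1) by (simp add: Kd_def)
  have deriv: "((\<lambda>t. val t m $ x) has_real_derivative g t x m) (at t within {0..T})"
    if t: "t \<in> {0..T}" and P: "m \<in> simplex_P" for t x m
  proof (rule has_real_derivative_if_backward_expansion[OF g_cont[OF P] h0(1) Kd0 _ t])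
    fix t t' assume t: "0 \<le> t" "t \<le> t'" "t' \<le> T" and h: "t' - t \<le> h0"
    let ?h = "t' - t" and ?m = "fst (sol t m)" and ?u = "snd (sol t m)"
    have tI: "t \<in> {0..T}" "t' \<in> {0..T}" and tT: "t \<le> T" and h': "0 \<le> ?h" using t by auto
    note S = sol[OF t(1) tT P]
    have ut: "?u t = val t m" by (simp add: val_def)
    have move: "norm (?m s - m) + norm (?u s - val t m) \<le> (EB + HB) * ?h" if s: "s \<in> {t..t'}" for s
    proof -
      have "norm (?m s - m) + norm (?u s - val t m) \<le> (EB + HB) * (s - t)"
        using traj[OF t(1) _ _ P, of s] s t by (auto simp: distrib_right)
      also have "\<dots> \<le> (EB + HB) * ?h" using s EB(1) HB(1) by (intro mult_left_mono) auto
      finally show ?thesis .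
    qed
    have mex: "norm (?m t' - ?m t - ?h *\<^sub>R drift m (val t m)) \<le> (LB * ((EB + HB) * ?h)) * ?h"
    proof (rule first_order_expansion[OF t(2)])
      fix s assume s: "s \<in> {t..t'}"
      then have s': "s \<in> {t..T}" using t by auto
      show "(?m has_vector_derivative drift (?m s) (?u s)) (at s within {t..t'})"
        by (rule has_vector_derivative_within_subset[OF mfgD(2)[OF S(1) s']]) (use t in auto)
      have "norm (drift (?m s) (?u s) - drift m (val t m)) \<le> LB * (norm (?m s - m) + norm (?u s - val t m))"
        by (rule drift_lip[OF mfgD(1)[OF S(1) s']])
      also have "\<dots> \<le> LB * ((EB + HB) * ?h)" by (intro mult_left_mono move s LB_ge(5))
      finally show "norm (drift (?m s) (?u s) - drift m (val t m)) \<le> LB * ((EB + HB) * ?h)" .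
    qed
    have uex: "norm (?u t' - ?u t - ?h *\<^sub>R ham m (val t m)) \<le> (LB * ((EB + HB) * ?h)) * ?h"
    proof (rule first_order_expansion[OF t(2)])
      fix s assume s: "s \<in> {t..t'}"
      then have s': "s \<in> {t..T}" using t by auto
      show "(?u has_vector_derivative ham (?m s) (?u s)) (at s within {t..t'})"
        by (rule has_vector_derivative_within_subset[OF mfgD(3)[OF S(1) s']]) (use t in auto)
      have "norm (ham (?m s) (?u s) - ham m (val t m)) \<le> LB * (norm (?m s - m) + norm (?u s - val t m))"
        by (rule ham_lip[OF mfgD(1)[OF S(1) s'] P])
      also have "\<dots> \<le> LB * ((EB + HB) * ?h)" by (intro mult_left_mono move s LB_ge(5))
      finally show "norm (ham (?m s) (?u s) - ham m (val t m)) \<le> LB * ((EB + HB) * ?h)" .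
    qed
    have hh: "norm (ham m (val t m) - ham m (val t' m)) \<le> LB * (Ct * ?h)"
    proof -
      have "norm (ham m (val t m) - ham m (val t' m)) \<le> LB * (norm (m - m) + norm (val t m - val t' m))"
        by (rule ham_lip[OF P P])
      also have "\<dots> \<le> LB * (Ct * ?h)" using time_lip1[OF t P] LB_ge(5) by (intro mult_left_mono) (auto simp: norm_minus_commute)
      finally show ?thesis .
    qed
    \<comment> \<open>The Euler step uses the drift at the later time, because it is
      \<open>val t'\<close> that gets expanded in the distribution. The curvature of the trajectory
      and the change of the drift are both of second order.\<close>
    have near: "norm (?m t' - (m + ?h *\<^sub>R e t' m)) \<le> (LB * (EB + HB) + LB * Ct) * ?h\<^sup>2"
    proof -
      have "norm (?h *\<^sub>R (e t m - e t' m)) \<le> ?h * (LB * (Ct * ?h))"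
        using e_lip[OF tI(2,1) P] h' by (auto intro!: mult_left_mono)
      moreover have "?m t' - (m + ?h *\<^sub>R e t' m) = (?m t' - ?m t - ?h *\<^sub>R drift m (val t m)) + ?h *\<^sub>R (e t m - e t' m)"
        by (simp add: S(2) e_def algebra_simps)
      ultimately show ?thesis
        using mex norm_triangle_ineq[of "?m t' - ?m t - ?h *\<^sub>R drift m (val t m)" "?h *\<^sub>R (e t m - e t' m)"]
        by (simp add: power2_eq_square algebra_simps)
    qed
    have "norm (val t' (?m t') - val t' (m + ?h *\<^sub>R e t' m)) \<le> \<Lambda> * norm (?m t' - (m + ?h *\<^sub>R e t' m))"
      by (rule lip[OF tI(2) val_traj(2)[OF t P] eP[OF P h' h]])
    also have "\<dots> \<le> \<Lambda> * ((LB * (EB + HB) + LB * Ct) * ?h\<^sup>2)" by (intro mult_left_mono near \<Lambda>)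
    finally have 1: "\<bar>(?u t' - val t' (m + ?h *\<^sub>R e t' m)) $ x\<bar> \<le> \<Lambda> * ((LB * (EB + HB) + LB * Ct) * ?h\<^sup>2)"
      using component_le_norm_cart[of "?u t' - val t' (m + ?h *\<^sub>R e t' m)" x] by (simp add: val_traj(1)[OF t P])
    have 2: "\<bar>(?u t' - ?u t - ?h *\<^sub>R ham m (val t m)) $ x\<bar> \<le> LB * (EB + HB) * ?h\<^sup>2"
      using component_le_norm_cart[of "?u t' - ?u t - ?h *\<^sub>R ham m (val t m)" x] uex
      by (simp add: power2_eq_square mult_ac)
    have "\<bar>(ham m (val t m) - ham m (val t' m)) $ x\<bar> \<le> LB * (Ct * ?h)"
      using component_le_norm_cart[of "ham m (val t m) - ham m (val t' m)" x] hh by linarith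
    then have "?h * \<bar>(ham m (val t m) - ham m (val t' m)) $ x\<bar> \<le> ?h * (LB * (Ct * ?h))" by (intro mult_left_mono h')
    then have 3: "\<bar>?h * (ham m (val t m) $ x - ham m (val t' m) $ x)\<bar> \<le> LB * Ct * ?h\<^sup>2"
      using h' by (simp add: abs_mult power2_eq_square mult_ac)
    have 4: "\<bar>val t' (m + ?h *\<^sub>R e t' m) $ x - val t' m $ x - ?h * a t' x m\<bar> \<le> Cg * EB\<^sup>2 * ?h\<^sup>2"
      by (rule a_expand[OF tI(2) P h' h])
    \<comment> \<open>The value \<open>?u t'\<close> of the trajectory is \<open>val t'\<close> at
      its endpoint; comparing that endpoint with the Euler step leaves four errors of second
      order.\<close>
    have eq: "val t' m $ x - val t m $ x - ?h * g t' x m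
        = (?u t' - ?u t - ?h *\<^sub>R ham m (val t m)) $ x + ?h * (ham m (val t m) $ x - ham m (val t' m) $ x)
          - (?u t' - val t' (m + ?h *\<^sub>R e t' m)) $ x - (val t' (m + ?h *\<^sub>R e t' m) $ x - val t' m $ x - ?h * a t' x m)"
      by (simp add: g_def ut right_diff_distrib)
    have "Kd * ?h\<^sup>2 = LB * (EB + HB) * ?h\<^sup>2 + LB * Ct * ?h\<^sup>2 + \<Lambda> * ((LB * (EB + HB) + LB * Ct) * ?h\<^sup>2) + Cg * EB\<^sup>2 * ?h\<^sup>2"
      by (simp add: Kd_def algebra_simps)
    then show "\<bar>val t' m $ x - val t m $ x - ?h * g t' x m\<bar> \<le> Kd * ?h\<^sup>2"
      unfolding eq using 1 2 3 4 by linarith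
  qed
  \<comment> \<open>Row \<open>y\<close> is the finite difference of the gradient at
    \<open>y\<close>, so the adjointness in \<open>inner_drift\<close> turns \<open>a\<close> into
    the integral term of the equation.\<close>
  define DU where "DU t x m y = dl (A t x m) y" for t x m y
  have DU: "DU t x = (\<lambda>m y. \<chi> z. A t x m $ z - A t x m $ y)" for t x
    by (simp add: DU_def fun_eq_iff vec_eq_iff dl_nth)
  have "classical_solution_with T H \<alpha> F G (\<lambda>t x m. val t m $ x) g DU"
    unfolding classical_solution_with_def
  proof (intro conjI allI ballI)
    fix x
    have "continuous_on ({0..T} \<times> simplex_P) (\<lambda>p. val (fst p) (snd p))"
    proof (rule lipschitz_on_continuous_on)
      show "(Ct + \<Lambda>)-lipschitz_on ({0..T} \<times> simplex_P) (\<lambda>p. val (fst p) (snd p))"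
      proof (rule lipschitz_onI)
        fix p q :: "real \<times> (real^'d)" assume p: "p \<in> {0..T} \<times> simplex_P" and q: "q \<in> {0..T} \<times> simplex_P"
        have "norm (val (fst p) (snd p) - val (fst q) (snd q))
            \<le> norm (val (fst p) (snd p) - val (fst q) (snd p)) + norm (val (fst q) (snd p) - val (fst q) (snd q))"
          using norm_triangle_ineq[of "val (fst p) (snd p) - val (fst q) (snd p)" "val (fst q) (snd p) - val (fst q) (snd q)"] by simp
        also have "\<dots> \<le> Ct * \<bar>fst p - fst q\<bar> + \<Lambda> * norm (snd p - snd q)"
          by (intro add_mono time_lip lip) (use p q in auto)
        also have "\<dots> \<le> Ct * norm (p - q) + \<Lambda> * norm (p - q)"
          using norm_fst_le'[of "p - q"] norm_snd_le'[of "p - q"] Ct0 \<Lambda> by (intro add_mono mult_left_mono) auto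
        finally show "dist (val (fst p) (snd p)) (val (fst q) (snd q)) \<le> (Ct + \<Lambda>) * dist p q"
          by (simp add: dist_norm distrib_right)
      qed (use Ct0 \<Lambda> in simp)
    qed
    then show "continuous_on ({0..T} \<times> simplex_P) (\<lambda>(t, m). val t m $ x)"
      unfolding case_prod_unfold by (intro continuous_intros)
  next
    fix x and m :: "real^'d" assume m: "m \<in> simplex_P"
    show "continuous_on {0..T} (\<lambda>t. g t x m)" by (rule g_cont[OF m])
  next
    fix x t and m :: "real^'d" assume "m \<in> simplex_P" "t \<in> {0..T}"
    then show "((\<lambda>s. val s m $ x) has_real_derivative g t x m) (at t within {0..T})" using deriv by blast
  next
    fix t x assume "t \<in> {0..T}"
    then show "C1_simplex (\<lambda>m. val t m $ x) (DU t x)" unfolding DU by (rule simplex_gradient_C1(1)[OF grad])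
  next
    fix t x and m :: "real^'d" assume t: "t \<in> {0..T}" and m: "m \<in> simplex_P"
    have good: "good (m, val t m)" using val_good[of t m] t m by simp
    have fd: "fdiff (($) (val t m)) y = dl (val t m) y" for y by (simp add: dl_def)
    have al: "\<alpha> y (dl (val t m) y) = \<beta> y (dl (val t m) y)" for y
      by (rule \<alpha>) (use good in \<open>simp add: good_def\<close>)
    have "a t x m = (\<Sum>y\<in>UNIV. m $ y * (DU t x m y \<bullet> \<alpha> y (dl (val t m) y)))"
      by (simp add: a_def e_def inner_drift al DU_def inner_commute)
    then show "- g t x m + H x (fdiff (($) (val t m)) x) - (\<Sum>y\<in>UNIV. m $ y * (DU t x m y \<bullet> \<alpha> y (fdiff (($) (val t m)) y))) = F x m"
      by (simp add: fd g_def ham_def)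
  next
    fix x and m :: "real^'d" assume "m \<in> simplex_P"
    then show "val T m $ x = G x m" by (simp add: val_fin fin_def)
  qed
  moreover have "(2 * real CARD('d) * Cg)-lipschitz_on simplex_P (\<lambda>m. DU t x m y)" if "t \<in> {0..T}" for t x y
    unfolding DU by (rule simplex_gradient_C1(2)[OF grad[OF that]])
  ultimately show ?thesis by blast
qed

end

section \<open>The Hamiltonian and the theorem\<close>

lemma ctrl_set_abs_le:
  assumes "a \<in> ctrl_set \<kappa> M"
  shows "\<bar>a $ j\<bar> \<le> \<bar>\<kappa>\<bar> + \<bar>M\<bar>"
proof -
  have "\<kappa> \<le> a $ j" "a $ j \<le> M" using assms by (auto simp: ctrl_set_def)
  then show ?thesis by linarith
qed

lemma compact_ctrl_set: "compact (ctrl_set \<kappa> M :: (real ^ 'd::finite) set)"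
proof -
  have "closed {a :: real^'d. \<forall>j. \<kappa> \<le> a $ j \<and> a $ j \<le> M}"
    by (intro closed_Collect_all closed_Collect_conj closed_Collect_le continuous_intros)
  moreover have "bounded (ctrl_set \<kappa> M :: (real^'d) set)"
    unfolding bounded_iff
  proof (intro exI ballI)
    fix a :: "real^'d" assume "a \<in> ctrl_set \<kappa> M"
    then show "norm a \<le> real CARD('d) * (\<bar>\<kappa>\<bar> + \<bar>M\<bar>)"
      by (intro norm_le_card_mult ctrl_set_abs_le)
  qed
  ultimately show ?thesis by (simp add: compact_eq_bounded_closed ctrl_set_def)
qed

section \<open>From the regularity hypotheses to quadratic expansions\<close>

lemma segment_has_vector_derivative:
  fixes f :: "'a::real_normed_vector \<Rightarrow> 'b::real_normed_vector"
  assumes f: "(f has_derivative f') (at (p + s *\<^sub>R e) within S)"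
    and seg: "\<And>r. r \<in> {0..1} \<Longrightarrow> p + r *\<^sub>R e \<in> S"
  shows "((\<lambda>r. f (p + r *\<^sub>R e)) has_vector_derivative f' e) (at s within {0..1})"
proof -
  have 1: "((\<lambda>r. p + r *\<^sub>R e) has_derivative (\<lambda>h. h *\<^sub>R e)) (at s within {0..1})"
    by (auto intro!: derivative_eq_intros)
  have 2: "(f has_derivative f') (at (p + s *\<^sub>R e) within (\<lambda>r. p + r *\<^sub>R e) ` {0..1})"
    by (rule has_derivative_subset[OF f]) (use seg in auto)
  have "linear f'" using f has_derivative_linear by blast
  then have "f' (h *\<^sub>R e) = h *\<^sub>R f' e" for h by (rule linear_scale)
  then show ?thesis
    using has_derivative_in_compose[OF 1 2] by (simp add: has_vector_derivative_def)
qed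

lemma norm_matrix_vector_le:
  fixes A :: "real ^ 'd::finite ^ 'd"
  shows "norm (A *v h) \<le> real CARD('d) * (norm A * norm h)"
proof (rule norm_le_card_mult)
  fix j
  have "\<bar>A $ j \<bullet> h\<bar> \<le> norm (A $ j) * norm h" by (rule Cauchy_Schwarz_ineq2)
  also have "\<dots> \<le> norm A * norm h" by (intro mult_right_mono Finite_Cartesian_Product.norm_nth_le) auto
  finally show "\<bar>(A *v h) $ j\<bar> \<le> norm A * norm h"
    by (simp add: matrix_vector_mul_component)
qed

lemma simplex_gradient_mono: "simplex_gradient C g A \<Longrightarrow> C \<le> C' \<Longrightarrow> simplex_gradient C' g A"
  unfolding simplex_gradient_def by (meson mult_right_mono norm_ge_zero order_trans zero_le_power2)

text \<open>By the cocycle identity any fixed row \<open>DF x m w\<close> of the derivative is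
  already a gradient; \<open>w\<close> is an arbitrary state. Enlarging the constant by the bounds
  of these rows makes it serve all states.\<close>

lemma RegCost_gradient:
  fixes F :: "'d::finite \<Rightarrow> real ^ 'd \<Rightarrow> real"
  assumes "RegCost F"
  shows "\<exists>C\<ge>0. \<exists>A. \<forall>x. simplex_gradient C (F x) (A x) \<and> (\<forall>m\<in>simplex_P. norm (A x m) \<le> C)"
proof -
  obtain DF L where DF: "\<And>x. C1_simplex (F x) (DF x)" "\<And>x y. bounded ((\<lambda>m. DF x m y) ` simplex_P)"
    "\<And>x y. L-lipschitz_on simplex_P (\<lambda>m. DF x m y)"
    using assms unfolding RegCost_def by blast
  define w :: 'd where "w = undefined"
  have "\<forall>x. \<exists>b. \<forall>m\<in>simplex_P. norm (DF x m w) \<le> b" using DF(2) by (auto simp: bounded_iff)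
  then obtain b where b: "\<And>x m. m \<in> simplex_P \<Longrightarrow> norm (DF x m w) \<le> b x" by metis
  define C1 where "C1 = 4 * (2 * L) * real CARD('d) ^ 3"
  define C where "C = C1 + (\<Sum>x\<in>UNIV. \<bar>b x\<bar>)"
  have g: "simplex_gradient C1 (F x) (\<lambda>m. DF x m w)" for x unfolding C1_def
    by (rule transfer_expansion_simplex_gradient[OF C1_simplex_transfer_expansion[OF DF(1) DF(3)]])
  then have C10: "0 \<le> C1" by (auto simp: simplex_gradient_def)
  have C: "C1 \<le> C" by (simp add: C_def sum_nonneg)
  have "norm (DF x m w) \<le> C" if "m \<in> simplex_P" for x m
  proof -
    have "\<bar>b x\<bar> \<le> (\<Sum>x\<in>UNIV. \<bar>b x\<bar>)" by (rule member_le_sum) auto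
    then show ?thesis using b[OF that, of x] C10 by (simp add: C_def)
  qed
  then show ?thesis using simplex_gradient_mono[OF g C] C10 C
    by (intro exI[of _ C] conjI exI[of _ "\<lambda>x m. DF x m w"]) auto
qed

text \<open>All three estimates are obtained along the segment from \<open>p\<close> to
  \<open>q\<close>. It lies in the ball by convexity, so derivatives relative to the ball suffice
  even at its boundary. The constant \<open>2 * c\<close> becomes \<open>c\<close> by the second
  integration of the Hessian bound.\<close>

lemma C11_ball_expansion:
  fixes f :: "real ^ 'd::finite \<Rightarrow> real" and D :: "real ^ 'd \<Rightarrow> real ^ 'd" and D2 :: "real ^ 'd \<Rightarrow> real ^ 'd ^ 'd"
  assumes f: "\<And>p. p \<in> cball 0 K \<Longrightarrow> (f has_derivative (\<lambda>h. D p \<bullet> h)) (at p within cball 0 K)"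
    and D: "\<And>p. p \<in> cball 0 K \<Longrightarrow> (D has_derivative (\<lambda>h. D2 p *v h)) (at p within cball 0 K)"
    and lipD: "C-lipschitz_on (cball 0 K) D" and lipD2: "C-lipschitz_on (cball 0 K) D2"
    and pos: "\<And>p h. p \<in> cball 0 K \<Longrightarrow> 2 * c * (norm h)\<^sup>2 \<le> h \<bullet> (D2 p *v h)"
    and pq: "p \<in> cball 0 K" "q \<in> cball 0 K"
  shows "\<bar>f q - f p - D p \<bullet> (q - p)\<bar> \<le> C * (norm (q - p))\<^sup>2"
    "norm (D q - D p - D2 p *v (q - p)) \<le> real CARD('d) * C * (norm (q - p))\<^sup>2"
    "c * (norm (q - p))\<^sup>2 \<le> f q - f p - D p \<bullet> (q - p)"
proof -
  define e where "e = q - p"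
  have C0: "0 \<le> C" using lipD lipschitz_on_nonneg by blast
  have seg: "p + r *\<^sub>R e \<in> cball 0 K" if "r \<in> {0..1}" for r
    using convexD[OF convex_cball pq, of "1 - r" r] that by (auto simp: e_def algebra_simps)
  have near: "norm (p + r *\<^sub>R e - p) \<le> norm e" if "r \<in> {0..1}" for r
    using that mult_right_mono[of r 1 "norm e"] by simp
  have df: "((\<lambda>r. f (p + r *\<^sub>R e)) has_vector_derivative D (p + s *\<^sub>R e) \<bullet> e) (at s within {0..1})"
    if "s \<in> {0..1}" for s by (rule segment_has_vector_derivative[OF f[OF seg[OF that]] seg])
  have dD: "((\<lambda>r. D (p + r *\<^sub>R e)) has_vector_derivative D2 (p + s *\<^sub>R e) *v e) (at s within {0..1})"
    if "s \<in> {0..1}" for s by (rule segment_has_vector_derivative[OF D[OF seg[OF that]] seg])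
  have "norm (f (p + 1 *\<^sub>R e) - f (p + 0 *\<^sub>R e) - (1 - 0) *\<^sub>R (D p \<bullet> e)) \<le> C * (norm e)\<^sup>2 * (1 - 0)"
  proof (rule first_order_expansion[where f = "\<lambda>r. f (p + r *\<^sub>R e)", OF _ df])
    fix s :: real assume s: "s \<in> {0..1}"
    have "norm (D (p + s *\<^sub>R e) - D p) \<le> C * norm e"
      using lipschitz_onD[OF lipD seg[OF s] pq(1)] mult_left_mono[OF near[OF s] C0] by (simp add: dist_norm)
    then have "norm (D (p + s *\<^sub>R e) - D p) * norm e \<le> C * norm e * norm e" by (rule mult_right_mono) simp
    then show "norm (D (p + s *\<^sub>R e) \<bullet> e - D p \<bullet> e) \<le> C * (norm e)\<^sup>2"
      using Cauchy_Schwarz_ineq2[of "D (p + s *\<^sub>R e) - D p" e] by (simp add: inner_diff_left power2_eq_square)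
  qed auto
  then show "\<bar>f q - f p - D p \<bullet> (q - p)\<bar> \<le> C * (norm (q - p))\<^sup>2" by (simp add: e_def)
  have "norm (D (p + 1 *\<^sub>R e) - D (p + 0 *\<^sub>R e) - (1 - 0) *\<^sub>R (D2 p *v e)) \<le> real CARD('d) * C * (norm e)\<^sup>2 * (1 - 0)"
  proof (rule first_order_expansion[where f = "\<lambda>r. D (p + r *\<^sub>R e)", OF _ dD])
    fix s :: real assume s: "s \<in> {0..1}"
    have "norm (D2 (p + s *\<^sub>R e) - D2 p) \<le> C * norm e"
      using lipschitz_onD[OF lipD2 seg[OF s] pq(1)] mult_left_mono[OF near[OF s] C0] by (simp add: dist_norm)
    then have "real CARD('d) * (norm (D2 (p + s *\<^sub>R e) - D2 p) * norm e) \<le> real CARD('d) * (C * norm e * norm e)"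
      by (intro mult_left_mono mult_right_mono) auto
    then show "norm (D2 (p + s *\<^sub>R e) *v e - D2 p *v e) \<le> real CARD('d) * C * (norm e)\<^sup>2"
      using norm_matrix_vector_le[of "D2 (p + s *\<^sub>R e) - D2 p" e]
      by (simp add: matrix_vector_mult_diff_rdistrib power2_eq_square mult_ac)
  qed auto
  then show "norm (D q - D p - D2 p *v (q - p)) \<le> real CARD('d) * C * (norm (q - p))\<^sup>2" by (simp add: e_def)
  have incr: "2 * c * (norm e)\<^sup>2 * s \<le> D (p + s *\<^sub>R e) \<bullet> e - D p \<bullet> e" if s: "s \<in> {0..1}" for s
  proof -
    have "(\<lambda>s. 2 * c * (norm e)\<^sup>2 * s - D (p + s *\<^sub>R e) \<bullet> e) s \<le> (\<lambda>s. 2 * c * (norm e)\<^sup>2 * s - D (p + s *\<^sub>R e) \<bullet> e) 0"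
    proof (rule nonincreasing_within[where f = "\<lambda>s. 2 * c * (norm e)\<^sup>2 * s - D (p + s *\<^sub>R e) \<bullet> e"
          and f' = "\<lambda>r. 2 * c * (norm e)\<^sup>2 - (D2 (p + r *\<^sub>R e) *v e) \<bullet> e"])
      fix r assume r: "r \<in> {0..s}"
      then have r1: "r \<in> {0..1}" using s by auto
      have "((\<lambda>r. D (p + r *\<^sub>R e) \<bullet> e) has_vector_derivative (D2 (p + r *\<^sub>R e) *v e) \<bullet> e) (at r within {0..s})"
        by (intro bounded_linear.has_vector_derivative[OF bounded_linear_inner_left]
            has_vector_derivative_within_subset[OF dD[OF r1]]) (use s in auto)
      then have "((\<lambda>r. D (p + r *\<^sub>R e) \<bullet> e) has_real_derivative (D2 (p + r *\<^sub>R e) *v e) \<bullet> e) (at r within {0..s})"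
        by (simp add: has_real_derivative_iff_has_vector_derivative)
      then show "((\<lambda>s. 2 * c * (norm e)\<^sup>2 * s - D (p + s *\<^sub>R e) \<bullet> e) has_real_derivative
          2 * c * (norm e)\<^sup>2 - (D2 (p + r *\<^sub>R e) *v e) \<bullet> e) (at r within {0..s})"
        by (auto intro!: derivative_eq_intros)
      show "2 * c * (norm e)\<^sup>2 - (D2 (p + r *\<^sub>R e) *v e) \<bullet> e \<le> 0"
        using pos[OF seg[OF r1], of e] by (simp add: inner_commute)
    qed (use s in auto)
    then show ?thesis by simp
  qed
  have "(\<lambda>s. s * (D p \<bullet> e) + c * (norm e)\<^sup>2 * s\<^sup>2 - f (p + s *\<^sub>R e)) 1
      \<le> (\<lambda>s. s * (D p \<bullet> e) + c * (norm e)\<^sup>2 * s\<^sup>2 - f (p + s *\<^sub>R e)) 0"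
  proof (rule nonincreasing_within[where f = "\<lambda>s. s * (D p \<bullet> e) + c * (norm e)\<^sup>2 * s\<^sup>2 - f (p + s *\<^sub>R e)"
        and f' = "\<lambda>s. D p \<bullet> e + 2 * c * (norm e)\<^sup>2 * s - D (p + s *\<^sub>R e) \<bullet> e"])
    fix s :: real assume s: "s \<in> {0..1}"
    have "((\<lambda>r. f (p + r *\<^sub>R e)) has_real_derivative D (p + s *\<^sub>R e) \<bullet> e) (at s within {0..1})"
      using df[OF s] by (simp add: has_real_derivative_iff_has_vector_derivative)
    then show "((\<lambda>s. s * (D p \<bullet> e) + c * (norm e)\<^sup>2 * s\<^sup>2 - f (p + s *\<^sub>R e)) has_real_derivative
        D p \<bullet> e + 2 * c * (norm e)\<^sup>2 * s - D (p + s *\<^sub>R e) \<bullet> e) (at s within {0..1})"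
      by (auto intro!: derivative_eq_intros)
    show "D p \<bullet> e + 2 * c * (norm e)\<^sup>2 * s - D (p + s *\<^sub>R e) \<bullet> e \<le> 0" using incr[OF s] by simp
  qed auto
  then show "c * (norm (q - p))\<^sup>2 \<le> f q - f p - D p \<bullet> (q - p)" by (simp add: e_def)
qed

section \<open>The Hamiltonian as a supremum of affine functions\<close>

context
  fixes L :: "'d::finite \<Rightarrow> real ^ 'd \<Rightarrow> real" and \<kappa> M :: real
  assumes L_cont: "\<And>x. continuous_on (ctrl_set \<kappa> M) (L x)"
    and unique_maximizer: "\<And>x p. \<exists>!a. is_maximizer \<kappa> M L x p a"
begin

lemma opt_ctrl_maximizer: "is_maximizer \<kappa> M L x p (opt_ctrl \<kappa> M L x p)"
  unfolding opt_ctrl_def by (rule theI'[OF unique_maximizer])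

lemma opt_ctrl_in: "opt_ctrl \<kappa> M L x p \<in> ctrl_set \<kappa> M"
  using opt_ctrl_maximizer[of x p] by (simp add: is_maximizer_def)

lemma Ham_eq: "Ham \<kappa> M L x p = - (opt_ctrl \<kappa> M L x p \<bullet> p) - L x (opt_ctrl \<kappa> M L x p)"
  unfolding Ham_def
proof (rule cSup_eq_maximum)
  show "- (opt_ctrl \<kappa> M L x p \<bullet> p) - L x (opt_ctrl \<kappa> M L x p) \<in> (\<lambda>a. - (a \<bullet> p) - L x a) ` ctrl_set \<kappa> M"
    by (rule imageI[OF opt_ctrl_in])
qed (use opt_ctrl_maximizer[of x p] in \<open>auto simp: is_maximizer_def\<close>)

lemma Ham_ge: "a \<in> ctrl_set \<kappa> M \<Longrightarrow> - (a \<bullet> p) - L x a \<le> Ham \<kappa> M L x p"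
  using opt_ctrl_maximizer[of x p] by (simp add: is_maximizer_def Ham_eq)

text \<open>The maximizer at \<open>p\<close> is still a competitor at \<open>q\<close>, so the
  affine function it defines supports the Hamiltonian from below, inside and outside the
  ball.\<close>

lemma Ham_subgradient: "Ham \<kappa> M L x p - opt_ctrl \<kappa> M L x p \<bullet> (q - p) \<le> Ham \<kappa> M L x q"
  using Ham_ge[OF opt_ctrl_in[of x p], of q x] by (simp add: Ham_eq[of x p] inner_diff_right)

lemma norm_opt_ctrl_le: "norm (opt_ctrl \<kappa> M L x p) \<le> real CARD('d) * (\<bar>\<kappa>\<bar> + \<bar>M\<bar>)"
  by (intro norm_le_card_mult ctrl_set_abs_le opt_ctrl_in)

lemma opt_ctrl_ge: "\<kappa> \<le> opt_ctrl \<kappa> M L x p $ j"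
  using opt_ctrl_in[of x p] by (simp add: ctrl_set_def)

lemma Ham_lip: "\<bar>Ham \<kappa> M L x p - Ham \<kappa> M L x q\<bar> \<le> real CARD('d) * (\<bar>\<kappa>\<bar> + \<bar>M\<bar>) * norm (p - q)"
proof -
  have le: "Ham \<kappa> M L x p - Ham \<kappa> M L x q \<le> real CARD('d) * (\<bar>\<kappa>\<bar> + \<bar>M\<bar>) * norm (p - q)" for p q
  proof -
    have "Ham \<kappa> M L x p - Ham \<kappa> M L x q \<le> opt_ctrl \<kappa> M L x p \<bullet> (q - p)" using Ham_subgradient[of x p q] by simp
    also have "\<dots> \<le> norm (opt_ctrl \<kappa> M L x p) * norm (q - p)" by (rule norm_cauchy_schwarz)
    also have "\<dots> \<le> real CARD('d) * (\<bar>\<kappa>\<bar> + \<bar>M\<bar>) * norm (q - p)" by (intro mult_right_mono norm_opt_ctrl_le) auto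
    finally show ?thesis by (simp add: norm_minus_commute)
  qed
  show ?thesis using le[of p q] le[of q p] by (simp add: abs_le_iff norm_minus_commute)
qed

text \<open>At boundary points of the ball the relative derivative does not identify the subgradient, so
  the identity is carried over from the interior by uniqueness of the maximizer.\<close>

lemma opt_ctrl_eq_derivative:
  assumes K: "0 < K"
    and D: "\<And>p. p \<in> cball 0 K \<Longrightarrow> (Ham \<kappa> M L x has_derivative (\<lambda>h. D p \<bullet> h)) (at p within cball 0 K)"
    and cont: "continuous_on (cball 0 K) D" and p: "p \<in> cball 0 K"
  shows "opt_ctrl \<kappa> M L x p = - D p"
proof -
  have interior: "opt_ctrl \<kappa> M L x q = - D q" if q: "norm q < K" for q
  proof -
    \<comment> \<open>By the supporting-plane inequality \<open>?f\<close> has a global minimum at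
      \<open>q\<close>, hence zero derivative there; at an interior point of the ball the relative
      derivative is the full one.\<close>
    let ?f = "\<lambda>r. Ham \<kappa> M L x r + opt_ctrl \<kappa> M L x q \<bullet> (r - q)"
    have "at q within cball 0 K = at q"
      by (rule at_within_interior) (use q in simp)
    then have "(Ham \<kappa> M L x has_derivative (\<lambda>h. D q \<bullet> h)) (at q)" using D[of q] q by simp
    then have "(?f has_derivative (\<lambda>h. D q \<bullet> h + opt_ctrl \<kappa> M L x q \<bullet> h)) (at q)"
      by (auto intro!: derivative_eq_intros)
    moreover have "\<forall>\<^sub>F r in at q. ?f q \<le> ?f r"
      using Ham_subgradient[of x q] by (intro always_eventually allI) (simp add: algebra_simps)
    ultimately have "(\<lambda>h. D q \<bullet> h + opt_ctrl \<kappa> M L x q \<bullet> h) = (\<lambda>h. 0)" by (rule has_derivative_local_min)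
    then have "(D q + opt_ctrl \<kappa> M L x q) \<bullet> h = 0" for h by (simp add: inner_add_left fun_eq_iff)
    then have "D q + opt_ctrl \<kappa> M L x q = 0" using inner_eq_zero_iff by blast
    then show ?thesis by (simp add: eq_neg_iff_add_eq_0 add.commute)
  qed
  \<comment> \<open>A radial sequence in the open ball, where the identity is known. It reaches
    \<open>p\<close> in the limit also when \<open>norm p = K\<close>.\<close>
  define r where "r n = (1 - 1 / real (Suc n)) *\<^sub>R p" for n
  have rK: "norm (r n) < K" for n
  proof -
    have "norm (r n) = (1 - 1 / real (Suc n)) * norm p" by (simp add: r_def)
    also have "\<dots> \<le> (1 - 1 / real (Suc n)) * K" using p by (intro mult_left_mono) auto
    also have "\<dots> < 1 * K" using K by (intro mult_strict_right_mono) auto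
    finally show ?thesis by simp
  qed
  have rlim: "r \<longlonglongrightarrow> p"
  proof -
    have "(\<lambda>n. (1 - 1 / real (Suc n)) *\<^sub>R p) \<longlonglongrightarrow> (1 - 0) *\<^sub>R p"
      by (intro tendsto_intros LIMSEQ_Suc[OF lim_1_over_n])
    then show ?thesis by (simp add: r_def[abs_def])
  qed
  have "(\<lambda>n. D (r n)) \<longlonglongrightarrow> D p"
    by (rule continuous_on_tendsto_compose[OF cont rlim p]) (use rK in \<open>auto intro!: always_eventually less_imp_le\<close>)
  then have alim: "(\<lambda>n. opt_ctrl \<kappa> M L x (r n)) \<longlonglongrightarrow> - D p"
    using interior[OF rK] by (simp add: tendsto_minus)
  have aA: "- D p \<in> ctrl_set \<kappa> M"
    by (rule closed_sequentially[OF compact_imp_closed[OF compact_ctrl_set] _ alim]) (rule opt_ctrl_in)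
  have "(\<lambda>n. L x (opt_ctrl \<kappa> M L x (r n))) \<longlonglongrightarrow> L x (- D p)"
    by (rule continuous_on_tendsto_compose[OF L_cont alim aA]) (use opt_ctrl_in in auto)
  then have 1: "(\<lambda>n. Ham \<kappa> M L x (r n)) \<longlonglongrightarrow> - (- D p \<bullet> p) - L x (- D p)"
    unfolding Ham_eq by (intro tendsto_intros alim rlim)
  have "continuous_on (cball 0 K) (Ham \<kappa> M L x)"
    using D by (rule has_derivative_continuous_on)
  then have 2: "(\<lambda>n. Ham \<kappa> M L x (r n)) \<longlonglongrightarrow> Ham \<kappa> M L x p"
    by (rule continuous_on_tendsto_compose[OF _ rlim p]) (use rK in \<open>auto intro!: always_eventually less_imp_le\<close>)
  have "- (- D p \<bullet> p) - L x (- D p) = Ham \<kappa> M L x p" by (rule LIMSEQ_unique[OF 1 2])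
  then have "is_maximizer \<kappa> M L x p (- D p)" using aA Ham_ge[of _ p x] by (simp add: is_maximizer_def)
  then show ?thesis using unique_maximizer opt_ctrl_maximizer by blast
qed

end

theorem theorem6:
  fixes L F G :: "'d::finite \<Rightarrow> real ^ 'd \<Rightarrow> real"
    and T \<kappa> M K :: real
  defines "H \<equiv> Ham \<kappa> M L"
    and "\<alpha> \<equiv> opt_ctrl \<kappa> M L"
  assumes "T > 0" and "0 < \<kappa>" and "\<kappa> < M"
    and L_cont: "\<And>x. continuous_on (ctrl_set \<kappa> M) (L x)"
    and unique_maximizer: "\<And>x p. \<exists>!a. is_maximizer \<kappa> M L x p a"
    and "K > 0"
    and K_bound: "bounds_value_differences T H F G K"
    and MonF: "Mon F" and MonG: "Mon G"
    and RegF: "RegCost F" and RegG: "RegCost G"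
    and RegH: "RegH K H"
  shows "\<exists>U. classical_solution T H \<alpha> F G U \<and>
             (\<forall>V. classical_solution T H \<alpha> F G V \<longrightarrow>
                (\<forall>t\<in>{0..T}. \<forall>x. \<forall>m\<in>simplex_P. V t x m = U t x m)) \<and>
             regular_solution T H \<alpha> F G U"
proof -
  note max = L_cont unique_maximizer
  let ?B = "cball (0 :: real^'d) K"
  obtain DH :: "'d \<Rightarrow> real ^ 'd \<Rightarrow> real ^ 'd" and D2H :: "'d \<Rightarrow> real ^ 'd \<Rightarrow> real ^ 'd ^ 'd" and CL CP
    where dH: "\<And>x p. p \<in> ?B \<Longrightarrow> (H x has_derivative (\<lambda>h. DH x p \<bullet> h)) (at p within ?B)"
      and dDH: "\<And>x p. p \<in> ?B \<Longrightarrow> (DH x has_derivative (\<lambda>h. D2H x p *v h)) (at p within ?B)"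
      and lipDH: "\<And>x. CL-lipschitz_on ?B (DH x)" and lipD2H: "\<And>x. CL-lipschitz_on ?B (D2H x)"
      and CP: "CP > 0" and posH: "\<And>x p h. p \<in> ?B \<Longrightarrow> inverse CP * (norm h)\<^sup>2 \<le> h \<bullet> (D2H x p *v h)"
    using RegH unfolding RegH_def by blast
  have CL: "0 \<le> CL" using lipDH lipschitz_on_nonneg by blast
  obtain CF AF where CF: "0 \<le> CF" and gF: "\<And>x. simplex_gradient CF (F x) (AF x)"
    and bF: "\<And>x m. m \<in> simplex_P \<Longrightarrow> norm (AF x m) \<le> CF"
    using RegCost_gradient[OF RegF] by blast
  obtain CG AG where CG: "0 \<le> CG" and gG: "\<And>x. simplex_gradient CG (G x) (AG x)"
    and bG: "\<And>x m. m \<in> simplex_P \<Longrightarrow> norm (AG x m) \<le> CG"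
    using RegCost_gradient[OF RegG] by blast
  have \<alpha>_eq: "\<alpha> x p = - DH x p" if "p \<in> ?B" for x p
    unfolding \<alpha>_def
    by (rule opt_ctrl_eq_derivative[OF max \<open>K > 0\<close> dH[unfolded H_def] lipschitz_on_continuous_on[OF lipDH] that])
  have "\<forall>x. \<exists>b. \<forall>p\<in>?B. norm (D2H x p) \<le> b"
  proof
    fix x
    have "compact (D2H x ` ?B)"
      by (intro compact_continuous_image lipschitz_on_continuous_on[OF lipD2H] compact_cball)
    then show "\<exists>b. \<forall>p\<in>?B. norm (D2H x p) \<le> b" by (auto dest!: compact_imp_bounded simp: bounded_iff)
  qed
  then obtain b where b: "\<And>x p. p \<in> ?B \<Longrightarrow> norm (D2H x p) \<le> b x" by metis
  define CB where "CB = (\<Sum>x\<in>UNIV. \<bar>b x\<bar>)"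
  have CB: "0 \<le> CB" by (simp add: CB_def sum_nonneg)
  have bD2: "norm (D2H x p) \<le> CB" if "p \<in> ?B" for x p
  proof -
    have "\<bar>b x\<bar> \<le> CB" unfolding CB_def by (rule member_le_sum) auto
    then show ?thesis using b[OF that, of x] by linarith
  qed
  let ?N = "real CARD('d)"
  define CM where "CM = ?N * (\<bar>\<kappa>\<bar> + \<bar>M\<bar>)"
  have CM: "0 \<le> CM" by (simp add: CM_def)
  \<comment> \<open>One constant for all bounds of the locale; the factors \<open>?N\<close> come
    from estimating matrices acting on vectors componentwise.\<close>
  define C where "C = 1 + CF + CG + CL + ?N * CL + ?N * CB + CM"
  have NC: "0 \<le> ?N * CL" "0 \<le> ?N * CB" using CL CB by auto
  have C: "1 \<le> C" "CF \<le> C" "CG \<le> C" "CL \<le> C" "?N * CL \<le> C" "?N * CB \<le> C" "CM \<le> C"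
    using CF CG CL NC CM by (auto simp: C_def)
  \<comment> \<open>Half of the convexity modulus: the strong convexity inequality loses a factor 2
    against the Hessian bound.\<close>
  define c where "c = inverse CP / 2"
  have c: "0 < c" using CP by (simp add: c_def)
  have pos: "2 * c * (norm h)\<^sup>2 \<le> h \<bullet> (D2H x p *v h)" if "p \<in> ?B" for x p h
    using posH[OF that] by (simp add: c_def)
  \<comment> \<open>Projection to the ball does not increase distances, so \<open>\<beta>\<close>
    inherits the Lipschitz constant of \<open>DH\<close>. Its values remain values of the optimal
    control, which keeps them nonnegative and bounded.\<close>
  define \<beta> where "\<beta> x p = \<alpha> x (closest_point ?B p)" for x p
  have proj: "closest_point ?B p \<in> ?B" for p
    by (rule closest_point_in_set) (use \<open>K > 0\<close> in auto)
  have \<beta>_eq: "\<alpha> x p = \<beta> x p" if "norm p \<le> K" for x p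
    using that by (simp add: \<beta>_def closest_point_self)
  have \<beta>_DH: "\<beta> x p = - DH x p" if "norm p \<le> K" for x p
    using \<beta>_eq[OF that] \<alpha>_eq that by simp
  have exH: "\<bar>H x q - H x p - DH x p \<bullet> (q - p)\<bar> \<le> CL * (norm (q - p))\<^sup>2"
    "norm (DH x q - DH x p - D2H x p *v (q - p)) \<le> ?N * CL * (norm (q - p))\<^sup>2"
    "c * (norm (q - p))\<^sup>2 \<le> H x q - H x p - DH x p \<bullet> (q - p)" if "p \<in> ?B" "q \<in> ?B" for x p q
    using C11_ball_expansion[where f = "H x" and D = "DH x" and ?D2.0 = "D2H x" and C = CL and c = c and K = K and p = p and q = q,
        OF dH dDH lipDH lipD2H pos that] by blast+
  interpret mfg_system T C c K H \<beta> "\<lambda>x p h. D2H x p *v h" F G AF AG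
  proof (rule mfg_system.intro)
    fix x :: 'd and p q h :: "real^'d" and j :: 'd and m
    show "0 < T" "1 \<le> C" "0 < c" "Mon F" "Mon G" "bounds_value_differences T H F G K"
      by (fact \<open>T > 0\<close> C(1) c MonF MonG K_bound)+
    show "\<bar>H x p - H x q\<bar> \<le> C * norm (p - q)"
      using Ham_lip[OF max, of x p q] mult_right_mono[OF C(7), of "norm (p - q)"] by (simp add: H_def CM_def)
    show "0 \<le> \<beta> x p $ j"
      using opt_ctrl_ge[OF max, of x "closest_point ?B p" j] \<open>0 < \<kappa>\<close> by (simp add: \<beta>_def \<alpha>_def)
    show "norm (\<beta> x p) \<le> C"
      using norm_opt_ctrl_le[OF max, of x "closest_point ?B p"] C(7) by (simp add: \<beta>_def \<alpha>_def CM_def)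
    have "norm (\<beta> x p - \<beta> x q) \<le> CL * dist (closest_point ?B p) (closest_point ?B q)"
      using lipschitz_onD[OF lipDH proj proj, of x p q] by (simp add: \<beta>_def \<alpha>_eq[OF proj] dist_norm norm_minus_commute)
    also have "\<dots> \<le> CL * dist p q"
      by (intro mult_left_mono CL closest_point_lipschitz) (use \<open>K > 0\<close> in auto)
    also have "\<dots> \<le> C * dist p q" by (intro mult_right_mono C) auto
    finally show "norm (\<beta> x p - \<beta> x q) \<le> C * norm (p - q)" by (simp add: dist_norm)
    show "linear ((*v) (D2H x p))" by (rule matrix_vector_mul_linear)
    show "simplex_gradient C (F x) (AF x)" by (rule simplex_gradient_mono[OF gF C(2)])
    show "simplex_gradient C (G x) (AG x)" by (rule simplex_gradient_mono[OF gG C(3)])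
    show "norm (AF x m) \<le> C" if "m \<in> simplex_P" using bF[OF that, of x] C(2) by linarith
    show "norm (AG x m) \<le> C" if "m \<in> simplex_P" using bG[OF that, of x] C(3) by linarith
    assume p: "norm p \<le> K"
    then have pB: "p \<in> ?B" by simp
    have "norm (D2H x p *v h) \<le> ?N * (norm (D2H x p) * norm h)" by (rule norm_matrix_vector_le)
    also have "\<dots> \<le> ?N * (CB * norm h)" by (intro mult_left_mono mult_right_mono bD2 pB) auto
    also have "\<dots> \<le> C * norm h" using mult_right_mono[OF C(6), of "norm h"] by (simp add: mult_ac)
    finally show "norm (D2H x p *v h) \<le> C * norm h" .
    have "0 \<le> c * (norm h)\<^sup>2" using c by simp
    then show "c * (norm h)\<^sup>2 \<le> h \<bullet> (D2H x p *v h)" using pos[OF pB, where h = h and x = x] by linarith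
    assume q: "norm q \<le> K"
    then have qB: "q \<in> ?B" by simp
    show "\<bar>H x q - H x p + \<beta> x p \<bullet> (q - p)\<bar> \<le> C * (norm (q - p))\<^sup>2"
      using exH(1)[OF pB qB, of x] mult_right_mono[OF C(4), of "(norm (q - p))\<^sup>2"] by (simp add: \<beta>_DH[OF p])
    have eq: "\<beta> x q - \<beta> x p + D2H x p *v (q - p) = - (DH x q - DH x p - D2H x p *v (q - p))"
      by (simp add: \<beta>_DH[OF p] \<beta>_DH[OF q])
    show "norm (\<beta> x q - \<beta> x p + D2H x p *v (q - p)) \<le> C * (norm (q - p))\<^sup>2"
      unfolding eq norm_minus_cancel
      using exH(2)[OF pB qB, of x] mult_right_mono[OF C(5) zero_le_power2, of "norm (q - p)"] by linarith
    have "norm ((D2H x p - D2H x q) *v h) \<le> ?N * (norm (D2H x p - D2H x q) * norm h)" by (rule norm_matrix_vector_le)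
    also have "\<dots> \<le> ?N * ((CL * norm (p - q)) * norm h)"
      using lipschitz_onD[OF lipD2H pB qB, of x] by (intro mult_left_mono mult_right_mono) (auto simp: dist_norm)
    also have "\<dots> \<le> C * (norm (p - q) * norm h)"
      using mult_right_mono[OF C(5), of "norm (p - q) * norm h"] by (simp add: mult_ac)
    finally show "norm (D2H x p *v h - D2H x q *v h) \<le> C * norm (p - q) * norm h"
      by (simp add: matrix_vector_mult_diff_rdistrib)
    show "c * (norm (q - p))\<^sup>2 \<le> H x q - H x p + \<beta> x p \<bullet> (q - p)"
      using exH(3)[OF pB qB, of x] by (simp add: \<beta>_DH[OF p])
  qed
  obtain Ut DU C' where sol: "classical_solution_with T H \<alpha> F G (\<lambda>t x m. val t m $ x) Ut DU"
    and reg: "\<forall>t\<in>{0..T}. \<forall>x y. C'-lipschitz_on simplex_P (\<lambda>m. DU t x m y)"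
    using master_solution[of \<alpha>] \<beta>_eq by blast
  have U: "classical_solution T H \<alpha> F G (\<lambda>t x m. val t m $ x)"
    unfolding classical_solution_def using sol by blast
  \<comment> \<open>Uniqueness is applied with the original control on the whole space: its rates
    are nonnegative as \<open>\<kappa>\<close> is positive, and \<open>Ham_subgradient\<close> holds
    for all momenta.\<close>
  have "0 \<le> \<alpha> x p $ j" for x p j
    using opt_ctrl_ge[OF max, of x p j] \<open>0 < \<kappa>\<close> by (simp add: \<alpha>_def)
  then have "V t x m = val t m $ x" if "classical_solution T H \<alpha> F G V" "t \<in> {0..T}" "m \<in> simplex_P" for V t x m
    using classical_solutions_agree[of H \<alpha> F G T V _ t m x, OF _ _ MonF MonG that(1) U that(2,3)]
      Ham_subgradient[OF max] unfolding H_def \<alpha>_def by blast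
  moreover have "regular_solution T H \<alpha> F G (\<lambda>t x m. val t m $ x)"
    unfolding regular_solution_def using sol reg by blast
  ultimately show ?thesis using U by blast
qed

end
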